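(* Let $g:\Omega\times[0,T]\times\mathbf{R}\times\mathbf{R}^d\to\mathbf{R}$ be a generator such that $(g(t,y,z))_{t\in[0,T]}$ is progressively measurable for each $(y,z)\in\mathbf{R}\times\mathbf{R}^d$ and such that: (A1) there exists a constant $K\ge 0$ such that $dP\times dt$-a.s., for all $y_1,y_2\in\mathbf{R}$ and $z_1,z_2\in\mathbf{R}^d$, $|g(t,y_1,z_1)-g(t,y_2,z_2)|\le K(|y_1-y_2|+|z_1-z_2|)$; (A2) the process $(g(t,0,0))_{t\in[0,T]}$ satisfies $\mathbf{E}\left[\int_0^T|g(t,0,0)|^2\,dt\right]<\infty$. Let $1\le p<2$. Then for each $(y,z)\in\mathbf{R}\times\mathbf{R}^d$, the equality $$g(t,y,z)=L^p\text{-}\lim_{\varepsilon\to 0^+}\frac{1}{\varepsilon}\left[Y_t\big(g,t+\varepsilon,y+z\cdot(B_{t+\varepsilon}-B_t)\big)-y\right]$$ holds for almost every $t\in[0,T[$.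
   Context: Let $T>0$ be fixed, $(\Omega,\mathcal{F},P)$ a probability space, $(B_t)_{t\ge 0}$ a $d$-dimensional standard Brownian motion on it with $B_0=0$, and $(\mathcal{F}_t)_{t\ge0}$ the augmented natural filtration of $B$, satisfying the usual conditions. $L^2(\mathcal{F}_t)$ is the set of real-valued $\mathcal{F}_t$-measurable random variables $\xi$ with $\mathbf{E}[\xi^2]<\infty$. Progressive measurability is with respect to $(\mathcal{F}_t)$. For $0<T'\le T$ and $\xi\in L^2(\mathcal{F}_{T'})$, the backward stochastic differential equation (BSDE) with parameters $(g,T',\xi)$ is $$y_t=\xi+\int_t^{T'}g(s,y_s,z_s)\,ds-\int_t^{T'}z_s\cdot dB_s,\qquad 0\le t\le T'.$$ Under (A1) and (A2) it has a unique solution (Pardoux–Peng), denoted $(Y_t(g,T',\xi),Z_t(g,T',\xi))_{t\in[0,T']}$, among pairs of progressively measurable processes with $Y$ real-valued, continuous, $\mathbf{E}[\sup_{0\le t\le T'}|Y_t|^2]<\infty$, and $Z$ $\mathbf{R}^d$-valued with $\mathbf{E}[\int_0^{T'}|Z_t|^2dt]<\infty$. In the claim, $Y_t(g,t+\varepsilon,\cdot)$ is the value at time $t$ of the $Y$-component of the solution of the BSDE with terminal time $T'=t+\varepsilon\le T$. $L^p$-$\lim$ denotes the limit in $L^p(\Omega,\mathcal{F},P)$, and "almost every $t$" refers to Lebesgue measure. *)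

theory Defs
  imports "HOL-Probability.Probability"
begin

text \<open>Processes are functions of time and outcome, \<open>X t \<omega>\<close>; only their values at the times
  indicated in each definition matter. A generator is a function \<open>g \<omega> t y z\<close>. The dimension is
  that of the type \<open>real ^ 'd\<close>.\<close>

definition natural_filtration ::
    "'a measure \<Rightarrow> (real \<Rightarrow> 'a \<Rightarrow> real ^ 'd) \<Rightarrow> real \<Rightarrow> 'a measure" where
  "natural_filtration M B t =
     sigma (space M) {B s -` A \<inter> space M | s A. s \<in> {0..t} \<and> A \<in> sets borel}"

definition augmented_filtration ::
    "'a measure \<Rightarrow> (real \<Rightarrow> 'a \<Rightarrow> real ^ 'd) \<Rightarrow> real \<Rightarrow> 'a measure" where
  "augmented_filtration M B t =
     sigma (space M) (sets (natural_filtration M B t) \<union> null_sets M)"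

definition standard_brownian_motion ::
    "'a measure \<Rightarrow> (real \<Rightarrow> 'a \<Rightarrow> real ^ 'd) \<Rightarrow> bool" where
  "standard_brownian_motion M B \<longleftrightarrow>
     (\<forall>t\<ge>0. B t \<in> borel_measurable M) \<and>
     (AE \<omega> in M. B 0 \<omega> = 0) \<and>
     (AE \<omega> in M. continuous_on {0..} (\<lambda>t. B t \<omega>)) \<and>
     (\<forall>s t. 0 \<le> s \<and> s < t \<longrightarrow>
        prob_space.indep_set M (sets (natural_filtration M B s))
          {(\<lambda>\<omega>. B t \<omega> - B s \<omega>) -` A \<inter> space M | A. A \<in> sets borel} \<and>
        prob_space.indep_vars M (\<lambda>_. borel) (\<lambda>i \<omega>. (B t \<omega> - B s \<omega>) $ i) UNIV \<and>
        (\<forall>i. distributed M lborel (\<lambda>\<omega>. (B t \<omega> - B s \<omega>) $ i)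
               (\<lambda>x. ennreal (normal_density 0 (sqrt (t - s)) x))))"

definition progressive ::
    "(real \<Rightarrow> 'a measure) \<Rightarrow> real \<Rightarrow> (real \<Rightarrow> 'a \<Rightarrow> 'b::topological_space) \<Rightarrow> bool" where
  "progressive F T X \<longleftrightarrow>
     (\<forall>t\<in>{0..T}. (\<lambda>(s, \<omega>). X s \<omega>) \<in> borel_measurable (restrict_space borel {0..t} \<Otimes>\<^sub>M F t))"

text \<open>A simple process \<open>\<Sum>i<n. \<eta>\<^sub>i 1\<^bsub>(\<tau>\<^sub>i, \<tau>\<^sub>i\<^sub>+\<^sub>1]\<^esub>\<close> with deterministic times and bounded
  coefficients is given by the data \<open>(n, \<tau>, \<eta>)\<close>.\<close>

type_synonym ('a, 'd) simple_data = "nat \<times> (nat \<Rightarrow> real) \<times> (nat \<Rightarrow> 'a \<Rightarrow> real ^ 'd)"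

definition simple_data :: "(real \<Rightarrow> 'a measure) \<Rightarrow> real \<Rightarrow> ('a, 'd::finite) simple_data \<Rightarrow> bool" where
  "simple_data F T = (\<lambda>(n, \<tau>, \<eta>).
     0 \<le> \<tau> 0 \<and> (\<forall>i<n. \<tau> i < \<tau> (Suc i)) \<and> \<tau> n \<le> T \<and>
     (\<forall>i<n. \<eta> i \<in> borel_measurable (F (\<tau> i)) \<and> (\<exists>C. \<forall>\<omega>\<in>space (F (\<tau> i)). norm (\<eta> i \<omega>) \<le> C)))"

definition simple_process :: "('a, 'd::finite) simple_data \<Rightarrow> real \<Rightarrow> 'a \<Rightarrow> real ^ 'd" where
  "simple_process = (\<lambda>(n, \<tau>, \<eta>) t \<omega>. \<Sum>i<n. indicator {\<tau> i <.. \<tau> (Suc i)} t *\<^sub>R \<eta> i \<omega>)"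

definition simple_integral ::
    "(real \<Rightarrow> 'a \<Rightarrow> real ^ 'd) \<Rightarrow> ('a, 'd::finite) simple_data \<Rightarrow> real \<Rightarrow> 'a \<Rightarrow> real" where
  "simple_integral B = (\<lambda>(n, \<tau>, \<eta>) t \<omega>.
     \<Sum>i<n. \<eta> i \<omega> \<bullet> (B (min t (\<tau> (Suc i))) \<omega> - B (min t (\<tau> i)) \<omega>))"

text \<open>\<open>I\<close> is a continuous version of the Ito integral process \<open>\<integral>\<^sub>0\<^sup>t Z\<^sub>s \<bullet> dB\<^sub>s\<close> on \<open>[0, T]\<close>. By the Ito
  isometry it is unique up to indistinguishability and does not depend on the approximating
  sequence.\<close>

definition ito_integral ::
    "'a measure \<Rightarrow> (real \<Rightarrow> 'a \<Rightarrow> real ^ 'd) \<Rightarrow> real \<Rightarrow> (real \<Rightarrow> 'a \<Rightarrow> real ^ 'd) \<Rightarrow>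
     (real \<Rightarrow> 'a \<Rightarrow> real) \<Rightarrow> bool" where
  "ito_integral M B T Z I \<longleftrightarrow>
     (\<forall>t\<in>{0..T}. I t \<in> borel_measurable (augmented_filtration M B t)) \<and>
     (AE \<omega> in M. continuous_on {0..T} (\<lambda>t. I t \<omega>)) \<and>
     (\<exists>H. (\<forall>k. simple_data (augmented_filtration M B) T (H k)) \<and>
        (\<lambda>k. \<integral>\<^sup>+\<omega>. (\<integral>\<^sup>+t\<in>{0..T}. ennreal ((norm (simple_process (H k) t \<omega> - Z t \<omega>))\<^sup>2) \<partial>lborel) \<partial>M)
           \<longlonglongrightarrow> 0 \<and>
        (\<forall>t\<in>{0..T}.
           (\<lambda>k. \<integral>\<^sup>+\<omega>. ennreal ((simple_integral B (H k) t \<omega> - I t \<omega>)\<^sup>2) \<partial>M) \<longlonglongrightarrow> 0))"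

text \<open>The drift integral is taken over \<open>lebesgue\<close> rather than \<open>lborel\<close>: since \<open>g\<close> is Lipschitz only
  outside a null set, \<open>t \<mapsto> g \<omega> t (Y t \<omega>) (Z t \<omega>)\<close> is in general only almost everywhere equal to a
  Borel function.\<close>

definition bsde_solution ::
    "'a measure \<Rightarrow> (real \<Rightarrow> 'a \<Rightarrow> real ^ 'd) \<Rightarrow> ('a \<Rightarrow> real \<Rightarrow> real \<Rightarrow> real ^ 'd \<Rightarrow> real) \<Rightarrow>
     real \<Rightarrow> ('a \<Rightarrow> real) \<Rightarrow> (real \<Rightarrow> 'a \<Rightarrow> real) \<Rightarrow> (real \<Rightarrow> 'a \<Rightarrow> real ^ 'd) \<Rightarrow> bool" where
  "bsde_solution M B g T \<xi> Y Z \<longleftrightarrow>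
     progressive (augmented_filtration M B) T Y \<and>
     (AE \<omega> in M. continuous_on {0..T} (\<lambda>t. Y t \<omega>)) \<and>
     (\<integral>\<^sup>+\<omega>. (SUP t\<in>{0..T}. ennreal (\<bar>Y t \<omega>\<bar>\<^sup>2)) \<partial>M) < \<infinity> \<and>
     progressive (augmented_filtration M B) T Z \<and>
     (\<integral>\<^sup>+\<omega>. (\<integral>\<^sup>+t\<in>{0..T}. ennreal ((norm (Z t \<omega>))\<^sup>2) \<partial>lborel) \<partial>M) < \<infinity> \<and>
     (AE \<omega> in M. set_integrable lebesgue {0..T} (\<lambda>s. g \<omega> s (Y s \<omega>) (Z s \<omega>))) \<and>
     (\<exists>I. ito_integral M B T Z I \<and>
        (AE \<omega> in M. \<forall>t\<in>{0..T}.
           Y t \<omega> = \<xi> \<omega> + (LINT s:{t..T}|lebesgue. g \<omega> s (Y s \<omega>) (Z s \<omega>)) - (I T \<omega> - I t \<omega>)))"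

definition in_Lp :: "'a measure \<Rightarrow> real \<Rightarrow> ('a \<Rightarrow> real) \<Rightarrow> bool" where
  "in_Lp M p X \<longleftrightarrow> X \<in> borel_measurable M \<and> integrable M (\<lambda>\<omega>. \<bar>X \<omega>\<bar> powr p)"

definition Lp_norm :: "'a measure \<Rightarrow> real \<Rightarrow> ('a \<Rightarrow> real) \<Rightarrow> real" where
  "Lp_norm M p X = (\<integral>\<omega>. \<bar>X \<omega>\<bar> powr p \<partial>M) powr (1 / p)"

definition Lp_tendsto ::
    "'a measure \<Rightarrow> real \<Rightarrow> ('i \<Rightarrow> 'a \<Rightarrow> real) \<Rightarrow> ('a \<Rightarrow> real) \<Rightarrow> 'i filter \<Rightarrow> bool" where
  "Lp_tendsto M p X L F \<longleftrightarrow>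
     in_Lp M p L \<and> (\<forall>\<^sub>F e in F. in_Lp M p (X e)) \<and>
     ((\<lambda>e. Lp_norm M p (\<lambda>\<omega>. X e \<omega> - L \<omega>)) \<longlongrightarrow> 0) F"

end

theory Submission
  imports Defs
begin

text \<open>Put \<open>u = t + \<epsilon>\<close>, \<open>G\<^sub>r = g(r, y, z)\<close> and \<open>\<Phi>\<^sub>r = g(r, Y\<^sub>r, Z\<^sub>r)\<close>. Subtracting the martingale
  \<open>z \<cdot> (B\<^sub>s - B\<^sub>t)\<close> from \<open>Y\<close> gives, for \<open>s \<in> [t, u]\<close>, \<open>Yh\<^sub>s + J\<^sub>s = \<integral>\<^sub>s\<^sup>u \<Phi>\<^sub>r dr\<close> where \<open>Yh\<^sub>s = Y\<^sub>s - y - z \<cdot> (B\<^sub>s - B\<^sub>t)\<close> is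
  \<open>F\<^sub>s\<close>-measurable and \<open>J\<^sub>s = \<integral>\<^sub>s\<^sup>u (Z\<^sub>r - z) \<cdot> dB\<^sub>r\<close> is orthogonal to \<open>L\<^sup>2(F\<^sub>s)\<close>. By Pythagoras and Cauchy-Schwarz both
  summands have second moment at most \<open>\<epsilon> N\<close> with \<open>N = E \<integral>\<^sub>t\<^sup>u \<Phi>\<^sub>r\<^sup>2 dr\<close>. With the Ito isometry and the Lipschitz
  condition this bounds \<open>E \<integral>\<^sub>t\<^sup>u (\<Phi>\<^sub>r - G\<^sub>r)\<^sup>2 dr\<close> by \<open>C (\<epsilon> N + \<epsilon>\<^sup>2)\<close>, so for small \<open>\<epsilon>\<close> the quantity \<open>N\<close> can be absorbed,
  and neither Ito's formula nor conditional expectations are needed. The same orthogonality at \<open>s = t\<close> yields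
  \<open>E ((Y\<^sub>t - y) / \<epsilon> - G\<^sub>t)\<^sup>2 \<le> \<epsilon>\<^sup>-\<^sup>1 E \<integral>\<^sub>t\<^sup>u (\<Phi>\<^sub>r - G\<^sub>t)\<^sup>2 dr\<close>, which tends to \<open>0\<close> whenever \<open>t\<close> is a Lebesgue point of
  \<open>r \<mapsto> G\<^sub>r \<in> L\<^sup>2\<close>. Hence the limit even holds in \<open>L\<^sup>2\<close>.\<close>

text \<open>Two null sets shape the argument. The Lipschitz condition holds only outside a null set
  of the product space, so \<open>g\<close> is traded for a generator \<open>f\<close> that is
  Lipschitz everywhere. This keeps joint measurability but may destroy adaptedness, whereas
  orthogonality at time \<open>t\<close> requires an \<open>F t\<close>-measurable candidate for the
  limit. Hence \<open>g\<close> itself stays the limit, and \<open>f\<close> serves in the integrals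
  and, almost surely, at the fixed time \<open>t\<close>. The exceptional set of times, on the other
  hand, has to be chosen before any solution is given; it depends on the generator and on
  \<open>(y, z)\<close> alone. As \<open>M\<close> is arbitrary, its space of square integrable
  variables may be nonseparable, so the scalar differentiation theorem does not yield Lebesgue
  points by itself. Joint measurability provides a countable family that approximates all sections.
  At a Lebesgue point the energy of \<open>G\<close> over the short interval tends to 0. The error
  \<open>\<Phi> - G\<close> therefore has energy \<open>\<epsilon>\<close> times a vanishing
  quantity, which survives the division by \<open>\<epsilon>\<close>.\<close>

definition sq_integrable :: "'a measure \<Rightarrow> ('a \<Rightarrow> real) \<Rightarrow> bool" where
  "sq_integrable M X \<longleftrightarrow> X \<in> borel_measurable M \<and> integrable M (\<lambda>\<omega>. (X \<omega>)\<^sup>2)"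

lemma sq_integrable_measurable: "sq_integrable M X \<Longrightarrow> X \<in> borel_measurable M"
  by (simp add: sq_integrable_def)

lemma sq_integrable_iff_nn_integral:
  assumes "X \<in> borel_measurable M"
  shows "sq_integrable M X \<longleftrightarrow> (\<integral>\<^sup>+\<omega>. ennreal ((X \<omega>)\<^sup>2) \<partial>M) < \<infinity>"
  using assms by (auto simp: sq_integrable_def integrable_iff_bounded)

lemma sq_integrable_mult:
  assumes "sq_integrable M X" "sq_integrable M Y"
  shows "integrable M (\<lambda>\<omega>. X \<omega> * Y \<omega>)"
proof (rule Bochner_Integration.integrable_bound)
  show "integrable M (\<lambda>\<omega>. (X \<omega>)\<^sup>2 + (Y \<omega>)\<^sup>2)"
    using assms by (auto simp: sq_integrable_def)
  show "(\<lambda>\<omega>. X \<omega> * Y \<omega>) \<in> borel_measurable M"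
    using assms by (auto simp: sq_integrable_def)
  have "\<bar>X \<omega> * Y \<omega>\<bar> \<le> (X \<omega>)\<^sup>2 + (Y \<omega>)\<^sup>2" for \<omega>
  proof -
    have "2 * (\<bar>X \<omega>\<bar> * \<bar>Y \<omega>\<bar>) \<le> (X \<omega>)\<^sup>2 + (Y \<omega>)\<^sup>2"
      using sum_squares_bound[of "\<bar>X \<omega>\<bar>" "\<bar>Y \<omega>\<bar>"] by simp
    moreover have "0 \<le> \<bar>X \<omega>\<bar> * \<bar>Y \<omega>\<bar>" by simp
    ultimately show ?thesis unfolding abs_mult by linarith
  qed
  then show "AE \<omega> in M. norm (X \<omega> * Y \<omega>) \<le> norm ((X \<omega>)\<^sup>2 + (Y \<omega>)\<^sup>2)"
    by auto
qed

lemma sq_integrable_zero: "sq_integrable M (\<lambda>\<omega>. 0)"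
  by (simp add: sq_integrable_def)

lemma sq_integrable_add:
  assumes "sq_integrable M X" "sq_integrable M Y"
  shows "sq_integrable M (\<lambda>\<omega>. X \<omega> + Y \<omega>)"
proof -
  have "integrable M (\<lambda>\<omega>. (X \<omega>)\<^sup>2 + (Y \<omega>)\<^sup>2 + 2 * (X \<omega> * Y \<omega>))"
    using assms sq_integrable_mult[OF assms] by (auto simp: sq_integrable_def)
  then show ?thesis using assms by (auto simp: sq_integrable_def power2_sum mult.assoc)
qed

lemma sq_integrable_cmult:
  assumes "sq_integrable M X"
  shows "sq_integrable M (\<lambda>\<omega>. c * X \<omega>)"
  using assms by (auto simp: sq_integrable_def power_mult_distrib)

lemma sq_integrable_diff:
  assumes "sq_integrable M X" "sq_integrable M Y"
  shows "sq_integrable M (\<lambda>\<omega>. X \<omega> - Y \<omega>)"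
  using sq_integrable_add[OF assms(1) sq_integrable_cmult[OF assms(2), of "-1"]] by simp

lemma sq_integrable_sum:
  assumes "\<And>i. i \<in> S \<Longrightarrow> sq_integrable M (X i)"
  shows "sq_integrable M (\<lambda>\<omega>. \<Sum>i\<in>S. X i \<omega>)"
  using assms by (induction S rule: infinite_finite_induct) (auto intro: sq_integrable_zero sq_integrable_add)

lemma sq_integrable_bounded_mult:
  assumes X: "sq_integrable M X" and Y[measurable]: "Y \<in> borel_measurable M"
    and bd: "\<And>\<omega>. \<omega> \<in> space M \<Longrightarrow> \<bar>Y \<omega>\<bar> \<le> C"
  shows "sq_integrable M (\<lambda>\<omega>. Y \<omega> * X \<omega>)"
proof -
  have [measurable]: "X \<in> borel_measurable M" and i: "integrable M (\<lambda>\<omega>. (X \<omega>)\<^sup>2)"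
    using X by (auto simp: sq_integrable_def)
  have "integrable M (\<lambda>\<omega>. (Y \<omega> * X \<omega>)\<^sup>2)"
  proof (rule Bochner_Integration.integrable_bound)
    show "integrable M (\<lambda>\<omega>. C\<^sup>2 * (X \<omega>)\<^sup>2)" using i by simp
    have "(Y \<omega>)\<^sup>2 * (X \<omega>)\<^sup>2 \<le> C\<^sup>2 * (X \<omega>)\<^sup>2" if "\<omega> \<in> space M" for \<omega>
      using bd[OF that] by (intro mult_right_mono) (auto intro: abs_le_square_iff[THEN iffD1])
    then show "AE \<omega> in M. norm ((Y \<omega> * X \<omega>)\<^sup>2) \<le> norm (C\<^sup>2 * (X \<omega>)\<^sup>2)"
      by (intro AE_I2) (simp add: power_mult_distrib)
  qed simp
  then show ?thesis by (simp add: sq_integrable_def)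
qed

lemma (in prob_space) sq_integrable_const: "sq_integrable M (\<lambda>\<omega>. c)"
  by (simp add: sq_integrable_def)

lemma (in prob_space) sq_integrable_imp_integrable:
  assumes "sq_integrable M X" shows "integrable M X"
  using sq_integrable_mult[OF assms sq_integrable_const[of 1]] by simp

section \<open>Brownian increments and the augmented filtration\<close>

locale brownian_motion = prob_space M for M :: "'a measure" +
  fixes B :: "real \<Rightarrow> 'a \<Rightarrow> real ^ 'd"
  assumes brownian: "standard_brownian_motion M B"
begin

abbreviation F :: "real \<Rightarrow> 'a measure" where "F \<equiv> augmented_filtration M B"

lemma B_measurable: "0 \<le> t \<Longrightarrow> B t \<in> borel_measurable M"
  using brownian by (auto simp: standard_brownian_motion_def)

lemma space_natural_filtration: "space (natural_filtration M B t) = space M"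
  unfolding natural_filtration_def by (rule space_measure_of) auto

lemma sets_natural_filtration:
  "sets (natural_filtration M B t) =
     sigma_sets (space M) {B s -` A \<inter> space M | s A. s \<in> {0..t} \<and> A \<in> sets borel}"
  unfolding natural_filtration_def by (rule sets_measure_of) auto

lemma sets_natural_filtration_subset: "sets (natural_filtration M B t) \<subseteq> sets M"
  unfolding sets_natural_filtration
  by (rule sets.sigma_sets_subset) (auto intro: measurable_sets[OF B_measurable])

lemma space_F [simp]: "space (F t) = space M"
  unfolding augmented_filtration_def
  by (rule space_measure_of)
    (use sets_natural_filtration_subset[of t] sets.space_closed[of M] in \<open>auto simp: null_sets_def\<close>)

lemma sets_F:
  "sets (F t) = sigma_sets (space M) (sets (natural_filtration M B t) \<union> null_sets M)"
  unfolding augmented_filtration_def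
  by (rule sets_measure_of)
    (use sets_natural_filtration_subset[of t] sets.space_closed[of M] in \<open>auto simp: null_sets_def\<close>)

lemma sets_F_subset: "sets (F t) \<subseteq> sets M"
  unfolding sets_F
  by (rule sets.sigma_sets_subset) (use sets_natural_filtration_subset in auto)

lemma subalgebra_F: "subalgebra M (F t)"
  using sets_F_subset by (auto simp: subalgebra_def)

lemma F_measurable: "X \<in> measurable (F t) N \<Longrightarrow> X \<in> measurable M N"
  by (rule measurable_from_subalg[OF subalgebra_F])

lemma sets_F_mono: "s \<le> t \<Longrightarrow> sets (F s) \<subseteq> sets (F t)"
  unfolding sets_F sets_natural_filtration
  by (intro sigma_sets_mono' Un_mono order_refl) fastforce

lemma F_measurable_mono: "X \<in> measurable (F s) N \<Longrightarrow> s \<le> t \<Longrightarrow> X \<in> measurable (F t) N"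
  by (rule measurable_from_subalg[of "F t" "F s"]) (auto simp: subalgebra_def dest: sets_F_mono)

lemma B_F_measurable: "0 \<le> s \<Longrightarrow> s \<le> t \<Longrightarrow> B s \<in> borel_measurable (F t)"
  by (rule measurableI) (auto simp: sets_F sets_natural_filtration)

text \<open>The sets that agree almost surely with an event of the natural filtration form a
  sigma-algebra containing all null sets, hence all of \<open>F s\<close>. Brownian motion is
  defined by independence from the natural filtration; this carries the independence over to the
  augmented one.\<close>

lemma F_AE_eq_natural_filtration:
  assumes "A \<in> sets (F s)"
  shows "\<exists>A'\<in>sets (natural_filtration M B s). AE \<omega> in M. \<omega> \<in> A \<longleftrightarrow> \<omega> \<in> A'"
  using assms unfolding sets_F
proof (induction rule: sigma_sets.induct)
  case (Basic a)
  then show ?case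
  proof
    assume "a \<in> null_sets M"
    then have "AE \<omega> in M. \<omega> \<notin> a" by (rule AE_not_in)
    then show ?thesis by (intro bexI[of _ "{}"]) auto
  qed auto
next
  case Empty
  then show ?case by (intro bexI[of _ "{}"]) auto
next
  case (Compl a)
  then obtain a' where a': "a' \<in> sets (natural_filtration M B s)"
    and eq: "AE \<omega> in M. \<omega> \<in> a \<longleftrightarrow> \<omega> \<in> a'" by auto
  have "space M - a' \<in> sets (natural_filtration M B s)"
    using sets.compl_sets[OF a'] by (simp only: space_natural_filtration)
  moreover have "AE \<omega> in M. \<omega> \<in> space M - a \<longleftrightarrow> \<omega> \<in> space M - a'"
    using eq by eventually_elim simp
  ultimately show ?case by blast
next
  case (Union a)
  then obtain a' where a': "\<And>i. a' i \<in> sets (natural_filtration M B s)"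
    and eq: "\<And>i. AE \<omega> in M. \<omega> \<in> a i \<longleftrightarrow> \<omega> \<in> a' i"
    by metis
  have "AE \<omega> in M. \<forall>i. \<omega> \<in> a i \<longleftrightarrow> \<omega> \<in> a' i"
    using eq by (simp add: AE_all_countable)
  then have "AE \<omega> in M. \<omega> \<in> (\<Union>i. a i) \<longleftrightarrow> \<omega> \<in> (\<Union>i. a' i)"
    by eventually_elim auto
  moreover have "(\<Union>i. a' i) \<in> sets (natural_filtration M B s)" using a' by auto
  ultimately show ?case by blast
qed

text \<open>Neither \<open>prob a\<close> nor \<open>prob (a \<inter> b)\<close> changes when
  \<open>a\<close> is replaced by an almost surely equal event of the natural filtration.\<close>

lemma indep_set_F_increment:
  assumes "0 \<le> s" "s < t"
  shows "indep_set (sets (F s)) {(\<lambda>\<omega>. B t \<omega> - B s \<omega>) -` A \<inter> space M | A. A \<in> sets borel}"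
proof -
  have *: "indep_set (sets (natural_filtration M B s)) {(\<lambda>\<omega>. B t \<omega> - B s \<omega>) -` A \<inter> space M | A. A \<in> sets borel}"
    using brownian assms by (auto simp: standard_brownian_motion_def)
  have ev: "{(\<lambda>\<omega>. B t \<omega> - B s \<omega>) -` A \<inter> space M | A. A \<in> sets borel} \<subseteq> events"
    using * by (simp only: indep_sets2_eq)
  show ?thesis
  proof (rule indep_setI[OF sets_F_subset ev])
    fix a b assume a: "a \<in> sets (F s)"
      and b: "b \<in> {(\<lambda>\<omega>. B t \<omega> - B s \<omega>) -` A \<inter> space M | A. A \<in> sets borel}"
    obtain a' where a': "a' \<in> sets (natural_filtration M B s)" and eq: "AE \<omega> in M. \<omega> \<in> a \<longleftrightarrow> \<omega> \<in> a'"
      using F_AE_eq_natural_filtration[OF a] by blast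
    have e [measurable]: "a \<in> events" "a' \<in> events" "b \<in> events"
      by (rule subsetD[OF sets_F_subset a], rule subsetD[OF sets_natural_filtration_subset a'], rule subsetD[OF ev b])
    have "prob (a \<inter> b) = prob (a' \<inter> b)"
      by (rule measure_eq_AE) (use eq in auto)
    moreover have "prob a = prob a'"
      by (rule measure_eq_AE) (use eq in auto)
    ultimately show "prob (a \<inter> b) = prob a * prob b"
      using indep_setD[OF * a' b] by simp
  qed
qed

text \<open>The function \<open>f\<close> will be a coordinate of the increment or a product of two
  coordinates. Both generated sigma-algebras lie inside the two independent families.\<close>

lemma indep_var_F_increment:
  fixes X :: "'a \<Rightarrow> real" and f :: "real ^ 'd \<Rightarrow> real"
  assumes st: "0 \<le> s" "s < t" and X: "X \<in> borel_measurable (F s)" and f: "f \<in> borel_measurable borel"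
  shows "indep_var borel X borel (\<lambda>\<omega>. f (B t \<omega> - B s \<omega>))"
proof -
  let ?D = "\<lambda>\<omega>. B t \<omega> - B s \<omega>"
  let ?G = "{?D -` A \<inter> space M | A. A \<in> sets borel}"
  have D: "?D \<in> borel_measurable M"
    using st by (intro borel_measurable_diff B_measurable) auto
  have fD: "(\<lambda>\<omega>. f (?D \<omega>)) \<in> borel_measurable M" using f D by measurable
  have G: "indep_set (sets (F s)) ?G" by (rule indep_set_F_increment[OF st])
  have 1: "sigma_sets (space M) {X -` A \<inter> space M | A. A \<in> sets borel} \<subseteq> sets (F s)"
    using sets.sigma_sets_subset[of "{X -` A \<inter> space M | A. A \<in> sets borel}" "F s"] measurable_sets[OF X] by auto
  have 2: "{(\<lambda>\<omega>. f (?D \<omega>)) -` A \<inter> space M | A. A \<in> sets borel} \<subseteq> ?G"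
  proof safe
    fix A :: "real set" assume "A \<in> sets borel"
    then have "f -` A \<in> sets borel" using measurable_sets[OF f] by simp
    then show "\<exists>C. (\<lambda>\<omega>. f (?D \<omega>)) -` A \<inter> space M = ?D -` C \<inter> space M \<and> C \<in> sets borel"
      by (intro exI[of _ "f -` A"]) auto
  qed
  \<comment> \<open>Preimages of Borel sets under a single map already form a sigma-algebra, so
    closing the family \<open>?G\<close> adds nothing.\<close>
  have "sets (vimage_algebra (space M) ?D borel) = ?G"
    by (rule sets_vimage_algebra2) auto
  then have "sigma_sets (space M) ?G = ?G"
    using sets.sigma_sets_eq[of "vimage_algebra (space M) ?D borel"] by simp
  with sigma_sets_mono'[OF 2, of "space M"]
  have 4: "sigma_sets (space M) {(\<lambda>\<omega>. f (?D \<omega>)) -` A \<inter> space M | A. A \<in> sets borel} \<subseteq> ?G"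
    by (rule ord_le_eq_trans)
  have "indep_set (sigma_sets (space M) {X -` A \<inter> space M | A. A \<in> sets borel})
      (sigma_sets (space M) {(\<lambda>\<omega>. f (?D \<omega>)) -` A \<inter> space M | A. A \<in> sets borel})"
  proof (rule indep_setI)
    show "sigma_sets (space M) {X -` A \<inter> space M | A. A \<in> sets borel} \<subseteq> events"
      using 1 sets_F_subset by (rule order_trans)
    have "?G \<subseteq> events" using G by (simp only: indep_sets2_eq)
    with 4 show "sigma_sets (space M) {(\<lambda>\<omega>. f (?D \<omega>)) -` A \<inter> space M | A. A \<in> sets borel} \<subseteq> events"
      by (rule order_trans)
    fix a b assume a: "a \<in> sigma_sets (space M) {X -` A \<inter> space M | A. A \<in> sets borel}"
      and b: "b \<in> sigma_sets (space M) {(\<lambda>\<omega>. f (?D \<omega>)) -` A \<inter> space M | A. A \<in> sets borel}"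
    show "prob (a \<inter> b) = prob a * prob b"
      by (rule indep_setD[OF G subsetD[OF 1 a] subsetD[OF 4 b]])
  qed
  then show ?thesis
    using F_measurable[OF X] fD by (simp only: indep_var_eq)
qed

lemma increment_component:
  assumes st: "0 \<le> s" "s < t"
  shows sq_integrable_increment: "sq_integrable M (\<lambda>\<omega>. (B t \<omega> - B s \<omega>) $ i)"
    and expectation_increment: "expectation (\<lambda>\<omega>. (B t \<omega> - B s \<omega>) $ i) = 0"
    and expectation_increment_square: "expectation (\<lambda>\<omega>. ((B t \<omega> - B s \<omega>) $ i)\<^sup>2) = t - s"
proof -
  let ?D = "\<lambda>\<omega>. (B t \<omega> - B s \<omega>) $ i"
  let ?s = "sqrt (t - s)"
  have pos: "0 < ?s" using st by simp
  have D: "distributed M lborel ?D (\<lambda>x. ennreal (normal_density 0 ?s x))"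
    using brownian st by (auto simp: standard_brownian_motion_def)
  have "integrable lborel (\<lambda>x. normal_density 0 ?s x * x\<^sup>2)"
    using integrable_normal_moment[OF pos, of 0 2] by simp
  then have "integrable M (\<lambda>\<omega>. (?D \<omega>)\<^sup>2)"
    using distributed_integrable[OF D, of "\<lambda>x. x\<^sup>2"] by simp
  moreover have "?D \<in> borel_measurable M"
    using distributed_measurable[OF D] by simp
  ultimately show "sq_integrable M ?D" by (simp add: sq_integrable_def)
  show 0: "expectation ?D = 0"
    using normal_distributed_expectation[OF pos D] .
  show "expectation (\<lambda>\<omega>. (?D \<omega>)\<^sup>2) = t - s"
    using normal_distributed_variance[OF pos D] 0 st by simp
qed

lemma expectation_increment_mult:
  assumes st: "0 \<le> s" "s < t"
  shows "expectation (\<lambda>\<omega>. (B t \<omega> - B s \<omega>) $ i * (B t \<omega> - B s \<omega>) $ j) = (if i = j then t - s else 0)"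
proof (cases "i = j")
  case True
  then show ?thesis using expectation_increment_square[OF st, of j] by (simp add: power2_eq_square)
next
  case False
  let ?D = "\<lambda>i \<omega>. (B t \<omega> - B s \<omega>) $ i"
  have "indep_vars (\<lambda>_. borel) ?D UNIV"
    using brownian st by (auto simp: standard_brownian_motion_def)
  then have "indep_vars (\<lambda>_. borel) ?D {i, j}"
    by (rule indep_vars_subset) simp
  then have "expectation (\<lambda>\<omega>. \<Prod>k\<in>{i, j}. ?D k \<omega>) = (\<Prod>k\<in>{i, j}. expectation (?D k))"
    using False by (intro indep_vars_lebesgue_integral)
      (use sq_integrable_imp_integrable[OF sq_integrable_increment[OF st]] in auto)
  then show ?thesis using False expectation_increment[OF st] by simp
qed

text \<open>Independence is available for \<open>s < t\<close>; for \<open>s = t\<close> the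
  increment vanishes and all four claims are trivial. Admitting this case spares the later
  partitions a separate treatment of degenerate intervals.\<close>

lemma
  fixes X :: "'a \<Rightarrow> real"
  assumes st: "0 \<le> s" "s \<le> t" and X: "X \<in> borel_measurable (F s)" and i: "integrable M X"
  shows integrable_F_mult_increment: "integrable M (\<lambda>\<omega>. X \<omega> * (B t \<omega> - B s \<omega>) $ i)"
    and expectation_F_mult_increment: "expectation (\<lambda>\<omega>. X \<omega> * (B t \<omega> - B s \<omega>) $ i) = 0"
    and integrable_F_mult_increments: "integrable M (\<lambda>\<omega>. X \<omega> * ((B t \<omega> - B s \<omega>) $ i * (B t \<omega> - B s \<omega>) $ j))"
    and expectation_F_mult_increments: "expectation (\<lambda>\<omega>. X \<omega> * ((B t \<omega> - B s \<omega>) $ i * (B t \<omega> - B s \<omega>) $ j))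
         = (if i = j then (t - s) * expectation X else 0)"
proof -
  note sq = sq_integrable_increment[OF st(1)]
  have "integrable M (\<lambda>\<omega>. X \<omega> * (B t \<omega> - B s \<omega>) $ i) \<and> expectation (\<lambda>\<omega>. X \<omega> * (B t \<omega> - B s \<omega>) $ i) = 0
     \<and> integrable M (\<lambda>\<omega>. X \<omega> * ((B t \<omega> - B s \<omega>) $ i * (B t \<omega> - B s \<omega>) $ j))
     \<and> expectation (\<lambda>\<omega>. X \<omega> * ((B t \<omega> - B s \<omega>) $ i * (B t \<omega> - B s \<omega>) $ j))
         = (if i = j then (t - s) * expectation X else 0)"
  proof (cases "s < t")
    case True
    have m: "indep_var borel X borel (\<lambda>\<omega>. (B t \<omega> - B s \<omega>) $ i)"
      "indep_var borel X borel (\<lambda>\<omega>. (B t \<omega> - B s \<omega>) $ i * (B t \<omega> - B s \<omega>) $ j)"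
      using indep_var_F_increment[OF st(1) True X, of "\<lambda>x. x $ i"]
        indep_var_F_increment[OF st(1) True X, of "\<lambda>x. x $ i * x $ j"] by simp_all
    have n: "integrable M (\<lambda>\<omega>. (B t \<omega> - B s \<omega>) $ i)"
      "integrable M (\<lambda>\<omega>. (B t \<omega> - B s \<omega>) $ i * (B t \<omega> - B s \<omega>) $ j)"
      using sq[OF True] sq_integrable_imp_integrable sq_integrable_mult by blast+
    show ?thesis
      using indep_var_integrable[OF m(1) i n(1)] indep_var_lebesgue_integral[OF m(1) i n(1)]
        indep_var_integrable[OF m(2) i n(2)] indep_var_lebesgue_integral[OF m(2) i n(2)]
        expectation_increment[OF st(1) True] expectation_increment_mult[OF st(1) True, of i j]
      by simp
  next
    case False
    then show ?thesis using st by simp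
  qed
  then show "integrable M (\<lambda>\<omega>. X \<omega> * (B t \<omega> - B s \<omega>) $ i)"
    "expectation (\<lambda>\<omega>. X \<omega> * (B t \<omega> - B s \<omega>) $ i) = 0"
    "integrable M (\<lambda>\<omega>. X \<omega> * ((B t \<omega> - B s \<omega>) $ i * (B t \<omega> - B s \<omega>) $ j))"
    "expectation (\<lambda>\<omega>. X \<omega> * ((B t \<omega> - B s \<omega>) $ i * (B t \<omega> - B s \<omega>) $ j))
         = (if i = j then (t - s) * expectation X else 0)"
    by blast+
qed

end

section \<open>Elementary stochastic integrals\<close>

context brownian_motion
begin

text \<open>Boundedness keeps the product of a coefficient with a square integrable increment square
  integrable.\<close>

definition bounded_F :: "real \<Rightarrow> ('a \<Rightarrow> real ^ 'd) \<Rightarrow> bool" where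
  "bounded_F a \<eta> \<longleftrightarrow> \<eta> \<in> borel_measurable (F a) \<and> (\<exists>C. \<forall>\<omega>\<in>space M. norm (\<eta> \<omega>) \<le> C)"

text \<open>The stochastic integral of the one-step integrand with value \<open>\<eta>\<close>
  between \<open>a\<close> and \<open>b\<close>.\<close>

definition increment :: "('a \<Rightarrow> real ^ 'd) \<Rightarrow> real \<Rightarrow> real \<Rightarrow> 'a \<Rightarrow> real" where
  "increment \<eta> a b \<omega> = \<eta> \<omega> \<bullet> (B b \<omega> - B a \<omega>)"

lemma bounded_F_mono: "bounded_F a \<eta> \<Longrightarrow> a \<le> b \<Longrightarrow> bounded_F b \<eta>"
  by (auto simp: bounded_F_def intro: F_measurable_mono)

lemma bounded_F_const: "bounded_F a (\<lambda>\<omega>. c)"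
  by (auto simp: bounded_F_def)

lemma component_measurable [measurable (raw)]:
  "f \<in> borel_measurable N \<Longrightarrow> (\<lambda>\<omega>. (f \<omega> :: real ^ 'd) $ i) \<in> borel_measurable N"
  using borel_measurable_inner[of f N "\<lambda>_. axis i 1"] by (simp add: inner_axis)

lemma bounded_F_component:
  assumes "bounded_F a \<eta>"
  shows "(\<lambda>\<omega>. \<eta> \<omega> $ i) \<in> borel_measurable (F a)" "\<exists>C. \<forall>\<omega>\<in>space M. \<bar>\<eta> \<omega> $ i\<bar> \<le> C"
  using assms unfolding bounded_F_def
  by (auto intro: component_measurable order_trans[OF component_le_norm_cart])

lemma increment_component_sum:
  "increment \<eta> a b \<omega> = (\<Sum>i\<in>UNIV. \<eta> \<omega> $ i * (B b \<omega> - B a \<omega>) $ i)"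
  by (simp add: increment_def inner_vec_def)

lemma increment_measurable:
  assumes "0 \<le> a" "a \<le> b" "bounded_F a \<eta>"
  shows "increment \<eta> a b \<in> borel_measurable (F b)"
proof -
  have [measurable]: "\<eta> \<in> borel_measurable (F b)" "B a \<in> borel_measurable (F b)" "B b \<in> borel_measurable (F b)"
    using assms bounded_F_mono[OF assms(3,2)] by (auto simp: bounded_F_def intro: B_F_measurable)
  show ?thesis unfolding increment_def[abs_def] by measurable
qed

lemma increment_sq_integrable:
  assumes "0 \<le> a" "a \<le> b" "bounded_F a \<eta>"
  shows "sq_integrable M (increment \<eta> a b)"
proof -
  have "sq_integrable M (\<lambda>\<omega>. \<eta> \<omega> $ i * (B b \<omega> - B a \<omega>) $ i)" for i
  proof -
    obtain C where C: "\<forall>\<omega>\<in>space M. \<bar>\<eta> \<omega> $ i\<bar> \<le> C" using bounded_F_component[OF assms(3)] by blast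
    have D: "sq_integrable M (\<lambda>\<omega>. (B b \<omega> - B a \<omega>) $ i)"
    proof (cases "a = b")
      case True
      then show ?thesis using sq_integrable_zero by simp
    next
      case False
      then show ?thesis using assms by (intro sq_integrable_increment) auto
    qed
    show ?thesis
      by (rule sq_integrable_bounded_mult[OF D F_measurable[OF bounded_F_component(1)[OF assms(3)]]])
        (use C in auto)
  qed
  then show ?thesis
    unfolding increment_component_sum[abs_def] by (rule sq_integrable_sum)
qed

lemma F_mult_component_integrable:
  assumes "X \<in> borel_measurable (F a)" "integrable M X" "bounded_F a \<eta>"
  shows "(\<lambda>\<omega>. X \<omega> * \<eta> \<omega> $ i) \<in> borel_measurable (F a)" "integrable M (\<lambda>\<omega>. X \<omega> * \<eta> \<omega> $ i)"
proof -
  have [measurable]: "X \<in> borel_measurable (F a)" "(\<lambda>\<omega>. \<eta> \<omega> $ i) \<in> borel_measurable (F a)"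
    using assms bounded_F_component by auto
  show 1: "(\<lambda>\<omega>. X \<omega> * \<eta> \<omega> $ i) \<in> borel_measurable (F a)" by measurable
  obtain C where C: "\<forall>\<omega>\<in>space M. \<bar>\<eta> \<omega> $ i\<bar> \<le> C" using bounded_F_component[OF assms(3)] by blast
  show "integrable M (\<lambda>\<omega>. X \<omega> * \<eta> \<omega> $ i)"
  proof (rule Bochner_Integration.integrable_bound)
    show "integrable M (\<lambda>\<omega>. C * X \<omega>)" using assms by simp
    show "(\<lambda>\<omega>. X \<omega> * \<eta> \<omega> $ i) \<in> borel_measurable M" using 1 by (rule F_measurable)
    have "\<bar>X \<omega>\<bar> * \<bar>\<eta> \<omega> $ i\<bar> \<le> \<bar>C\<bar> * \<bar>X \<omega>\<bar>" if "\<omega> \<in> space M" for \<omega>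
    proof -
      have "\<bar>\<eta> \<omega> $ i\<bar> \<le> \<bar>C\<bar>" using C that by (meson abs_ge_self order_trans)
      from mult_left_mono[OF this abs_ge_zero[of "X \<omega>"]] show ?thesis by (simp only: mult.commute)
    qed
    then show "AE \<omega> in M. norm (X \<omega> * \<eta> \<omega> $ i) \<le> norm (C * X \<omega>)"
      by (intro AE_I2) (simp add: abs_mult)
  qed
qed

text \<open>Coordinatewise this is an integrable variable known at time \<open>a\<close> times an
  independent centred increment. Thanks to independence mere integrability of \<open>X\<close> is
  enough, so \<open>X\<close> may be a product or an earlier increment.\<close>

lemma F_mult_increment:
  assumes ab: "0 \<le> a" "a \<le> b" and X: "X \<in> borel_measurable (F a)" "integrable M X" and \<eta>: "bounded_F a \<eta>"
  shows "expectation (\<lambda>\<omega>. X \<omega> * increment \<eta> a b \<omega>) = 0"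
proof -
  note c = F_mult_component_integrable[OF X \<eta>]
  have eq: "X \<omega> * increment \<eta> a b \<omega> = (\<Sum>i\<in>UNIV. (X \<omega> * \<eta> \<omega> $ i) * (B b \<omega> - B a \<omega>) $ i)" for \<omega>
    by (simp only: increment_component_sum sum_distrib_left mult.assoc)
  show "expectation (\<lambda>\<omega>. X \<omega> * increment \<eta> a b \<omega>) = 0"
    unfolding eq
    by (subst Bochner_Integration.integral_sum)
      (simp_all only: integrable_F_mult_increment[OF ab c] expectation_F_mult_increment[OF ab c] sum.neutral_const)
qed

text \<open>Expanding both inner products gives a double sum over coordinates. The covariance matrix
  of the increment is \<open>b - a\<close> times the identity, so only the diagonal
  survives.\<close>

lemma expectation_increment_same:
  assumes ab: "0 \<le> a" "a \<le> b" and \<eta>: "bounded_F a \<eta>" and \<theta>: "bounded_F a \<theta>"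
  shows "expectation (\<lambda>\<omega>. increment \<eta> a b \<omega> * increment \<theta> a b \<omega>) = (b - a) * expectation (\<lambda>\<omega>. \<eta> \<omega> \<bullet> \<theta> \<omega>)"
proof -
  have i: "integrable M (\<lambda>\<omega>. \<eta> \<omega> $ i)" for i
  proof -
    obtain C where "\<forall>\<omega>\<in>space M. \<bar>\<eta> \<omega> $ i\<bar> \<le> C" using bounded_F_component[OF \<eta>] by blast
    then show ?thesis
      by (intro integrable_const_bound[of _ C] F_measurable[OF bounded_F_component(1)[OF \<eta>]]) auto
  qed
  note c = F_mult_component_integrable[OF bounded_F_component(1)[OF \<eta>] i \<theta>]
  have eq: "increment \<eta> a b \<omega> * increment \<theta> a b \<omega> =
      (\<Sum>i\<in>UNIV. \<Sum>j\<in>UNIV. (\<eta> \<omega> $ i * \<theta> \<omega> $ j) * ((B b \<omega> - B a \<omega>) $ i * (B b \<omega> - B a \<omega>) $ j))" for \<omega>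
    by (simp only: increment_component_sum sum_product mult_ac)
  have "expectation (\<lambda>\<omega>. increment \<eta> a b \<omega> * increment \<theta> a b \<omega>) =
      (\<Sum>i\<in>UNIV. \<Sum>j\<in>UNIV. if i = j then (b - a) * expectation (\<lambda>\<omega>. \<eta> \<omega> $ i * \<theta> \<omega> $ j) else 0)"
    unfolding eq
    by (simp only: Bochner_Integration.integral_sum Bochner_Integration.integrable_sum
        integrable_F_mult_increments[OF ab c] expectation_F_mult_increments[OF ab c])
  also have "\<dots> = (b - a) * (\<Sum>i\<in>UNIV. expectation (\<lambda>\<omega>. \<eta> \<omega> $ i * \<theta> \<omega> $ i))"
    by (simp add: sum_distrib_left)
  also have "(\<Sum>i\<in>UNIV. expectation (\<lambda>\<omega>. \<eta> \<omega> $ i * \<theta> \<omega> $ i)) = expectation (\<lambda>\<omega>. \<eta> \<omega> \<bullet> \<theta> \<omega>)"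
    unfolding inner_vec_def inner_real_def using c(2) by (simp add: Bochner_Integration.integral_sum)
  finally show ?thesis .
qed

lemma expectation_increment_disjoint:
  assumes "0 \<le> a" "a \<le> b" "b \<le> c" "c \<le> d" "bounded_F a \<eta>" "bounded_F c \<theta>"
  shows "expectation (\<lambda>\<omega>. increment \<eta> a b \<omega> * increment \<theta> c d \<omega>) = 0"
  using assms
  by (intro F_mult_increment)
    (auto intro: F_measurable_mono[OF increment_measurable] sq_integrable_imp_integrable increment_sq_integrable)

lemma increment_split: "increment \<eta> a c \<omega> = increment \<eta> a b \<omega> + increment \<eta> b c \<omega>"
  by (simp add: increment_def algebra_simps)

text \<open>Cutting at \<open>c\<close> and at \<open>m = min b d\<close> leaves pieces that are
  pairwise identical, disjoint or degenerate; only the common piece from \<open>c\<close> to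
  \<open>m\<close> contributes.\<close>

lemma expectation_increment_mult_aux:
  assumes a: "0 \<le> a" "a \<le> b" and c: "a \<le> c" "c \<le> d" and \<eta>: "bounded_F a \<eta>" and \<theta>: "bounded_F c \<theta>"
  shows "expectation (\<lambda>\<omega>. increment \<eta> a b \<omega> * increment \<theta> c d \<omega>)
    = max 0 (min b d - max a c) * expectation (\<lambda>\<omega>. \<eta> \<omega> \<bullet> \<theta> \<omega>)"
proof (cases "b \<le> c")
  case True
  then show ?thesis using expectation_increment_disjoint[OF a True c(2) \<eta> \<theta>] c by simp
next
  case False
  define m where "m = min b d"
  have m: "c \<le> m" "m \<le> b" "m \<le> d" "0 \<le> c" "0 \<le> m" "a \<le> m" using False a c by (auto simp: m_def)
  have \<eta>c: "bounded_F c \<eta>" and \<eta>m: "bounded_F m \<eta>" and \<theta>m: "bounded_F m \<theta>"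
    using \<eta> \<theta> c m by (auto intro: bounded_F_mono)
  let ?x1 = "increment \<eta> a c" and ?x2 = "increment \<eta> c m" and ?x3 = "increment \<eta> m b"
  let ?w1 = "increment \<theta> c m" and ?w2 = "increment \<theta> m d"
  have sq: "sq_integrable M ?x1" "sq_integrable M ?x2" "sq_integrable M ?x3" "sq_integrable M ?w1" "sq_integrable M ?w2"
    using a c m \<eta> \<eta>c \<eta>m \<theta> \<theta>m by (auto intro: increment_sq_integrable)
  note [simp] = sq_integrable_mult[OF sq(1) sq(4)] sq_integrable_mult[OF sq(1) sq(5)]
    sq_integrable_mult[OF sq(2) sq(4)] sq_integrable_mult[OF sq(2) sq(5)]
    sq_integrable_mult[OF sq(3) sq(4)] sq_integrable_mult[OF sq(3) sq(5)]
  have "increment \<eta> a b \<omega> * increment \<theta> c d \<omega> =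
      ?x1 \<omega> * ?w1 \<omega> + ?x1 \<omega> * ?w2 \<omega> + ?x2 \<omega> * ?w1 \<omega> + ?x2 \<omega> * ?w2 \<omega> + ?x3 \<omega> * ?w1 \<omega> + ?x3 \<omega> * ?w2 \<omega>" for \<omega>
    using increment_split[of \<eta> a b \<omega> c] increment_split[of \<eta> c b \<omega> m] increment_split[of \<theta> c d \<omega> m]
    by (simp add: algebra_simps)
  then have "expectation (\<lambda>\<omega>. increment \<eta> a b \<omega> * increment \<theta> c d \<omega>) =
      expectation (\<lambda>\<omega>. ?x1 \<omega> * ?w1 \<omega>) + expectation (\<lambda>\<omega>. ?x1 \<omega> * ?w2 \<omega>) + expectation (\<lambda>\<omega>. ?x2 \<omega> * ?w1 \<omega>)
      + expectation (\<lambda>\<omega>. ?x2 \<omega> * ?w2 \<omega>) + expectation (\<lambda>\<omega>. ?x3 \<omega> * ?w1 \<omega>) + expectation (\<lambda>\<omega>. ?x3 \<omega> * ?w2 \<omega>)"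
    by simp
  also have "expectation (\<lambda>\<omega>. ?x1 \<omega> * ?w1 \<omega>) = 0"
    by (rule expectation_increment_disjoint) (use a c m \<eta> \<theta> in auto)
  also have "expectation (\<lambda>\<omega>. ?x1 \<omega> * ?w2 \<omega>) = 0"
    by (rule expectation_increment_disjoint) (use a c m \<eta> \<theta>m in auto)
  also have "expectation (\<lambda>\<omega>. ?x2 \<omega> * ?w1 \<omega>) = (m - c) * expectation (\<lambda>\<omega>. \<eta> \<omega> \<bullet> \<theta> \<omega>)"
    by (rule expectation_increment_same) (use m \<eta>c \<theta> in auto)
  also have "expectation (\<lambda>\<omega>. ?x2 \<omega> * ?w2 \<omega>) = 0"
    by (rule expectation_increment_disjoint) (use m \<eta>c \<theta>m in auto)
  also have "expectation (\<lambda>\<omega>. ?x3 \<omega> * ?w1 \<omega>) = 0"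
    using expectation_increment_disjoint[of c m m b \<theta> \<eta>] m \<theta> \<eta>m by (simp add: mult.commute)
  \<comment> \<open>One of the two pieces beyond \<open>m\<close> is degenerate, because
    \<open>m\<close> is one of the two right endpoints.\<close>
  also have "expectation (\<lambda>\<omega>. ?x3 \<omega> * ?w2 \<omega>) = 0"
  proof (cases "b \<le> d")
    case True
    then have "m = b" by (simp add: m_def)
    then show ?thesis by (simp add: increment_def)
  next
    case False
    then have "m = d" by (simp add: m_def)
    then show ?thesis by (simp add: increment_def)
  qed
  finally show ?thesis using m c by (simp add: m_def max_def)
qed

lemma expectation_increment_product:
  assumes "0 \<le> a" "a \<le> b" "0 \<le> c" "c \<le> d" "bounded_F a \<eta>" "bounded_F c \<theta>"
  shows "expectation (\<lambda>\<omega>. increment \<eta> a b \<omega> * increment \<theta> c d \<omega>)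
    = max 0 (min b d - max a c) * expectation (\<lambda>\<omega>. \<eta> \<omega> \<bullet> \<theta> \<omega>)"
proof (cases "a \<le> c")
  case True
  then show ?thesis using assms by (intro expectation_increment_mult_aux) auto
next
  case False
  then have "expectation (\<lambda>\<omega>. increment \<theta> c d \<omega> * increment \<eta> a b \<omega>)
    = max 0 (min d b - max c a) * expectation (\<lambda>\<omega>. \<theta> \<omega> \<bullet> \<eta> \<omega>)"
    using assms by (intro expectation_increment_mult_aux) auto
  then show ?thesis by (simp add: mult.commute inner_commute min.commute max.commute)
qed

text \<open>On both sides the pair \<open>(i, j)\<close> is weighted by the length of the overlap of
  the two intervals. Overlaps are allowed on purpose: a constant integrand on a whole interval can
  then be appended to a simple process without refining its partition.\<close>

lemma elementary_isometry:
  fixes a b :: "'i \<Rightarrow> real"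
  assumes J: "finite J" and a: "\<And>i. i \<in> J \<Longrightarrow> 0 \<le> a i" and ab: "\<And>i. i \<in> J \<Longrightarrow> a i \<le> b i"
    and \<eta>: "\<And>i. i \<in> J \<Longrightarrow> bounded_F (a i) (\<eta> i)"
  shows "(\<integral>\<^sup>+\<omega>. (\<integral>\<^sup>+r. ennreal ((norm (\<Sum>i\<in>J. indicator {a i<..b i} r *\<^sub>R \<eta> i \<omega>))\<^sup>2) \<partial>lborel) \<partial>M)
     = (\<integral>\<^sup>+\<omega>. ennreal ((\<Sum>i\<in>J. increment (\<eta> i) (a i) (b i) \<omega>)\<^sup>2) \<partial>M)"
proof -
  define l where "l i j = max 0 (min (b i) (b j) - max (a i) (a j))" for i j
  have sq: "sq_integrable M (increment (\<eta> i) (a i) (b i))" if "i \<in> J" for i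
    by (rule increment_sq_integrable) (use a ab \<eta> that in auto)
  have ii: "integrable M (\<lambda>\<omega>. \<eta> i \<omega> \<bullet> \<eta> j \<omega>)" if ij: "i \<in> J" "j \<in> J" for i j
  proof -
    obtain C where C: "\<forall>\<omega>\<in>space M. norm (\<eta> i \<omega>) \<le> C" using \<eta>[OF ij(1)] by (auto simp: bounded_F_def)
    obtain D where D: "\<forall>\<omega>\<in>space M. norm (\<eta> j \<omega>) \<le> D" using \<eta>[OF ij(2)] by (auto simp: bounded_F_def)
    have [measurable]: "\<eta> i \<in> borel_measurable M" "\<eta> j \<in> borel_measurable M"
      using \<eta>[OF ij(1)] \<eta>[OF ij(2)] by (auto simp: bounded_F_def intro: F_measurable)
    have "\<bar>\<eta> i \<omega> \<bullet> \<eta> j \<omega>\<bar> \<le> C * D" if "\<omega> \<in> space M" for \<omega>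
      using Cauchy_Schwarz_ineq2[of "\<eta> i \<omega>" "\<eta> j \<omega>"] C D that
      by (meson mult_mono norm_ge_zero order_trans)
    then show ?thesis by (intro integrable_const_bound[of _ "C * D"]) auto
  qed
  have inner: "has_bochner_integral lborel (\<lambda>r. (norm (\<Sum>i\<in>J. indicator {a i<..b i} r *\<^sub>R \<eta> i \<omega>))\<^sup>2)
      (\<Sum>i\<in>J. \<Sum>j\<in>J. l i j * (\<eta> i \<omega> \<bullet> \<eta> j \<omega>))" for \<omega>
  proof -
    have eq: "(norm (\<Sum>i\<in>J. indicator {a i<..b i} r *\<^sub>R \<eta> i \<omega>))\<^sup>2 =
        (\<Sum>i\<in>J. \<Sum>j\<in>J. (\<eta> i \<omega> \<bullet> \<eta> j \<omega>) * indicator {max (a i) (a j)<..min (b i) (b j)} r)" for r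
      unfolding power2_norm_eq_inner inner_sum_left inner_sum_right
      by (intro sum.cong refl) (auto simp: indicator_def inner_commute)
    show ?thesis unfolding eq
    proof (intro has_bochner_integral_sum)
      fix i j
      have Ioc: "emeasure lborel {p<..q} < \<infinity>" for p q :: real
        by (cases "p \<le> q") simp_all
      have "has_bochner_integral lborel (indicator {max (a i) (a j)<..min (b i) (b j)} :: real \<Rightarrow> real)
          (measure lborel {max (a i) (a j)<..min (b i) (b j)})"
        by (rule has_bochner_integral_real_indicator[OF _ Ioc]) simp
      moreover have "measure lborel {max (a i) (a j)<..min (b i) (b j)} = l i j"
        by (cases "max (a i) (a j) \<le> min (b i) (b j)") (auto simp: l_def)
      ultimately show "has_bochner_integral lborel
          (\<lambda>r. (\<eta> i \<omega> \<bullet> \<eta> j \<omega>) * indicator {max (a i) (a j)<..min (b i) (b j)} r) (l i j * (\<eta> i \<omega> \<bullet> \<eta> j \<omega>))"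
        by (simp only: mult.commute[of "l i j"] has_bochner_integral_mult_right)
    qed
  qed
  \<comment> \<open>The quadratic form is nonnegative because it is the time integral of a squared
    norm; the individual coefficients do not show this. It permits the passage between
    \<open>ennreal\<close> and real expectations.\<close>
  have nn: "0 \<le> (\<Sum>i\<in>J. \<Sum>j\<in>J. l i j * (\<eta> i \<omega> \<bullet> \<eta> j \<omega>))" for \<omega>
    unfolding has_bochner_integral_integral_eq[OF inner[of \<omega>], symmetric]
    by (rule Bochner_Integration.integral_nonneg) simp
  have "(\<integral>\<^sup>+\<omega>. (\<integral>\<^sup>+r. ennreal ((norm (\<Sum>i\<in>J. indicator {a i<..b i} r *\<^sub>R \<eta> i \<omega>))\<^sup>2) \<partial>lborel) \<partial>M)
      = (\<integral>\<^sup>+\<omega>. ennreal (\<Sum>i\<in>J. \<Sum>j\<in>J. l i j * (\<eta> i \<omega> \<bullet> \<eta> j \<omega>)) \<partial>M)"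
  proof (rule nn_integral_cong)
    fix \<omega>
    show "(\<integral>\<^sup>+r. ennreal ((norm (\<Sum>i\<in>J. indicator {a i<..b i} r *\<^sub>R \<eta> i \<omega>))\<^sup>2) \<partial>lborel)
        = ennreal (\<Sum>i\<in>J. \<Sum>j\<in>J. l i j * (\<eta> i \<omega> \<bullet> \<eta> j \<omega>))"
      unfolding has_bochner_integral_integral_eq[OF inner[of \<omega>], symmetric]
      by (rule nn_integral_eq_integral[OF integrable.intros[OF inner]]) simp
  qed
  also have "\<dots> = ennreal (expectation (\<lambda>\<omega>. \<Sum>i\<in>J. \<Sum>j\<in>J. l i j * (\<eta> i \<omega> \<bullet> \<eta> j \<omega>)))"
    by (rule nn_integral_eq_integral)
      (intro Bochner_Integration.integrable_sum integrable_mult_right ii, assumption+, simp add: nn)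
  also have "expectation (\<lambda>\<omega>. \<Sum>i\<in>J. \<Sum>j\<in>J. l i j * (\<eta> i \<omega> \<bullet> \<eta> j \<omega>))
      = (\<Sum>i\<in>J. \<Sum>j\<in>J. l i j * expectation (\<lambda>\<omega>. \<eta> i \<omega> \<bullet> \<eta> j \<omega>))"
    by (simp only: Bochner_Integration.integral_sum Bochner_Integration.integrable_sum ii
        integrable_mult_right integral_mult_right_zero cong: sum.cong)
  also have "\<dots> = (\<Sum>i\<in>J. \<Sum>j\<in>J. expectation (\<lambda>\<omega>. increment (\<eta> i) (a i) (b i) \<omega> * increment (\<eta> j) (a j) (b j) \<omega>))"
    using a ab \<eta> by (intro sum.cong refl) (simp add: l_def expectation_increment_product)
  also have "\<dots> = expectation (\<lambda>\<omega>. \<Sum>i\<in>J. \<Sum>j\<in>J. increment (\<eta> i) (a i) (b i) \<omega> * increment (\<eta> j) (a j) (b j) \<omega>)"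
    by (simp only: Bochner_Integration.integral_sum Bochner_Integration.integrable_sum sq_integrable_mult sq
        cong: sum.cong)
  also have "\<dots> = expectation (\<lambda>\<omega>. (\<Sum>i\<in>J. increment (\<eta> i) (a i) (b i) \<omega>)\<^sup>2)"
    by (simp only: power2_eq_square sum_product)
  also have "ennreal \<dots> = (\<integral>\<^sup>+\<omega>. ennreal ((\<Sum>i\<in>J. increment (\<eta> i) (a i) (b i) \<omega>)\<^sup>2) \<partial>M)"
    using sq_integrable_sum[of J M "\<lambda>i. increment (\<eta> i) (a i) (b i)", OF sq]
    by (intro nn_integral_eq_integral[symmetric]) (simp_all only: sq_integrable_def zero_le_power2 eventually_True)
  finally show ?thesis .
qed

end

section \<open>Increments of the Ito integral\<close>

lemma ennreal_tendsto_0_le: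
  fixes c :: ennreal
  assumes "\<And>k. c \<le> d + f k" "f \<longlonglongrightarrow> 0"
  shows "c \<le> d"
proof -
  have "(\<lambda>k. d + f k) \<longlonglongrightarrow> d + 0"
    by (intro tendsto_add tendsto_const assms)
  then show ?thesis
    using assms(1) by (intro LIMSEQ_le_const[of "\<lambda>k. d + f k"]) auto
qed

text \<open>The source of most factors 2 below: estimates in \<open>ennreal\<close> avoid
  subtraction, so the triangle inequality is used in this squared form.\<close>

lemma norm_diff_square_le:
  fixes a b c :: "'a::real_inner"
  shows "(norm (a - c))\<^sup>2 \<le> 2 * (norm (a - b))\<^sup>2 + 2 * (norm (b - c))\<^sup>2"
proof -
  have "norm (a - c) \<le> norm (a - b) + norm (b - c)"
    by (rule norm_diff_triangle_le[OF order_refl order_refl])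
  then have "(norm (a - c))\<^sup>2 \<le> (norm (a - b) + norm (b - c))\<^sup>2"
    by (intro power_mono) auto
  also have "\<dots> \<le> 2 * (norm (a - b))\<^sup>2 + 2 * (norm (b - c))\<^sup>2"
    using sum_squares_bound[of "norm (a - b)" "norm (b - c)"] by (simp add: power2_sum)
  finally show ?thesis .
qed

lemma square_diff_le: "(a - c)\<^sup>2 \<le> 2 * (a - b)\<^sup>2 + 2 * (b - c :: real)\<^sup>2"
  using norm_diff_square_le[of a c b] by simp

lemma nn_integral_le_twice_sum:
  fixes f g h :: "'a \<Rightarrow> real"
  assumes le: "\<And>x. x \<in> space N \<Longrightarrow> f x \<le> 2 * g x + 2 * h x"
    and g: "\<And>x. 0 \<le> g x" "g \<in> borel_measurable N" and h: "\<And>x. 0 \<le> h x" "h \<in> borel_measurable N"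
  shows "(\<integral>\<^sup>+x. ennreal (f x) \<partial>N) \<le> 2 * (\<integral>\<^sup>+x. ennreal (g x) \<partial>N) + 2 * (\<integral>\<^sup>+x. ennreal (h x) \<partial>N)"
proof -
  have "(\<integral>\<^sup>+x. ennreal (f x) \<partial>N) \<le> (\<integral>\<^sup>+x. 2 * ennreal (g x) + 2 * ennreal (h x) \<partial>N)"
  proof (rule nn_integral_mono)
    fix x assume "x \<in> space N"
    then have "ennreal (f x) \<le> ennreal (2 * g x + 2 * h x)" by (intro ennreal_leI le)
    also have "\<dots> = 2 * ennreal (g x) + 2 * ennreal (h x)"
      using g h by (simp add: ennreal_plus ennreal_mult)
    finally show "ennreal (f x) \<le> 2 * ennreal (g x) + 2 * ennreal (h x)" .
  qed
  also have "\<dots> = 2 * (\<integral>\<^sup>+x. ennreal (g x) \<partial>N) + 2 * (\<integral>\<^sup>+x. ennreal (h x) \<partial>N)"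
    using g h by (simp add: nn_integral_add nn_integral_cmult)
  finally show ?thesis .
qed

lemma (in prob_space) expectation_mult_square_le:
  assumes U: "sq_integrable M U" and V: "sq_integrable M V"
  shows "(expectation (\<lambda>\<omega>. U \<omega> * V \<omega>))\<^sup>2 \<le> expectation (\<lambda>\<omega>. (U \<omega>)\<^sup>2) * expectation (\<lambda>\<omega>. (V \<omega>)\<^sup>2)"
proof -
  have [measurable]: "U \<in> borel_measurable M" "V \<in> borel_measurable M"
    using U V by (auto simp: sq_integrable_def)
  have "ennreal ((expectation (\<lambda>\<omega>. U \<omega> * V \<omega>))\<^sup>2) = (ennreal \<bar>expectation (\<lambda>\<omega>. U \<omega> * V \<omega>)\<bar>)\<^sup>2"
    by (simp add: ennreal_power)
  also have "\<dots> \<le> (\<integral>\<^sup>+\<omega>. ennreal \<bar>U \<omega>\<bar> * ennreal \<bar>V \<omega>\<bar> \<partial>M)\<^sup>2"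
    using integral_norm_bound_ennreal[OF sq_integrable_mult[OF U V]]
    by (intro power_mono) (auto simp: abs_mult ennreal_mult)
  also have "\<dots> \<le> (\<integral>\<^sup>+\<omega>. (ennreal \<bar>U \<omega>\<bar>)\<^sup>2 \<partial>M) * (\<integral>\<^sup>+\<omega>. (ennreal \<bar>V \<omega>\<bar>)\<^sup>2 \<partial>M)"
    by (rule Cauchy_Schwarz_nn_integral) auto
  also have "\<dots> = ennreal (expectation (\<lambda>\<omega>. (U \<omega>)\<^sup>2)) * ennreal (expectation (\<lambda>\<omega>. (V \<omega>)\<^sup>2))"
    using U V by (simp add: ennreal_power nn_integral_eq_integral sq_integrable_def)
  finally show ?thesis by (simp add: ennreal_mult[symmetric])
qed

context brownian_motion
begin

text \<open>A progressive process is controlled on \<open>[0, T]\<close> only. Continuing it by 0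
  makes it measurable on the whole product, in the coordinate order that suits integration over
  \<open>M\<close> first or last.\<close>

lemma progressive_measurable:
  fixes X :: "real \<Rightarrow> 'a \<Rightarrow> 'b::{real_normed_vector}"
  assumes X: "progressive F T X" and "0 \<le> T"
  shows "(\<lambda>(\<omega>, r). if r \<in> {0..T} then X r \<omega> else 0) \<in> borel_measurable (M \<Otimes>\<^sub>M borel)"
proof -
  let ?N = "restrict_space (M \<Otimes>\<^sub>M borel) {x :: 'a \<times> real. snd x \<in> {0..T}}"
  have "snd \<in> measurable ?N (restrict_space borel {0..T})"
    by (intro measurable_restrict_space2 measurable_restrict_space1) (auto simp: space_restrict_space)
  moreover have "fst \<in> measurable ?N (F T)"
  proof (rule measurable_restrict_space1)
    have "(\<lambda>\<omega>. \<omega>) \<in> measurable M (F T)"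
      using sets_F_subset by (auto simp: measurable_def)
    then show "fst \<in> measurable (M \<Otimes>\<^sub>M borel) (F T)"
      by (rule measurable_compose[OF measurable_fst])
  qed
  ultimately have 1: "(\<lambda>x. (snd x, fst x)) \<in> measurable ?N (restrict_space borel {0..T} \<Otimes>\<^sub>M F T)"
    by (rule measurable_Pair)
  have 2: "(\<lambda>(s, \<omega>). X s \<omega>) \<in> borel_measurable (restrict_space borel {0..T} \<Otimes>\<^sub>M F T)"
    using assms by (auto simp: progressive_def)
  have "(\<lambda>x. X (snd x) (fst x)) \<in> borel_measurable ?N"
    using measurable_compose[OF 1 2] by simp
  moreover have "{x \<in> space (M \<Otimes>\<^sub>M borel). snd x \<in> {0..T}} \<in> sets (M \<Otimes>\<^sub>M borel)"
    by measurable
  ultimately have "(\<lambda>x. if snd x \<in> {0..T} then X (snd x) (fst x) else 0) \<in> borel_measurable (M \<Otimes>\<^sub>M borel)"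
    by (subst measurable_If_restrict_space_iff) auto
  then show ?thesis by (simp add: case_prod_beta')
qed

lemma progressive_adapted:
  assumes X: "progressive F T X" and "0 \<le> t" "t \<le> T"
  shows "X t \<in> borel_measurable (F t)"
proof -
  have 1: "(\<lambda>(s, \<omega>). X s \<omega>) \<in> borel_measurable (restrict_space borel {0..t} \<Otimes>\<^sub>M F t)"
    using assms by (auto simp: progressive_def)
  have 2: "(\<lambda>\<omega>. (t, \<omega>)) \<in> measurable (F t) (restrict_space borel {0..t} \<Otimes>\<^sub>M F t)"
    using assms by (intro measurable_Pair1') (auto simp: space_restrict_space)
  show ?thesis using measurable_compose[OF 2 1] by simp
qed

text \<open>Clipping the partition to \<open>[t, u]\<close> turns the increment of a simple integral
  into elementary terms that start no earlier than \<open>t\<close>. The process itself is matched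
  only for \<open>r > t\<close>, since the clipped intervals are open on the left and miss
  \<open>t\<close>.\<close>

lemma simple_data_decomposition:
  assumes H: "simple_data F T H" and tu: "0 \<le> t" "t \<le> u"
  obtains J :: "nat set" and a b \<eta> where "finite J" "\<forall>i\<in>J. t \<le> a i" "\<forall>i\<in>J. a i \<le> b i"
    "\<forall>i\<in>J. b i \<le> u" "\<forall>i\<in>J. bounded_F (a i) (\<eta> i)"
    "\<forall>\<omega>. simple_integral B H u \<omega> - simple_integral B H t \<omega> = (\<Sum>i\<in>J. increment (\<eta> i) (a i) (b i) \<omega>)"
    "\<forall>\<omega>. \<forall>r\<in>{t<..u}. simple_process H r \<omega> = (\<Sum>i\<in>J. indicator {a i<..b i} r *\<^sub>R \<eta> i \<omega>)"
proof -
  obtain n \<tau> \<eta> where Heq: "H = (n, \<tau>, \<eta>)" by (cases H)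
  have \<tau>s: "\<And>i. i < n \<Longrightarrow> \<tau> i < \<tau> (Suc i)"
    and \<eta>: "\<And>i. i < n \<Longrightarrow> bounded_F (\<tau> i) (\<eta> i)"
    using H by (auto simp: simple_data_def Heq bounded_F_def)
  define c where "c x = max t (min x u)" for x
  \<comment> \<open>Terms with \<open>\<tau> i \<ge> u\<close> contribute nothing, but their
    coefficients need not be \<open>F u\<close>-measurable. Without them the clipped start is never
    earlier than \<open>\<tau> i\<close>, so the coefficients remain known when their terms
    start.\<close>
  define J where "J = {i. i < n \<and> \<tau> i < u}"
  have J: "J \<subseteq> {..<n}" "finite J" by (auto simp: J_def)
  have "(\<eta> i \<omega> \<bullet> (B (min u (\<tau> (Suc i))) \<omega> - B (min u (\<tau> i)) \<omega>))
      - (\<eta> i \<omega> \<bullet> (B (min t (\<tau> (Suc i))) \<omega> - B (min t (\<tau> i)) \<omega>))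
      = (if i \<in> J then increment (\<eta> i) (c (\<tau> i)) (c (\<tau> (Suc i))) \<omega> else 0)" if "i < n" for i \<omega>
  proof -
    \<comment> \<open>The path stopped at \<open>u\<close> minus the path stopped at
      \<open>t\<close> is the clipped path up to \<open>B t\<close>, which cancels between the two
      ends of an interval.\<close>
    have clip: "B (min u x) \<omega> - B (min t x) \<omega> = B (c x) \<omega> - B t \<omega>" for x
      using tu by (auto simp: c_def min_def max_def)
    have 1: "(\<eta> i \<omega> \<bullet> (B (min u (\<tau> (Suc i))) \<omega> - B (min u (\<tau> i)) \<omega>))
      - (\<eta> i \<omega> \<bullet> (B (min t (\<tau> (Suc i))) \<omega> - B (min t (\<tau> i)) \<omega>))
      = \<eta> i \<omega> \<bullet> ((B (min u (\<tau> (Suc i))) \<omega> - B (min t (\<tau> (Suc i))) \<omega>) - (B (min u (\<tau> i)) \<omega> - B (min t (\<tau> i)) \<omega>))"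
      by (simp add: inner_diff_right)
    have 2: "\<dots> = increment (\<eta> i) (c (\<tau> i)) (c (\<tau> (Suc i))) \<omega>"
      unfolding clip by (simp add: increment_def)
    show ?thesis
    proof (cases "i \<in> J")
      case False
      then have "c (\<tau> i) = c (\<tau> (Suc i))" using \<tau>s[OF that] that tu by (auto simp: J_def c_def)
      then show ?thesis using 1 2 False by (simp add: increment_def)
    qed (use 1 2 in simp)
  qed
  then have *: "simple_integral B H u \<omega> - simple_integral B H t \<omega>
      = (\<Sum>i<n. if i \<in> J then increment (\<eta> i) (c (\<tau> i)) (c (\<tau> (Suc i))) \<omega> else 0)" for \<omega>
    by (simp add: Heq simple_integral_def sum_subtractf[symmetric])
  show thesis
  proof (rule that[of J "\<lambda>i. c (\<tau> i)" "\<lambda>i. c (\<tau> (Suc i))" \<eta>]; (intro ballI allI)?)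
    show "finite J" by (rule J)
    show "t \<le> c (\<tau> i)" for i by (simp add: c_def)
    show "c (\<tau> (Suc i)) \<le> u" for i using tu by (simp add: c_def)
    show "c (\<tau> i) \<le> c (\<tau> (Suc i))" if "i \<in> J" for i
      using \<tau>s[of i] that by (auto simp: c_def J_def max_def min_def)
    show "bounded_F (c (\<tau> i)) (\<eta> i)" if "i \<in> J" for i
      using \<eta>[of i] that by (auto simp: c_def J_def max_def min_def intro: bounded_F_mono)
    show "simple_integral B H u \<omega> - simple_integral B H t \<omega>
        = (\<Sum>i\<in>J. increment (\<eta> i) (c (\<tau> i)) (c (\<tau> (Suc i))) \<omega>)" for \<omega>
      unfolding * using J by (simp add: sum.If_cases Int_absorb1 Int_absorb2)
    show "simple_process H r \<omega> = (\<Sum>i\<in>J. indicator {c (\<tau> i)<..c (\<tau> (Suc i))} r *\<^sub>R \<eta> i \<omega>)"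
      if "r \<in> {t<..u}" for \<omega> r
    proof -
      have "simple_process H r \<omega> = (\<Sum>i<n. indicator {\<tau> i<..\<tau> (Suc i)} r *\<^sub>R \<eta> i \<omega>)"
        by (simp add: Heq simple_process_def)
      also have "\<dots> = (\<Sum>i\<in>J. indicator {\<tau> i<..\<tau> (Suc i)} r *\<^sub>R \<eta> i \<omega>)"
        using J that by (intro sum.mono_neutral_right) (auto simp: J_def)
      also have "\<dots> = (\<Sum>i\<in>J. indicator {c (\<tau> i)<..c (\<tau> (Suc i))} r *\<^sub>R \<eta> i \<omega>)"
        using that by (intro sum.cong refl) (auto simp: c_def indicator_def max_def min_def)
      finally show ?thesis .
    qed
  qed
qed

lemma simple_isometry:
  assumes H: "simple_data F T H" and tu: "0 \<le> t" "t \<le> u"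
  shows "(\<integral>\<^sup>+\<omega>. (\<integral>\<^sup>+r\<in>{t..u}. ennreal ((norm (simple_process H r \<omega> - z))\<^sup>2) \<partial>lborel) \<partial>M)
     = (\<integral>\<^sup>+\<omega>. ennreal ((simple_integral B H u \<omega> - simple_integral B H t \<omega> - increment (\<lambda>_. z) t u \<omega>)\<^sup>2) \<partial>M)"
proof -
  obtain J :: "nat set" and a b \<eta> where J': "finite J" "\<forall>i\<in>J. t \<le> a i" "\<forall>i\<in>J. a i \<le> b i"
    "\<forall>i\<in>J. b i \<le> u" "\<forall>i\<in>J. bounded_F (a i) (\<eta> i)"
    and S': "\<forall>\<omega>. simple_integral B H u \<omega> - simple_integral B H t \<omega> = (\<Sum>i\<in>J. increment (\<eta> i) (a i) (b i) \<omega>)"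
    and P': "\<forall>\<omega>. \<forall>r\<in>{t<..u}. simple_process H r \<omega> = (\<Sum>i\<in>J. indicator {a i<..b i} r *\<^sub>R \<eta> i \<omega>)"
    by (rule simple_data_decomposition[OF H tu])
  note J = J'(1) J'(2-)[rule_format] and S = S'[rule_format] and P = P'[rule_format]
  \<comment> \<open>The index \<open>None\<close> stands for the appended term with coefficient
    \<open>- z\<close> on the whole interval from \<open>t\<close> to \<open>u\<close>; it overlaps
    all the others.\<close>
  define a' where "a' = case_option t a"
  define b' where "b' = case_option u b"
  define \<eta>' where "\<eta>' = case_option (\<lambda>_. - z) \<eta>"
  let ?J = "insert None (Some ` J)"
  have sum: "(\<Sum>i\<in>?J. f i) = f None + (\<Sum>i\<in>J. f (Some i))" for f :: "nat option \<Rightarrow> 'c::comm_monoid_add"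
    using J(1) by (subst sum.insert) (auto simp: sum.reindex)
  have iso: "(\<integral>\<^sup>+\<omega>. (\<integral>\<^sup>+r. ennreal ((norm (\<Sum>i\<in>?J. indicator {a' i<..b' i} r *\<^sub>R \<eta>' i \<omega>))\<^sup>2) \<partial>lborel) \<partial>M)
     = (\<integral>\<^sup>+\<omega>. ennreal ((\<Sum>i\<in>?J. increment (\<eta>' i) (a' i) (b' i) \<omega>)\<^sup>2) \<partial>M)"
    using J tu by (intro elementary_isometry) (force simp: a'_def b'_def \<eta>'_def bounded_F_const)+
  have "(\<Sum>i\<in>?J. increment (\<eta>' i) (a' i) (b' i) \<omega>) =
      simple_integral B H u \<omega> - simple_integral B H t \<omega> - increment (\<lambda>_. z) t u \<omega>" for \<omega>
    unfolding sum S by (simp add: a'_def b'_def \<eta>'_def increment_def)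
  moreover have "(\<integral>\<^sup>+r\<in>{t..u}. ennreal ((norm (simple_process H r \<omega> - z))\<^sup>2) \<partial>lborel)
     = (\<integral>\<^sup>+r. ennreal ((norm (\<Sum>i\<in>?J. indicator {a' i<..b' i} r *\<^sub>R \<eta>' i \<omega>))\<^sup>2) \<partial>lborel)" for \<omega>
  proof (rule nn_integral_cong_AE)
    \<comment> \<open>The closed interval of integration and the left-open elementary intervals
      differ at \<open>t\<close> alone, a Lebesgue null set.\<close>
    have *: "ennreal ((norm (simple_process H r \<omega> - z))\<^sup>2) * indicator {t..u} r
        = ennreal ((norm (\<Sum>i\<in>?J. indicator {a' i<..b' i} r *\<^sub>R \<eta>' i \<omega>))\<^sup>2)" if "r \<noteq> t" for r
    proof (cases "t < r \<and> r \<le> u")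
      case True
      then show ?thesis unfolding sum by (simp add: a'_def b'_def \<eta>'_def P)
    next
      case False
      then have "(\<Sum>i\<in>J. indicator {a i<..b i} r *\<^sub>R \<eta> i \<omega>) = 0"
        using J by (intro sum.neutral) (force simp: indicator_def)
      then show ?thesis using False that unfolding sum by (auto simp: a'_def b'_def \<eta>'_def)
    qed
    show "AE r in lborel. ennreal ((norm (simple_process H r \<omega> - z))\<^sup>2) * indicator {t..u} r
        = ennreal ((norm (\<Sum>i\<in>?J. indicator {a' i<..b' i} r *\<^sub>R \<eta>' i \<omega>))\<^sup>2)"
      by (rule eventually_mono[OF AE_lborel_singleton[of t]]) (rule *)
  qed
  ultimately show ?thesis using iso by simp
qed

text \<open>Every elementary term starts at some \<open>a i \<ge> t\<close>, so \<open>U\<close> is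
  known by then and each product has mean zero.\<close>

lemma simple_integral_increment:
  assumes H: "simple_data F T H" and tu: "0 \<le> t" "t \<le> u"
  shows simple_integral_increment_sq_integrable:
      "sq_integrable M (\<lambda>\<omega>. simple_integral B H u \<omega> - simple_integral B H t \<omega>)"
    and simple_integral_increment_orthogonal:
      "U \<in> borel_measurable (F t) \<Longrightarrow> sq_integrable M U \<Longrightarrow>
        expectation (\<lambda>\<omega>. U \<omega> * (simple_integral B H u \<omega> - simple_integral B H t \<omega>)) = 0"
proof -
  obtain J :: "nat set" and a b \<eta> where J': "finite J" "\<forall>i\<in>J. t \<le> a i" "\<forall>i\<in>J. a i \<le> b i"
    "\<forall>i\<in>J. b i \<le> u" "\<forall>i\<in>J. bounded_F (a i) (\<eta> i)"
    and S': "\<forall>\<omega>. simple_integral B H u \<omega> - simple_integral B H t \<omega> = (\<Sum>i\<in>J. increment (\<eta> i) (a i) (b i) \<omega>)"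
    by (rule simple_data_decomposition[OF H tu])
  note J = J'(1) J'(2-)[rule_format] and S = S'[rule_format]
  have J0: "0 \<le> a i" if "i \<in> J" for i using J(2)[OF that] tu by simp
  have sq: "sq_integrable M (increment (\<eta> i) (a i) (b i))" if "i \<in> J" for i
    by (intro increment_sq_integrable J J0 that)
  show "sq_integrable M (\<lambda>\<omega>. simple_integral B H u \<omega> - simple_integral B H t \<omega>)"
    unfolding S by (intro sq_integrable_sum sq)
  assume U: "U \<in> borel_measurable (F t)" "sq_integrable M U"
  have "expectation (\<lambda>\<omega>. U \<omega> * (\<Sum>i\<in>J. increment (\<eta> i) (a i) (b i) \<omega>))
      = (\<Sum>i\<in>J. expectation (\<lambda>\<omega>. U \<omega> * increment (\<eta> i) (a i) (b i) \<omega>))"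
    unfolding sum_distrib_left
    by (intro Bochner_Integration.integral_sum sq_integrable_mult[OF U(2)] sq)
  also have "\<dots> = 0"
  proof (rule sum.neutral, rule ballI)
    fix i assume i: "i \<in> J"
    show "expectation (\<lambda>\<omega>. U \<omega> * increment (\<eta> i) (a i) (b i) \<omega>) = 0"
      by (intro F_mult_increment F_measurable_mono[OF U(1)] sq_integrable_imp_integrable U J J0 i)
  qed
  finally show "expectation (\<lambda>\<omega>. U \<omega> * (simple_integral B H u \<omega> - simple_integral B H t \<omega>)) = 0"
    unfolding S .
qed

lemma simple_process_measurable:
  assumes "simple_data F T H"
  shows "(\<lambda>(\<omega>, r). simple_process H r \<omega>) \<in> borel_measurable (M \<Otimes>\<^sub>M borel)"
proof -
  obtain n \<tau> \<eta> where Heq: "H = (n, \<tau>, \<eta>)" by (cases H)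
  have [measurable]: "\<eta> i \<in> borel_measurable M" if "i < n" for i
    using assms that by (auto simp: simple_data_def Heq intro: F_measurable)
  have "(\<lambda>x. \<Sum>i<n. indicator {\<tau> i<..\<tau> (Suc i)} (snd x) *\<^sub>R \<eta> i (fst x)) \<in> borel_measurable (M \<Otimes>\<^sub>M borel)"
    by (intro borel_measurable_sum borel_measurable_scaleR) auto
  then show ?thesis by (simp add: Heq simple_process_def case_prod_beta')
qed

text \<open>The three facts pass from simple integrands to the mean-square limit; \<open>D\<close>
  is the Ito integral of \<open>Z - z\<close> between \<open>t\<close> and \<open>u\<close>. The
  factor 4 arises because the approximating process is inserted once and removed once, each time at
  the cost of a factor 2. The absorption argument asks only for the right order.\<close>

lemma ito_increment:
  fixes z :: "real ^ 'd"
  assumes I: "ito_integral M B T Z I" and Z: "progressive F T Z" and tu: "0 \<le> t" "t \<le> u" "u \<le> T"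
  defines "D \<equiv> \<lambda>\<omega>. I u \<omega> - I t \<omega> - z \<bullet> (B u \<omega> - B t \<omega>)"
  shows ito_increment_sq_integrable: "sq_integrable M D"
    and ito_increment_orthogonal:
      "U \<in> borel_measurable (F t) \<Longrightarrow> sq_integrable M U \<Longrightarrow> expectation (\<lambda>\<omega>. U \<omega> * D \<omega>) = 0"
    and ito_increment_energy_le:
      "(\<integral>\<^sup>+\<omega>. (\<integral>\<^sup>+r\<in>{t..u}. ennreal ((norm (Z r \<omega> - z))\<^sup>2) \<partial>lborel) \<partial>M) \<le> 4 * (\<integral>\<^sup>+\<omega>. ennreal ((D \<omega>)\<^sup>2) \<partial>M)"
proof -
  obtain H where H': "\<forall>k. simple_data F T (H k)"
    and HZ: "(\<lambda>k. \<integral>\<^sup>+\<omega>. (\<integral>\<^sup>+t\<in>{0..T}. ennreal ((norm (simple_process (H k) t \<omega> - Z t \<omega>))\<^sup>2) \<partial>lborel) \<partial>M) \<longlonglongrightarrow> 0"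
    and HI': "\<forall>s\<in>{0..T}. (\<lambda>k. \<integral>\<^sup>+\<omega>. ennreal ((simple_integral B (H k) s \<omega> - I s \<omega>)\<^sup>2) \<partial>M) \<longlonglongrightarrow> 0"
    using I unfolding ito_integral_def by blast
  note H = H'[rule_format] and HI = HI'[rule_format]
  have [measurable]: "I u \<in> borel_measurable M" "I t \<in> borel_measurable M"
    using I tu by (auto simp: ito_integral_def intro: F_measurable)
  have [measurable]: "B u \<in> borel_measurable M" "B t \<in> borel_measurable M"
    using tu by (auto intro: B_measurable)
  have [measurable]: "D \<in> borel_measurable M" unfolding D_def by measurable
  have sm: "simple_integral B (H k) s \<in> borel_measurable M" if "0 \<le> s" for k s
  proof -
    obtain n \<tau> \<eta> where Heq: "H k = (n, \<tau>, \<eta>)" by (cases "H k")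
    have \<tau>s: "0 \<le> \<tau> 0" "\<And>i. i < n \<Longrightarrow> \<tau> i < \<tau> (Suc i)"
      and \<eta>: "\<And>i. i < n \<Longrightarrow> \<eta> i \<in> borel_measurable M"
      using H[of k] by (auto simp: simple_data_def Heq intro: F_measurable)
    have \<tau>: "0 \<le> \<tau> i" if "i \<le> n" for i
      using that by (induction i) (use \<tau>s in \<open>auto simp: Suc_le_eq intro: less_imp_le order.strict_trans1\<close>)
    have "(\<lambda>\<omega>. \<Sum>i<n. \<eta> i \<omega> \<bullet> (B (min s (\<tau> (Suc i))) \<omega> - B (min s (\<tau> i)) \<omega>)) \<in> borel_measurable M"
      using \<tau> that \<eta> by (intro borel_measurable_sum borel_measurable_inner borel_measurable_diff B_measurable) auto
    then show ?thesis unfolding Heq simple_integral_def by simp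
  qed
  define S where "S k \<omega> = simple_integral B (H k) u \<omega> - simple_integral B (H k) t \<omega> - increment (\<lambda>_. z) t u \<omega>" for k \<omega>
  have z: "bounded_F t (\<lambda>_. z)" by (rule bounded_F_const)
  have Ssq: "sq_integrable M (S k)" for k
    unfolding S_def[abs_def] using tu
    by (intro sq_integrable_diff simple_integral_increment_sq_integrable[OF H] increment_sq_integrable z) auto
  note [measurable] = sq_integrable_measurable[OF Ssq] sm[OF tu(1)] sm[OF order_trans[OF tu(1,2)]]
  define e where "e k = 2 * (\<integral>\<^sup>+\<omega>. ennreal ((simple_integral B (H k) u \<omega> - I u \<omega>)\<^sup>2) \<partial>M)
      + 2 * (\<integral>\<^sup>+\<omega>. ennreal ((simple_integral B (H k) t \<omega> - I t \<omega>)\<^sup>2) \<partial>M)" for k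
  have "e \<longlonglongrightarrow> 2 * 0 + 2 * 0"
    unfolding e_def[abs_def] using tu by (intro tendsto_add ennreal_tendsto_cmult HI) auto
  then have e0: "e \<longlonglongrightarrow> 0" by simp
  have SD: "(\<integral>\<^sup>+\<omega>. ennreal ((S k \<omega> - D \<omega>)\<^sup>2) \<partial>M) \<le> e k" for k
    unfolding e_def
  proof (rule nn_integral_le_twice_sum)
    fix \<omega>
    show "(S k \<omega> - D \<omega>)\<^sup>2 \<le> 2 * (simple_integral B (H k) u \<omega> - I u \<omega>)\<^sup>2 + 2 * (simple_integral B (H k) t \<omega> - I t \<omega>)\<^sup>2"
      using square_diff_le[of "simple_integral B (H k) u \<omega> - I u \<omega>" "simple_integral B (H k) t \<omega> - I t \<omega>" 0]
        power2_commute[of "I t \<omega>" "simple_integral B (H k) t \<omega>"]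
      by (simp add: S_def D_def increment_def algebra_simps)
  qed auto
  \<comment> \<open>Convergence to 0 in \<open>ennreal\<close> tolerates infinite initial terms.
    From \<open>K\<close> on the errors are square integrable, and so is \<open>D\<close>, being
    \<open>S K\<close> minus such an error.\<close>
  have "eventually (\<lambda>k. e k < \<infinity>) sequentially"
    using e0 by (rule order_tendstoD) simp
  then obtain K where K: "\<And>k. K \<le> k \<Longrightarrow> e k < \<infinity>" by (auto simp: eventually_sequentially)
  have SDsq: "sq_integrable M (\<lambda>\<omega>. S k \<omega> - D \<omega>)" if "K \<le> k" for k
    using le_less_trans[OF SD K[OF that]] by (subst sq_integrable_iff_nn_integral) auto
  have "sq_integrable M (\<lambda>\<omega>. S K \<omega> - (S K \<omega> - D \<omega>))"
    by (intro sq_integrable_diff Ssq SDsq) simp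
  then show Dsq: "sq_integrable M D" by simp
  show "expectation (\<lambda>\<omega>. U \<omega> * D \<omega>) = 0" if U: "U \<in> borel_measurable (F t)" "sq_integrable M U" for U
  proof -
    let ?c = "expectation (\<lambda>\<omega>. U \<omega> * D \<omega>)"
    \<comment> \<open>Since \<open>U\<close> is orthogonal to \<open>S (k + K)\<close>, the constant
      \<open>?c\<close> is up to sign the expectation against the error
      \<open>S (k + K) - D\<close>. Cauchy-Schwarz bounds its square by a null sequence.\<close>
    have "ennreal (?c\<^sup>2) \<le> 0 + ennreal (expectation (\<lambda>\<omega>. (U \<omega>)\<^sup>2)) * e (k + K)" for k
    proof -
      have k: "K \<le> k + K" by simp
      have "expectation (\<lambda>\<omega>. U \<omega> * S (k + K) \<omega>) =
          expectation (\<lambda>\<omega>. U \<omega> * (simple_integral B (H (k + K)) u \<omega> - simple_integral B (H (k + K)) t \<omega>))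
          - expectation (\<lambda>\<omega>. U \<omega> * increment (\<lambda>_. z) t u \<omega>)"
        unfolding S_def right_diff_distrib[of "U _" "_ - _" "increment _ _ _ _"]
        using tu z U by (intro Bochner_Integration.integral_diff sq_integrable_mult
            simple_integral_increment_sq_integrable[OF H] increment_sq_integrable) auto
      also have "\<dots> = 0"
        using tu z U simple_integral_increment_orthogonal[OF H[of "k + K"] tu(1,2) U]
          F_mult_increment[OF tu(1,2) U(1) sq_integrable_imp_integrable[OF U(2)] z] by simp
      finally have "expectation (\<lambda>\<omega>. U \<omega> * S (k + K) \<omega>) = 0" .
      moreover have "expectation (\<lambda>\<omega>. U \<omega> * (S (k + K) \<omega> - D \<omega>)) =
          expectation (\<lambda>\<omega>. U \<omega> * S (k + K) \<omega>) - ?c"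
        unfolding right_diff_distrib
        by (intro Bochner_Integration.integral_diff sq_integrable_mult U Ssq Dsq)
      ultimately have "?c\<^sup>2 = (expectation (\<lambda>\<omega>. U \<omega> * (S (k + K) \<omega> - D \<omega>)))\<^sup>2" by simp
      also have "\<dots> \<le> expectation (\<lambda>\<omega>. (U \<omega>)\<^sup>2) * expectation (\<lambda>\<omega>. (S (k + K) \<omega> - D \<omega>)\<^sup>2)"
        by (rule expectation_mult_square_le[OF U(2) SDsq[OF k]])
      finally have "ennreal (?c\<^sup>2) \<le> ennreal (expectation (\<lambda>\<omega>. (U \<omega>)\<^sup>2)) * ennreal (expectation (\<lambda>\<omega>. (S (k + K) \<omega> - D \<omega>)\<^sup>2))"
        by (simp add: ennreal_mult[symmetric] ennreal_leI)
      also have "ennreal (expectation (\<lambda>\<omega>. (S (k + K) \<omega> - D \<omega>)\<^sup>2)) \<le> e (k + K)"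
        using SD[of "k + K"] SDsq[OF k] by (simp add: nn_integral_eq_integral sq_integrable_def)
      finally show ?thesis by (simp add: mult_left_mono)
    qed
    moreover have "(\<lambda>k. ennreal (expectation (\<lambda>\<omega>. (U \<omega>)\<^sup>2)) * e (k + K)) \<longlonglongrightarrow> 0"
      using ennreal_tendsto_cmult[OF _ LIMSEQ_ignore_initial_segment[OF e0, of K]] by fastforce
    ultimately have "ennreal (?c\<^sup>2) \<le> 0" by (rule ennreal_tendsto_0_le)
    then show ?thesis by (simp add: ennreal_eq_0_iff)
  qed
  \<comment> \<open>\<open>Z\<close> is arbitrary outside \<open>[0, T]\<close>; the truncation is
    jointly measurable and agrees with \<open>Z\<close> on \<open>[t, u]\<close>.\<close>
  define Zt where "Zt \<omega> r = (if r \<in> {0..T} then Z r \<omega> else 0)" for \<omega> r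
  have Zm: "(\<lambda>(\<omega>, r). Zt \<omega> r) \<in> borel_measurable (M \<Otimes>\<^sub>M borel)"
    unfolding Zt_def by (rule progressive_measurable[OF Z]) (use tu in simp)
  define h where "h k \<omega> r = (norm (simple_process (H k) r \<omega> - z))\<^sup>2 * indicator {t..u} r" for k \<omega> r
  define d where "d k \<omega> r = (norm (simple_process (H k) r \<omega> - Zt \<omega> r))\<^sup>2 * indicator {t..u} r" for k \<omega> r
  note Hm = simple_process_measurable[OF H]
  have hm [measurable]: "(\<lambda>(\<omega>, r). h k \<omega> r) \<in> borel_measurable (M \<Otimes>\<^sub>M lborel)" for k
    using Hm[of k] unfolding h_def case_prod_beta' by measurable
  have dm [measurable]: "(\<lambda>(\<omega>, r). d k \<omega> r) \<in> borel_measurable (M \<Otimes>\<^sub>M lborel)" for k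
    using Hm[of k] Zm unfolding d_def case_prod_beta' by measurable
  have h0: "0 \<le> h k \<omega> r" and d0: "0 \<le> d k \<omega> r" for k \<omega> r
    by (simp_all add: h_def d_def)
  define w where "w k = (\<integral>\<^sup>+\<omega>. (\<integral>\<^sup>+r\<in>{0..T}. ennreal ((norm (simple_process (H k) r \<omega> - Z r \<omega>))\<^sup>2) \<partial>lborel) \<partial>M)" for k
  have "(\<integral>\<^sup>+\<omega>. (\<integral>\<^sup>+r\<in>{t..u}. ennreal ((norm (Z r \<omega> - z))\<^sup>2) \<partial>lborel) \<partial>M)
      \<le> 4 * (\<integral>\<^sup>+\<omega>. ennreal ((D \<omega>)\<^sup>2) \<partial>M) + (4 * e k + 2 * w k)" for k
  proof -
    have "(\<integral>\<^sup>+\<omega>. (\<integral>\<^sup>+r\<in>{t..u}. ennreal ((norm (Z r \<omega> - z))\<^sup>2) \<partial>lborel) \<partial>M)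
        \<le> (\<integral>\<^sup>+\<omega>. 2 * (\<integral>\<^sup>+r. ennreal (d k \<omega> r) \<partial>lborel) + 2 * (\<integral>\<^sup>+r. ennreal (h k \<omega> r) \<partial>lborel) \<partial>M)"
    proof (rule nn_integral_mono)
      fix \<omega> assume \<omega>: "\<omega> \<in> space M"
      have "(\<integral>\<^sup>+r\<in>{t..u}. ennreal ((norm (Z r \<omega> - z))\<^sup>2) \<partial>lborel)
        = (\<integral>\<^sup>+r. ennreal ((norm (Zt \<omega> r - z))\<^sup>2 * indicator {t..u} r) \<partial>lborel)"
        using tu by (intro nn_integral_cong) (auto simp: indicator_def Zt_def)
      also have "\<dots> \<le> 2 * (\<integral>\<^sup>+r. ennreal (d k \<omega> r) \<partial>lborel) + 2 * (\<integral>\<^sup>+r. ennreal (h k \<omega> r) \<partial>lborel)"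
      proof (rule nn_integral_le_twice_sum)
        fix r
        show "(norm (Zt \<omega> r - z))\<^sup>2 * indicator {t..u} r \<le> 2 * d k \<omega> r + 2 * h k \<omega> r"
          using norm_diff_square_le[of "Zt \<omega> r" z "simple_process (H k) r \<omega>"]
          unfolding norm_minus_commute[of "Zt \<omega> r" "simple_process (H k) r \<omega>"] d_def h_def
          by (cases "r \<in> {t..u}") simp_all
        show "d k \<omega> \<in> borel_measurable lborel" "h k \<omega> \<in> borel_measurable lborel"
          using measurable_compose[OF measurable_Pair1'[OF \<omega>] dm] measurable_compose[OF measurable_Pair1'[OF \<omega>] hm]
          by simp_all
      qed (rule d0 h0)+
      finally show "(\<integral>\<^sup>+r\<in>{t..u}. ennreal ((norm (Z r \<omega> - z))\<^sup>2) \<partial>lborel)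
        \<le> 2 * (\<integral>\<^sup>+r. ennreal (d k \<omega> r) \<partial>lborel) + 2 * (\<integral>\<^sup>+r. ennreal (h k \<omega> r) \<partial>lborel)" .
    qed
    also have "\<dots> = 2 * (\<integral>\<^sup>+\<omega>. (\<integral>\<^sup>+r. ennreal (d k \<omega> r) \<partial>lborel) \<partial>M) + 2 * (\<integral>\<^sup>+\<omega>. (\<integral>\<^sup>+r. ennreal (h k \<omega> r) \<partial>lborel) \<partial>M)"
      by (subst nn_integral_add) (auto simp: nn_integral_cmult)
    also have "\<dots> \<le> 2 * w k + 2 * (2 * e k + 2 * (\<integral>\<^sup>+\<omega>. ennreal ((D \<omega>)\<^sup>2) \<partial>M))"
    proof (intro add_mono mult_left_mono)
      show "(\<integral>\<^sup>+\<omega>. (\<integral>\<^sup>+r. ennreal (d k \<omega> r) \<partial>lborel) \<partial>M) \<le> w k"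
        unfolding w_def using tu by (intro nn_integral_mono) (auto simp: indicator_def d_def Zt_def)
      have "(\<integral>\<^sup>+\<omega>. (\<integral>\<^sup>+r. ennreal (h k \<omega> r) \<partial>lborel) \<partial>M) = (\<integral>\<^sup>+\<omega>. ennreal ((S k \<omega>)\<^sup>2) \<partial>M)"
        unfolding S_def simple_isometry[OF H tu(1,2), of k z, symmetric]
        by (intro nn_integral_cong) (auto simp: indicator_def h_def)
      also have "\<dots> \<le> 2 * (\<integral>\<^sup>+\<omega>. ennreal ((S k \<omega> - D \<omega>)\<^sup>2) \<partial>M) + 2 * (\<integral>\<^sup>+\<omega>. ennreal ((D \<omega>)\<^sup>2) \<partial>M)"
        by (rule nn_integral_le_twice_sum) (use square_diff_le[of "S k _" 0 "D _"] in auto)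
      also have "\<dots> \<le> 2 * e k + 2 * (\<integral>\<^sup>+\<omega>. ennreal ((D \<omega>)\<^sup>2) \<partial>M)"
        by (intro add_mono mult_left_mono SD) auto
      finally show "(\<integral>\<^sup>+\<omega>. (\<integral>\<^sup>+r. ennreal (h k \<omega> r) \<partial>lborel) \<partial>M) \<le> 2 * e k + 2 * (\<integral>\<^sup>+\<omega>. ennreal ((D \<omega>)\<^sup>2) \<partial>M)" .
    qed auto
    also have "\<dots> = 4 * (\<integral>\<^sup>+\<omega>. ennreal ((D \<omega>)\<^sup>2) \<partial>M) + (4 * e k + 2 * w k)"
      by (simp add: distrib_left mult.assoc[symmetric] add_ac)
    finally show ?thesis .
  qed
  note bound = this
  have "(\<lambda>k. 4 * e k + 2 * w k) \<longlonglongrightarrow> 4 * 0 + 2 * 0"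
    using HZ unfolding w_def[symmetric] by (intro tendsto_add ennreal_tendsto_cmult e0) auto
  then have "(\<lambda>k. 4 * e k + 2 * w k) \<longlonglongrightarrow> 0" by (simp only: mult_zero_right add_0_right)
  with bound show "(\<integral>\<^sup>+\<omega>. (\<integral>\<^sup>+r\<in>{t..u}. ennreal ((norm (Z r \<omega> - z))\<^sup>2) \<partial>lborel) \<partial>M) \<le> 4 * (\<integral>\<^sup>+\<omega>. ennreal ((D \<omega>)\<^sup>2) \<partial>M)"
    by (rule ennreal_tendsto_0_le)
qed

end

section \<open>Countable approximation of sections in \<open>L\<^sup>2\<close>\<close>

context prob_space
begin

text \<open>The sections lie in the closure of a countable set for convergence in probability,
  metrized by the truncated distance. This distance requires no integrability, so the class is
  closed under pointwise limits and can be extended from rectangles to all measurable functions;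
  mean-square approximation is recovered at the end by clipping.\<close>

definition separable_sections :: "('a \<times> 'b \<Rightarrow> real) \<Rightarrow> bool" where
  "separable_sections f \<longleftrightarrow> (\<forall>r. (\<lambda>\<omega>. f (\<omega>, r)) \<in> borel_measurable M) \<and>
     (\<exists>C. countable C \<and> C \<subseteq> borel_measurable M \<and>
       (\<forall>r. \<forall>e>0. \<exists>c\<in>C. expectation (\<lambda>\<omega>. min 1 \<bar>f (\<omega>, r) - c \<omega>\<bar>) < e))"

lemma integrable_min_1:
  "f \<in> borel_measurable M \<Longrightarrow> integrable M (\<lambda>\<omega>. min 1 \<bar>f \<omega>\<bar> :: real)"
  by (rule integrable_const_bound[of _ 1]) auto

lemma separable_sections_cong:
  assumes "separable_sections f" "\<And>\<omega> r. \<omega> \<in> space M \<Longrightarrow> f (\<omega>, r) = g (\<omega>, r)"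
  shows "separable_sections g"
proof -
  have "expectation (\<lambda>\<omega>. min 1 \<bar>g (\<omega>, r) - c \<omega>\<bar>) = expectation (\<lambda>\<omega>. min 1 \<bar>f (\<omega>, r) - c \<omega>\<bar>)" for r c
    by (intro Bochner_Integration.integral_cong refl) (simp add: assms(2))
  moreover have "(\<lambda>\<omega>. f (\<omega>, r)) \<in> borel_measurable M \<longleftrightarrow> (\<lambda>\<omega>. g (\<omega>, r)) \<in> borel_measurable M" for r
    by (intro measurable_cong assms(2))
  ultimately show ?thesis using assms(1) by (simp add: separable_sections_def)
qed

text \<open>Such a function has at most two different sections, \<open>f\<close> and 0.\<close>

lemma separable_sections_const: "separable_sections (\<lambda>(\<omega>, r). if r \<in> A then f \<omega> else 0)"
  if f: "f \<in> borel_measurable M"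
proof -
  have "\<exists>c\<in>{f, \<lambda>_. 0}. expectation (\<lambda>\<omega>. min 1 \<bar>(if r \<in> A then f \<omega> else 0) - c \<omega>\<bar>) < e"
    if "e > 0" for r and e :: real
    using that by (cases "r \<in> A") auto
  then show ?thesis using f unfolding separable_sections_def
    by (intro conjI exI[of _ "{f, \<lambda>_. 0}"]) auto
qed

lemma separable_sections_add:
  assumes "separable_sections f" "separable_sections g"
  shows "separable_sections (\<lambda>x. f x + g x)"
proof -
  obtain C where C: "countable C" "C \<subseteq> borel_measurable M"
    and Ce: "\<And>r e. e > 0 \<Longrightarrow> \<exists>c\<in>C. expectation (\<lambda>\<omega>. min 1 \<bar>f (\<omega>, r) - c \<omega>\<bar>) < e"
    using assms(1) by (auto simp: separable_sections_def)
  obtain D where D: "countable D" "D \<subseteq> borel_measurable M"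
    and De: "\<And>r e. e > 0 \<Longrightarrow> \<exists>c\<in>D. expectation (\<lambda>\<omega>. min 1 \<bar>g (\<omega>, r) - c \<omega>\<bar>) < e"
    using assms(2) by (auto simp: separable_sections_def)
  have fm: "(\<lambda>\<omega>. f (\<omega>, r)) \<in> borel_measurable M" and gm: "(\<lambda>\<omega>. g (\<omega>, r)) \<in> borel_measurable M" for r
    using assms by (auto simp: separable_sections_def)
  let ?E = "(\<lambda>(c, d) \<omega>. c \<omega> + d \<omega>) ` (C \<times> D)"
  have "\<exists>b\<in>?E. expectation (\<lambda>\<omega>. min 1 \<bar>f (\<omega>, r) + g (\<omega>, r) - b \<omega>\<bar>) < e" if "e > 0" for r e
  proof -
    have e2: "e / 2 > 0" using that by simp
    obtain c where c: "c \<in> C" "expectation (\<lambda>\<omega>. min 1 \<bar>f (\<omega>, r) - c \<omega>\<bar>) < e / 2" using Ce[OF e2] by blast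
    obtain d where d: "d \<in> D" "expectation (\<lambda>\<omega>. min 1 \<bar>g (\<omega>, r) - d \<omega>\<bar>) < e / 2" using De[OF e2] by blast
    have [measurable]: "c \<in> borel_measurable M" "d \<in> borel_measurable M"
      "(\<lambda>\<omega>. f (\<omega>, r)) \<in> borel_measurable M" "(\<lambda>\<omega>. g (\<omega>, r)) \<in> borel_measurable M"
      using c d C D fm gm by auto
    have "expectation (\<lambda>\<omega>. min 1 \<bar>f (\<omega>, r) + g (\<omega>, r) - (c \<omega> + d \<omega>)\<bar>)
        \<le> expectation (\<lambda>\<omega>. min 1 \<bar>f (\<omega>, r) - c \<omega>\<bar> + min 1 \<bar>g (\<omega>, r) - d \<omega>\<bar>)"
      by (intro integral_mono Bochner_Integration.integrable_add integrable_min_1) auto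
    also have "\<dots> = expectation (\<lambda>\<omega>. min 1 \<bar>f (\<omega>, r) - c \<omega>\<bar>) + expectation (\<lambda>\<omega>. min 1 \<bar>g (\<omega>, r) - d \<omega>\<bar>)"
      by (intro Bochner_Integration.integral_add integrable_min_1) auto
    finally have "expectation (\<lambda>\<omega>. min 1 \<bar>f (\<omega>, r) + g (\<omega>, r) - (c \<omega> + d \<omega>)\<bar>) < e"
      using c d by simp
    then show ?thesis using c d by (intro bexI[of _ "\<lambda>\<omega>. c \<omega> + d \<omega>"]) auto
  qed
  moreover have "?E \<subseteq> borel_measurable M" using C(2) D(2) by (auto intro!: borel_measurable_add dest: subsetD)
  ultimately show ?thesis using C D fm gm unfolding separable_sections_def
    by (intro conjI exI[of _ ?E]) auto
qed

lemma separable_sections_cmult: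
  assumes "separable_sections f"
  shows "separable_sections (\<lambda>x. a * f x)"
proof -
  obtain C where C: "countable C" "C \<subseteq> borel_measurable M"
    and Ce: "\<And>r e. e > 0 \<Longrightarrow> \<exists>c\<in>C. expectation (\<lambda>\<omega>. min 1 \<bar>f (\<omega>, r) - c \<omega>\<bar>) < e"
    using assms by (auto simp: separable_sections_def)
  have fm: "(\<lambda>\<omega>. f (\<omega>, r)) \<in> borel_measurable M" for r
    using assms by (auto simp: separable_sections_def)
  let ?E = "(\<lambda>c \<omega>. a * c \<omega>) ` C"
  \<comment> \<open>This factor dominates \<open>\<bar>a\<bar>\<close> where the distance is at most
    1 and the truncation level 1 elsewhere, and it is positive even for
    \<open>a = 0\<close>.\<close>
  let ?b = "1 + \<bar>a\<bar>"
  have "\<exists>b\<in>?E. expectation (\<lambda>\<omega>. min 1 \<bar>a * f (\<omega>, r) - b \<omega>\<bar>) < e" if "e > 0" for r e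
  proof -
    have eb: "e / ?b > 0" using that by (simp add: add_pos_nonneg)
    obtain c where c: "c \<in> C" "expectation (\<lambda>\<omega>. min 1 \<bar>f (\<omega>, r) - c \<omega>\<bar>) < e / ?b"
      using Ce[OF eb] by blast
    have [measurable]: "c \<in> borel_measurable M" "(\<lambda>\<omega>. f (\<omega>, r)) \<in> borel_measurable M"
      using c C fm by auto
    have *: "min 1 \<bar>a * x - a * y\<bar> \<le> ?b * min 1 \<bar>x - y\<bar>" for x y :: real
    proof (cases "\<bar>x - y\<bar> \<le> 1")
      case True
      have "\<bar>a * x - a * y\<bar> = \<bar>a\<bar> * \<bar>x - y\<bar>" by (simp add: abs_mult[symmetric] right_diff_distrib)
      also have "\<dots> \<le> ?b * \<bar>x - y\<bar>" by (intro mult_right_mono) auto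
      finally show ?thesis using True by simp
    qed simp
    have "expectation (\<lambda>\<omega>. min 1 \<bar>a * f (\<omega>, r) - a * c \<omega>\<bar>)
        \<le> expectation (\<lambda>\<omega>. ?b * min 1 \<bar>f (\<omega>, r) - c \<omega>\<bar>)"
      by (intro integral_mono integrable_mult_right integrable_min_1 *) auto
    also have "\<dots> = ?b * expectation (\<lambda>\<omega>. min 1 \<bar>f (\<omega>, r) - c \<omega>\<bar>)" by simp
    also have "\<dots> < ?b * (e / ?b)" using c by (intro mult_strict_left_mono) auto
    also have "\<dots> = e" by simp
    finally show ?thesis using c by (intro bexI[of _ "\<lambda>\<omega>. a * c \<omega>"]) auto
  qed
  moreover have "?E \<subseteq> borel_measurable M" using C(2) by (auto intro!: borel_measurable_times dest: subsetD)
  ultimately show ?thesis using C fm unfolding separable_sections_def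
    by (intro conjI exI[of _ ?E]) auto
qed

lemma separable_sections_sum:
  assumes "finite S" "\<And>i. i \<in> S \<Longrightarrow> separable_sections (f i)"
  shows "separable_sections (\<lambda>x. \<Sum>i\<in>S. f i x)"
  using assms
proof (induction S rule: finite_induct)
  case empty
  show ?case using separable_sections_const[of "\<lambda>_. 0" UNIV] by (simp add: case_prod_beta')
next
  case (insert i S)
  then show ?case by (simp add: separable_sections_add)
qed

text \<open>For fixed \<open>r\<close>, dominated convergence with the bound 1 turns pointwise
  convergence into convergence in the truncated distance, so the union of the countable families
  serves the limit.\<close>

lemma separable_sections_lim:
  assumes f: "\<And>n. separable_sections (f n)" and lim: "\<And>\<omega> r. \<omega> \<in> space M \<Longrightarrow> (\<lambda>n :: nat. f n (\<omega>, r)) \<longlonglongrightarrow> g (\<omega>, r)"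
  shows "separable_sections g"
proof -
  have "\<exists>C. countable C \<and> C \<subseteq> borel_measurable M \<and>
       (\<forall>r. \<forall>e>0. \<exists>c\<in>C. expectation (\<lambda>\<omega>. min 1 \<bar>f n (\<omega>, r) - c \<omega>\<bar>) < e)" for n
    using f[of n] by (simp add: separable_sections_def)
  then obtain C where C: "\<And>n. countable (C n)" "\<And>n. C n \<subseteq> borel_measurable M"
    and Ce: "\<And>n r e. e > 0 \<Longrightarrow> \<exists>c\<in>C n. expectation (\<lambda>\<omega>. min 1 \<bar>f n (\<omega>, r) - c \<omega>\<bar>) < e"
    by metis
  have fm [measurable]: "(\<lambda>\<omega>. f n (\<omega>, r)) \<in> borel_measurable M" for r n
    using f[of n] by (auto simp: separable_sections_def)
  have gm [measurable]: "(\<lambda>\<omega>. g (\<omega>, r)) \<in> borel_measurable M" for r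
    by (rule borel_measurable_LIMSEQ_real[OF lim fm])
  let ?E = "\<Union>n. C n"
  have "\<exists>b\<in>?E. expectation (\<lambda>\<omega>. min 1 \<bar>g (\<omega>, r) - b \<omega>\<bar>) < e" if e: "e > 0" for r e
  proof -
    have "(\<lambda>n. expectation (\<lambda>\<omega>. min 1 \<bar>g (\<omega>, r) - f n (\<omega>, r)\<bar>)) \<longlonglongrightarrow> expectation (\<lambda>\<omega>. min 1 \<bar>g (\<omega>, r) - g (\<omega>, r)\<bar>)"
    proof (rule integral_dominated_convergence[where w="\<lambda>_. 1"])
      show "AE \<omega> in M. (\<lambda>n. min 1 \<bar>g (\<omega>, r) - f n (\<omega>, r)\<bar>) \<longlonglongrightarrow> min 1 \<bar>g (\<omega>, r) - g (\<omega>, r)\<bar>"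
        by (intro AE_I2 tendsto_intros lim)
    qed auto
    then have "(\<lambda>n. expectation (\<lambda>\<omega>. min 1 \<bar>g (\<omega>, r) - f n (\<omega>, r)\<bar>)) \<longlonglongrightarrow> 0" by simp
    then have "eventually (\<lambda>n. expectation (\<lambda>\<omega>. min 1 \<bar>g (\<omega>, r) - f n (\<omega>, r)\<bar>) < e / 2) sequentially"
      using e by (intro order_tendstoD) auto
    then obtain n where n: "expectation (\<lambda>\<omega>. min 1 \<bar>g (\<omega>, r) - f n (\<omega>, r)\<bar>) < e / 2"
      by (auto simp: eventually_sequentially)
    obtain c where c: "c \<in> C n" "expectation (\<lambda>\<omega>. min 1 \<bar>f n (\<omega>, r) - c \<omega>\<bar>) < e / 2"
      using Ce[OF half_gt_zero[OF e]] by blast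
    have [measurable]: "c \<in> borel_measurable M" using c C by auto
    have "expectation (\<lambda>\<omega>. min 1 \<bar>g (\<omega>, r) - c \<omega>\<bar>)
        \<le> expectation (\<lambda>\<omega>. min 1 \<bar>g (\<omega>, r) - f n (\<omega>, r)\<bar> + min 1 \<bar>f n (\<omega>, r) - c \<omega>\<bar>)"
      by (intro integral_mono Bochner_Integration.integrable_add integrable_min_1) auto
    also have "\<dots> = expectation (\<lambda>\<omega>. min 1 \<bar>g (\<omega>, r) - f n (\<omega>, r)\<bar>) + expectation (\<lambda>\<omega>. min 1 \<bar>f n (\<omega>, r) - c \<omega>\<bar>)"
      by (intro Bochner_Integration.integral_add integrable_min_1) auto
    finally have "expectation (\<lambda>\<omega>. min 1 \<bar>g (\<omega>, r) - c \<omega>\<bar>) < e" using c n by simp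
    then show ?thesis using c by auto
  qed
  moreover have "countable ?E" "?E \<subseteq> borel_measurable M" using C by auto
  ultimately show ?thesis using gm unfolding separable_sections_def
    by (intro conjI exI[of _ ?E]) auto
qed

text \<open>Dynkin induction from measurable rectangles: complements are differences, and disjoint
  unions are limits of finite sums.\<close>

lemma separable_sections_indicator:
  assumes "S \<in> sets (M \<Otimes>\<^sub>M N)"
  shows "separable_sections (indicator S)"
  using Int_stable_pair_measure_generator pair_measure_closed assms
  unfolding sets_pair_measure
proof (induct rule: sigma_sets_induct_disjoint)
  case (basic S)
  then obtain A R where S: "S = A \<times> R" "A \<in> sets M" by auto
  then have "separable_sections (\<lambda>(\<omega>, r). if r \<in> R then indicator A \<omega> else 0)"
    by (intro separable_sections_const) auto
  then show ?case by (rule separable_sections_cong) (simp add: S indicator_def)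
next
  case empty
  show ?case using separable_sections_const[of "\<lambda>_. 0" UNIV]
    by (rule separable_sections_cong) auto
next
  case (compl S)
  have 1: "separable_sections (\<lambda>(\<omega>, r). if r \<in> space N then 1 else 0)"
    by (rule separable_sections_const) auto
  \<comment> \<open>The complement is relative to \<open>space M \<times> space N\<close>, whereas
    \<open>r\<close> ranges over its whole type. Hence the subtraction is from the indicator of
    \<open>r \<in> space N\<close> and not from the constant 1.\<close>
  have 2: "separable_sections (\<lambda>x. (case x of (\<omega>, r) \<Rightarrow> if r \<in> space N then 1 else 0) + (-1) * indicator S x)"
    by (intro separable_sections_add 1 separable_sections_cmult compl)
  have "S \<subseteq> space M \<times> space N"
    using compl(1) sigma_sets_into_sp[OF pair_measure_closed] by blast
  then show ?case
    by (intro separable_sections_cong[OF 2]) (auto simp: indicator_def)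
next
  case (union A)
  have "separable_sections (\<lambda>x. \<Sum>i<n. indicator (A i) x)" for n
    by (intro separable_sections_sum union) auto
  then show ?case
  proof (rule separable_sections_lim)
    fix \<omega> r
    show "(\<lambda>n. \<Sum>i<n. indicator (A i) (\<omega>, r) :: real) \<longlonglongrightarrow> indicator (\<Union>i. A i) (\<omega>, r)"
    proof -
      have "(\<Sum>i<n. indicator (A i) (\<omega>, r) :: real) = indicator (\<Union>i<n. A i) (\<omega>, r)" for n
        using union(1) by (intro indicator_UN_disjoint[symmetric]) (auto simp: disjoint_family_on_def)
      then show ?thesis using LIMSEQ_indicator_UN[of A "(\<omega>, r)"] by simp
    qed
  qed
qed

lemma separable_sections_measurable:
  assumes f: "f \<in> borel_measurable (M \<Otimes>\<^sub>M N)" and N: "space N = UNIV"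
  shows "separable_sections f"
proof -
  obtain s where s: "\<forall>i. simple_function (M \<Otimes>\<^sub>M N) (s i)"
    and lim: "\<forall>x\<in>space (M \<Otimes>\<^sub>M N). (\<lambda>i. s i x) \<longlonglongrightarrow> f x"
    using borel_measurable_implies_sequence_metric[OF f, of 0] by blast
  show ?thesis
  proof (rule separable_sections_lim)
    fix i
    let ?P = "M \<Otimes>\<^sub>M N"
    have "finite (s i ` space ?P)" "\<And>y. s i -` {y} \<inter> space ?P \<in> sets ?P"
      using s simple_functionD by blast+
    then have "separable_sections (\<lambda>x. \<Sum>y\<in>s i ` space ?P. y * indicator (s i -` {y} \<inter> space ?P) x)"
      by (intro separable_sections_sum separable_sections_cmult separable_sections_indicator[of _ N])
    then show "separable_sections (s i)"
    proof (rule separable_sections_cong)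
      fix \<omega> r assume "\<omega> \<in> space M"
      then have x: "(\<omega>, r) \<in> space ?P" using N by (simp add: space_pair_measure)
      show "(\<Sum>y\<in>s i ` space ?P. y * indicator (s i -` {y} \<inter> space ?P) (\<omega>, r)) = s i (\<omega>, r)"
        using simple_function_indicator_representation_banach[OF s[rule_format] x, of i]
        by (simp only: real_scaleR_def mult.commute)
    qed
  qed (use lim N in \<open>auto simp: space_pair_measure\<close>)
qed

text \<open>Clipping turns closeness in probability into mean-square closeness. The clipping level
  depends on the section, so the countable family contains the clipped approximants for every level
  \<open>n\<close>.\<close>

lemma separable_sections_L2:
  fixes \<Gamma> :: "'a \<Rightarrow> 'b \<Rightarrow> real"
  assumes \<Gamma>: "(\<lambda>(\<omega>, r). \<Gamma> \<omega> r) \<in> borel_measurable (M \<Otimes>\<^sub>M N)" and N: "space N = UNIV"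
  obtains C where "countable C" "\<forall>c\<in>C. sq_integrable M c"
    "\<forall>r e. (\<integral>\<^sup>+\<omega>. ennreal ((\<Gamma> \<omega> r)\<^sup>2) \<partial>M) < \<infinity> \<longrightarrow> e > 0 \<longrightarrow>
      (\<exists>c\<in>C. (\<integral>\<^sup>+\<omega>. ennreal ((\<Gamma> \<omega> r - c \<omega>)\<^sup>2) \<partial>M) < ennreal e)"
proof -
  have "separable_sections (\<lambda>(\<omega>, r). \<Gamma> \<omega> r)" by (rule separable_sections_measurable[OF \<Gamma> N])
  then obtain C where C: "countable C" "C \<subseteq> borel_measurable M"
    and Ce: "\<And>r e. e > 0 \<Longrightarrow> \<exists>c\<in>C. expectation (\<lambda>\<omega>. min 1 \<bar>\<Gamma> \<omega> r - c \<omega>\<bar>) < e"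
    and \<Gamma>m [measurable]: "\<And>r. (\<lambda>\<omega>. \<Gamma> \<omega> r) \<in> borel_measurable M"
    by (auto simp: separable_sections_def)
  define cl :: "nat \<Rightarrow> real \<Rightarrow> real" where "cl n x = max (- real n) (min (real n) x)" for n x
  have [measurable]: "cl n \<in> borel_measurable borel" for n unfolding cl_def[abs_def] by measurable
  have cl_bd: "\<bar>cl n x\<bar> \<le> real n" for n x by (auto simp: cl_def)
  have cl_sub: "\<bar>x - cl n x\<bar> \<le> \<bar>x\<bar>" for n x by (auto simp: cl_def)
  have cl_lip: "\<bar>cl n x - cl n y\<bar> \<le> \<bar>x - y\<bar>" for n x y by (auto simp: cl_def)
  let ?E = "(\<lambda>(n, c) \<omega>. cl n (c \<omega>)) ` (UNIV \<times> C)"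
  show thesis
  proof (rule that[of ?E])
    show "countable ?E" using C by auto
    show "\<forall>c\<in>?E. sq_integrable M c"
    proof
      fix b assume "b \<in> ?E"
      then obtain n c where b: "b = (\<lambda>\<omega>. cl n (c \<omega>))" "c \<in> C" by auto
      then have [measurable]: "c \<in> borel_measurable M" using C by auto
      have "(cl n (c \<omega>))\<^sup>2 \<le> (real n)\<^sup>2" for \<omega>
        using cl_bd[of n "c \<omega>"] by (intro abs_le_square_iff[THEN iffD1]) simp
      then have "integrable M (\<lambda>\<omega>. (cl n (c \<omega>))\<^sup>2)"
        by (intro integrable_const_bound[of _ "(real n)\<^sup>2"]) auto
      then show "sq_integrable M b" unfolding b sq_integrable_def by simp
    qed
    show "\<forall>r e. (\<integral>\<^sup>+\<omega>. ennreal ((\<Gamma> \<omega> r)\<^sup>2) \<partial>M) < \<infinity> \<longrightarrow> e > 0 \<longrightarrow>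
      (\<exists>c\<in>?E. (\<integral>\<^sup>+\<omega>. ennreal ((\<Gamma> \<omega> r - c \<omega>)\<^sup>2) \<partial>M) < ennreal e)"
    proof (intro allI impI)
      fix r and e :: real
      assume fin: "(\<integral>\<^sup>+\<omega>. ennreal ((\<Gamma> \<omega> r)\<^sup>2) \<partial>M) < \<infinity>" and e: "e > 0"
      have int: "integrable M (\<lambda>\<omega>. (\<Gamma> \<omega> r)\<^sup>2)"
        using fin by (simp add: integrable_iff_bounded)
      have sub2: "(x - cl n x)\<^sup>2 \<le> x\<^sup>2" for n x
        using cl_sub[of x n] by (intro abs_le_square_iff[THEN iffD1])
      have "(\<lambda>n. expectation (\<lambda>\<omega>. (\<Gamma> \<omega> r - cl n (\<Gamma> \<omega> r))\<^sup>2)) \<longlonglongrightarrow> expectation (\<lambda>\<omega>. 0)"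
      proof (rule integral_dominated_convergence[where w="\<lambda>\<omega>. (\<Gamma> \<omega> r)\<^sup>2", OF _ _ int])
        show "AE \<omega> in M. (\<lambda>n. (\<Gamma> \<omega> r - cl n (\<Gamma> \<omega> r))\<^sup>2) \<longlonglongrightarrow> 0"
        proof (intro AE_I2 tendsto_eventually)
          fix \<omega>
          obtain m where m: "\<bar>\<Gamma> \<omega> r\<bar> \<le> real m" using real_arch_simple by blast
          show "eventually (\<lambda>n. (\<Gamma> \<omega> r - cl n (\<Gamma> \<omega> r))\<^sup>2 = 0) sequentially"
            unfolding eventually_sequentially
            by (intro exI[of _ m]) (use m in \<open>auto simp: cl_def\<close>)
        qed
      qed (auto simp: sub2)
      \<comment> \<open>The level \<open>n\<close> is fixed before the approximant \<open>c\<close>,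
        whose accuracy depends on it. The clipping error and the approximation error each get
        \<open>e / 4\<close>, as the square inequality doubles both.\<close>
      then have "eventually (\<lambda>n. expectation (\<lambda>\<omega>. (\<Gamma> \<omega> r - cl n (\<Gamma> \<omega> r))\<^sup>2) < e / 4) sequentially"
        using e by (intro order_tendstoD) auto
      then have "eventually (\<lambda>n. expectation (\<lambda>\<omega>. (\<Gamma> \<omega> r - cl n (\<Gamma> \<omega> r))\<^sup>2) < e / 4 \<and> 1 \<le> n) sequentially"
        using eventually_ge_at_top[of 1] by (rule eventually_conj)
      then obtain n where n: "expectation (\<lambda>\<omega>. (\<Gamma> \<omega> r - cl n (\<Gamma> \<omega> r))\<^sup>2) < e / 4" and n1: "1 \<le> n"
        using eventually_happens' trivial_limit_sequentially by blast
      \<comment> \<open>Two clipped values differ by at most \<open>2 * real n\<close>. As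
        \<open>n \<ge> 1\<close>, they also differ by at most \<open>2 * real n\<close> times the
        truncated distance of the original values. The product of both bounds gives
        \<open>k\<close>.\<close>
      define k where "k = 4 * (real n)\<^sup>2"
      have k: "k > 0" using n1 by (simp add: k_def)
      obtain c where c: "c \<in> C" "expectation (\<lambda>\<omega>. min 1 \<bar>\<Gamma> \<omega> r - c \<omega>\<bar>) < e / (4 * k)"
        using Ce[of "e / (4 * k)" r] e k by (meson divide_pos_pos mult_pos_pos zero_less_numeral)
      have [measurable]: "c \<in> borel_measurable M" using c C by auto
      have lip2: "(cl n x - cl n y)\<^sup>2 \<le> k * min 1 \<bar>x - y\<bar>" for x y
      proof -
        have a: "\<bar>cl n x - cl n y\<bar> \<le> 2 * real n" using cl_bd[of n x] cl_bd[of n y] by linarith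
        have n1': "1 \<le> real n" using n1 by simp
        have b: "\<bar>cl n x - cl n y\<bar> \<le> 2 * real n * min 1 \<bar>x - y\<bar>"
        proof (cases "\<bar>x - y\<bar> \<le> 1")
          case True
          have "\<bar>x - y\<bar> \<le> 2 * real n * \<bar>x - y\<bar>" using n1' mult_right_mono[of 1 "2 * real n" "\<bar>x - y\<bar>"] by simp
          then show ?thesis using cl_lip[of n x y] True by simp
        qed (use a in simp)
        have "(cl n x - cl n y)\<^sup>2 = \<bar>cl n x - cl n y\<bar> * \<bar>cl n x - cl n y\<bar>" by (simp add: power2_eq_square)
        also have "\<dots> \<le> (2 * real n) * (2 * real n * min 1 \<bar>x - y\<bar>)"
          by (intro mult_mono a b) auto
        also have "\<dots> = k * min 1 \<bar>x - y\<bar>" by (simp add: k_def power2_eq_square)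
        finally show ?thesis .
      qed
      have pt: "(\<Gamma> \<omega> r - cl n (c \<omega>))\<^sup>2 \<le> 2 * (\<Gamma> \<omega> r - cl n (\<Gamma> \<omega> r))\<^sup>2 + 2 * (k * min 1 \<bar>\<Gamma> \<omega> r - c \<omega>\<bar>)" for \<omega>
        using square_diff_le[of "\<Gamma> \<omega> r" "cl n (c \<omega>)" "cl n (\<Gamma> \<omega> r)"] lip2[of "\<Gamma> \<omega> r" "c \<omega>"] by linarith
      have i1: "integrable M (\<lambda>\<omega>. (\<Gamma> \<omega> r - cl n (\<Gamma> \<omega> r))\<^sup>2)"
        by (rule Bochner_Integration.integrable_bound[OF int]) (auto simp: sub2)
      have i2: "integrable M (\<lambda>\<omega>. min 1 \<bar>\<Gamma> \<omega> r - c \<omega>\<bar>)" by (rule integrable_min_1) simp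
      have i3: "integrable M (\<lambda>\<omega>. 2 * (\<Gamma> \<omega> r - cl n (\<Gamma> \<omega> r))\<^sup>2 + 2 * (k * min 1 \<bar>\<Gamma> \<omega> r - c \<omega>\<bar>))"
        by (intro Bochner_Integration.integrable_add integrable_mult_right i1 i2)
      have "(\<integral>\<^sup>+\<omega>. ennreal ((\<Gamma> \<omega> r - cl n (c \<omega>))\<^sup>2) \<partial>M)
          \<le> (\<integral>\<^sup>+\<omega>. ennreal (2 * (\<Gamma> \<omega> r - cl n (\<Gamma> \<omega> r))\<^sup>2 + 2 * (k * min 1 \<bar>\<Gamma> \<omega> r - c \<omega>\<bar>)) \<partial>M)"
        by (intro nn_integral_mono ennreal_leI pt)
      also have "\<dots> = ennreal (expectation (\<lambda>\<omega>. 2 * (\<Gamma> \<omega> r - cl n (\<Gamma> \<omega> r))\<^sup>2 + 2 * (k * min 1 \<bar>\<Gamma> \<omega> r - c \<omega>\<bar>)))"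
        using k by (intro nn_integral_eq_integral i3) (auto intro!: add_nonneg_nonneg)
      also have "\<dots> < ennreal e"
      proof (rule ennreal_lessI[OF e])
        have "expectation (\<lambda>\<omega>. 2 * (\<Gamma> \<omega> r - cl n (\<Gamma> \<omega> r))\<^sup>2 + 2 * (k * min 1 \<bar>\<Gamma> \<omega> r - c \<omega>\<bar>))
          = 2 * expectation (\<lambda>\<omega>. (\<Gamma> \<omega> r - cl n (\<Gamma> \<omega> r))\<^sup>2) + 2 * (k * expectation (\<lambda>\<omega>. min 1 \<bar>\<Gamma> \<omega> r - c \<omega>\<bar>))"
          using i1 i2 by simp
        moreover have "k * expectation (\<lambda>\<omega>. min 1 \<bar>\<Gamma> \<omega> r - c \<omega>\<bar>) < k * (e / (4 * k))"
          using c k by (intro mult_strict_left_mono) auto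
        moreover have "k * (e / (4 * k)) = e / 4" using k by simp
        ultimately show "expectation (\<lambda>\<omega>. 2 * (\<Gamma> \<omega> r - cl n (\<Gamma> \<omega> r))\<^sup>2 + 2 * (k * min 1 \<bar>\<Gamma> \<omega> r - c \<omega>\<bar>)) < e"
          using n by simp
      qed
      finally show "\<exists>c\<in>?E. (\<integral>\<^sup>+\<omega>. ennreal ((\<Gamma> \<omega> r - c \<omega>)\<^sup>2) \<partial>M) < ennreal e"
        using c by (intro bexI[of _ "\<lambda>\<omega>. cl n (c \<omega>)"]) auto
    qed
  qed
qed

end

section \<open>Lebesgue points of \<open>L\<^sup>2\<close>-valued maps\<close>

lemma AE_lborel_not_in_negligible:
  assumes "negligible (N :: 'a::euclidean_space set)"
  shows "AE x in lborel. x \<notin> N"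
proof -
  have "N \<in> null_sets (completion lborel)" using assms by (simp add: negligible_iff_null_sets)
  then obtain N' where "N' \<in> null_sets lborel" "N \<subseteq> N'" by (auto simp: null_sets_completion_iff2)
  then show ?thesis by (auto dest!: AE_not_in elim!: eventually_mono)
qed

text \<open>The differentiation theorem is taken in the form with averages over
  \<open>cbox x (x + \<epsilon> *\<^sub>R One)\<close>, which is one-sided in dimension one.
  Nonnegativity and local finiteness identify its integrals with the \<open>ennreal\<close>
  integrals used here.\<close>

lemma nn_integral_Lebesgue_differentiation:
  fixes h :: "real \<Rightarrow> real"
  assumes [measurable]: "h \<in> borel_measurable borel" and h0: "\<And>r. 0 \<le> h r"
    and fin: "\<And>a b. (\<integral>\<^sup>+r\<in>{a..b}. ennreal (h r) \<partial>lborel) < \<infinity>"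
  shows "AE t in lborel. ((\<lambda>\<epsilon>. ennreal (1 / \<epsilon>) * (\<integral>\<^sup>+r\<in>{t..t + \<epsilon>}. ennreal (h r) \<partial>lborel)) \<longlongrightarrow> ennreal (h t)) (at_right 0)"
proof -
  have int: "set_integrable lborel {a..b} h" for a b
  proof -
    have "(\<integral>\<^sup>+r. ennreal (norm (indicator {a..b} r *\<^sub>R h r)) \<partial>lborel) = (\<integral>\<^sup>+r\<in>{a..b}. ennreal (h r) \<partial>lborel)"
      by (intro nn_integral_cong) (simp add: indicator_def h0)
    then show ?thesis unfolding set_integrable_def integrable_iff_bounded using fin[of a b] by simp
  qed
  have eq: "(\<integral>\<^sup>+r\<in>{a..b}. ennreal (h r) \<partial>lborel) = ennreal (integral {a..b} h)" for a b
  proof -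
    have "(\<integral>\<^sup>+r\<in>{a..b}. ennreal (h r) \<partial>lborel) = (\<integral>\<^sup>+r. ennreal (indicator {a..b} r *\<^sub>R h r) \<partial>lborel)"
      by (intro nn_integral_cong) (simp add: indicator_def)
    also have "\<dots> = ennreal (LINT r:{a..b}|lborel. h r)"
      unfolding set_lebesgue_integral_def
      using int[of a b] by (intro nn_integral_eq_integral) (auto simp: set_integrable_def h0)
    finally show ?thesis using set_borel_integral_eq_integral(2)[OF int[of a b]] by simp
  qed
  obtain N where N: "negligible N"
    and lim: "\<And>x e. \<lbrakk>x \<notin> N; 0 < e\<rbrakk> \<Longrightarrow> \<exists>d>0. \<forall>\<epsilon>. 0 < \<epsilon> \<and> \<epsilon> < d \<longrightarrow>
        norm (integral (cbox x (x + \<epsilon> *\<^sub>R One)) h /\<^sub>R \<epsilon> ^ DIM(real) - h x) < e"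
    using integrable_ccontinuous_explicit[of h] set_borel_integral_eq_integral(1)[OF int] by (metis cbox_interval)
  have "((\<lambda>\<epsilon>. ennreal (1 / \<epsilon>) * (\<integral>\<^sup>+r\<in>{t..t + \<epsilon>}. ennreal (h r) \<partial>lborel)) \<longlongrightarrow> ennreal (h t)) (at_right 0)"
    if t: "t \<notin> N" for t
  proof -
    have "((\<lambda>\<epsilon>. integral {t..t + \<epsilon>} h / \<epsilon>) \<longlongrightarrow> h t) (at_right 0)"
      unfolding tendsto_iff
    proof (intro allI impI)
      fix e :: real assume "0 < e"
      then obtain d where d: "d > 0" "\<And>\<epsilon>. 0 < \<epsilon> \<Longrightarrow> \<epsilon> < d \<Longrightarrow> \<bar>integral {t..t + \<epsilon>} h / \<epsilon> - h t\<bar> < e"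
        using lim[OF t, of e] by (auto simp: divide_inverse mult.commute)
      show "\<forall>\<^sub>F \<epsilon> in at_right 0. dist (integral {t..t + \<epsilon>} h / \<epsilon>) (h t) < e"
        unfolding eventually_at_right_field
        by (intro exI[of _ d]) (use d in \<open>auto simp: dist_real_def\<close>)
    qed
    then have "((\<lambda>\<epsilon>. ennreal (integral {t..t + \<epsilon>} h / \<epsilon>)) \<longlongrightarrow> ennreal (h t)) (at_right 0)"
      by (rule tendsto_ennrealI)
    moreover have "\<forall>\<^sub>F \<epsilon> in at_right 0. ennreal (integral {t..t + \<epsilon>} h / \<epsilon>)
        = ennreal (1 / \<epsilon>) * (\<integral>\<^sup>+r\<in>{t..t + \<epsilon>}. ennreal (h r) \<partial>lborel)"
    proof -
      have "ennreal (integral {t..t + \<epsilon>} h / \<epsilon>) = ennreal (1 / \<epsilon>) * (\<integral>\<^sup>+r\<in>{t..t + \<epsilon>}. ennreal (h r) \<partial>lborel)"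
        if "0 < \<epsilon>" for \<epsilon>
        unfolding eq using that
        by (subst ennreal_mult[symmetric]) (auto simp: h0 intro!: Henstock_Kurzweil_Integration.integral_nonneg set_borel_integral_eq_integral(1) int)
      then show ?thesis
        by (intro eventually_mono[OF eventually_at_right_less[of 0]])
    qed
    ultimately show ?thesis by (rule Lim_transform_eventually)
  qed
  then show ?thesis
    by (intro eventually_mono[OF AE_lborel_not_in_negligible[OF N]])
qed

lemma tendsto_0_ennrealI:
  fixes f :: "'i \<Rightarrow> ennreal"
  assumes "\<And>e::real. 0 < e \<Longrightarrow> eventually (\<lambda>x. f x \<le> ennreal e) F"
  shows "(f \<longlongrightarrow> 0) F"
proof (rule order_tendstoI)
  fix a :: ennreal assume "0 < a"
  then obtain b where b: "0 < b" "b < a" using dense by blast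
  then obtain b' where b': "b = ennreal b'" "0 < b'"
    by (cases b) auto
  show "eventually (\<lambda>x. f x < a) F"
    using assms[OF b'(2)] by (rule eventually_mono) (use b b' in auto)
qed auto

context prob_space
begin

text \<open>The countable family of \<open>separable_sections_L2\<close> reduces the Lebesgue differentiation theorem
  for the \<open>L\<^sup>2\<close>-valued map \<open>r \<mapsto> \<Gamma> \<cdot> r\<close> to the one for the real functions
  \<open>r \<mapsto> \<integral>(\<Gamma> \<omega> r - c \<omega>)\<^sup>2\<close>.\<close>

lemma L2_Lebesgue_points:
  fixes \<Gamma> :: "'a \<Rightarrow> real \<Rightarrow> real"
  assumes \<Gamma>: "(\<lambda>(\<omega>, r). \<Gamma> \<omega> r) \<in> borel_measurable (M \<Otimes>\<^sub>M borel)"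
    and fin: "(\<integral>\<^sup>+\<omega>. (\<integral>\<^sup>+r. ennreal ((\<Gamma> \<omega> r)\<^sup>2) \<partial>lborel) \<partial>M) < \<infinity>"
  shows "AE t in lborel. (\<integral>\<^sup>+\<omega>. ennreal ((\<Gamma> \<omega> t)\<^sup>2) \<partial>M) < \<infinity> \<and>
    ((\<lambda>\<epsilon>. ennreal (1 / \<epsilon>) * (\<integral>\<^sup>+r\<in>{t..t + \<epsilon>}. (\<integral>\<^sup>+\<omega>. ennreal ((\<Gamma> \<omega> r - \<Gamma> \<omega> t)\<^sup>2) \<partial>M) \<partial>lborel)) \<longlongrightarrow> 0) (at_right 0)"
proof -
  interpret P: pair_sigma_finite M lborel ..
  have \<Gamma>': "(\<lambda>x. \<Gamma> (fst x) (snd x)) \<in> borel_measurable (M \<Otimes>\<^sub>M lborel)"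
    using \<Gamma> by (simp add: case_prod_beta')
  have sm [measurable]: "(\<lambda>\<omega>. \<Gamma> \<omega> r) \<in> borel_measurable M" for r
    using measurable_compose[OF measurable_Pair2'[of r borel M] \<Gamma>] by simp
  define E where "E r = (\<integral>\<^sup>+\<omega>. ennreal ((\<Gamma> \<omega> r)\<^sup>2) \<partial>M)" for r
  have Em: "(\<lambda>r. \<integral>\<^sup>+\<omega>. ennreal ((\<Gamma> \<omega> r - c \<omega>)\<^sup>2) \<partial>M) \<in> borel_measurable borel"
    if [measurable]: "c \<in> borel_measurable M" for c
  proof -
    have "(\<lambda>(r, \<omega>). ennreal ((\<Gamma> \<omega> r - c \<omega>)\<^sup>2)) \<in> borel_measurable (borel \<Otimes>\<^sub>M M)"
      using measurable_compose[OF measurable_pair_swap' \<Gamma>]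
      by (simp add: case_prod_beta')
    then show ?thesis by (rule borel_measurable_nn_integral)
  qed
  have [measurable]: "E \<in> borel_measurable borel"
    using Em[of "\<lambda>_. 0"] by (simp add: E_def[abs_def])
  have Efin: "(\<integral>\<^sup>+r. E r \<partial>lborel) < \<infinity>"
  proof -
    have "(\<integral>\<^sup>+r. E r \<partial>lborel) = (\<integral>\<^sup>+\<omega>. (\<integral>\<^sup>+r. ennreal ((\<Gamma> \<omega> r)\<^sup>2) \<partial>lborel) \<partial>M)"
      unfolding E_def using \<Gamma>' by (intro P.Fubini') (simp add: case_prod_beta')
    then show ?thesis using fin by simp
  qed
  then have EAE: "AE r in lborel. E r \<noteq> \<infinity>"
    by (intro nn_integral_PInf_AE) (auto simp: less_top)
  obtain C where C: "countable C" "\<forall>c\<in>C. sq_integrable M c"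
    and Ce: "\<forall>r e. (\<integral>\<^sup>+\<omega>. ennreal ((\<Gamma> \<omega> r)\<^sup>2) \<partial>M) < \<infinity> \<longrightarrow> e > 0 \<longrightarrow>
      (\<exists>c\<in>C. (\<integral>\<^sup>+\<omega>. ennreal ((\<Gamma> \<omega> r - c \<omega>)\<^sup>2) \<partial>M) < ennreal e)"
    by (rule separable_sections_L2[OF \<Gamma> space_borel])
  define Q where "Q c r = (\<integral>\<^sup>+\<omega>. ennreal ((\<Gamma> \<omega> r - c \<omega>)\<^sup>2) \<partial>M)" for c r
  have "AE t in lborel. ((\<lambda>\<epsilon>. ennreal (1 / \<epsilon>) * (\<integral>\<^sup>+r\<in>{t..t + \<epsilon>}. Q c r \<partial>lborel)) \<longlongrightarrow> Q c t) (at_right 0)"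
    if c: "c \<in> C" for c
  proof -
    have csq: "sq_integrable M c" using C c by auto
    have cm [measurable]: "c \<in> borel_measurable M" by (rule sq_integrable_measurable[OF csq])
    have Qm [measurable]: "Q c \<in> borel_measurable borel" using Em[OF cm] by (simp add: Q_def[abs_def])
    define q where "q = (\<integral>\<^sup>+\<omega>. ennreal ((c \<omega>)\<^sup>2) \<partial>M)"
    have q: "q < \<infinity>" using csq by (simp add: q_def sq_integrable_iff_nn_integral[OF cm])
    have QE: "Q c r \<le> 2 * E r + 2 * q" for r
      unfolding Q_def E_def q_def
      by (rule nn_integral_le_twice_sum) (use square_diff_le[of "\<Gamma> _ r" "c _" 0] in auto)
    \<comment> \<open>\<open>Q c r\<close> may be infinite for \<open>r\<close> in a null set, while
      the scalar theorem speaks of real functions; \<open>enn2real\<close> alters \<open>Q c\<close>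
      only there.\<close>
    have Qfin: "AE r in lborel. Q c r = ennreal (enn2real (Q c r))"
      using EAE
    proof (rule eventually_mono)
      fix r assume "E r \<noteq> \<infinity>"
      then have "2 * E r + 2 * q < \<infinity>" using q by (simp add: ennreal_mult_less_top less_top)
      then have "Q c r < top" using le_less_trans[OF QE[of r]] by simp
      then show "Q c r = ennreal (enn2real (Q c r))" by simp
    qed
    have eq: "(\<integral>\<^sup>+r\<in>{a..b}. ennreal (enn2real (Q c r)) \<partial>lborel) = (\<integral>\<^sup>+r\<in>{a..b}. Q c r \<partial>lborel)" for a b
      by (rule nn_integral_cong_AE) (use Qfin in \<open>auto elim!: eventually_mono\<close>)
    have fin': "(\<integral>\<^sup>+r\<in>{a..b}. Q c r \<partial>lborel) < \<infinity>" for a b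
    proof -
      have "(\<integral>\<^sup>+r\<in>{a..b}. Q c r \<partial>lborel) \<le> (\<integral>\<^sup>+r. 2 * E r + 2 * q * indicator {a..b} r \<partial>lborel)"
        using QE by (intro nn_integral_mono) (auto simp: indicator_def)
      also have "\<dots> = 2 * (\<integral>\<^sup>+r. E r \<partial>lborel) + 2 * q * emeasure lborel {a..b}"
        by (subst nn_integral_add) (auto simp: nn_integral_cmult nn_integral_cmult_indicator)
      also have "\<dots> < \<infinity>"
      proof -
        have "emeasure lborel {a..b} < \<infinity>" by (cases "a \<le> b") auto
        then show ?thesis using Efin q by (simp add: ennreal_mult_less_top)
      qed
      finally show ?thesis .
    qed
    have "AE t in lborel. ((\<lambda>\<epsilon>. ennreal (1 / \<epsilon>) * (\<integral>\<^sup>+r\<in>{t..t + \<epsilon>}. ennreal (enn2real (Q c r)) \<partial>lborel)) \<longlongrightarrow> ennreal (enn2real (Q c t))) (at_right 0)"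
      by (rule nn_integral_Lebesgue_differentiation) (use fin' in \<open>auto simp: eq\<close>)
    from this[unfolded eq] Qfin show ?thesis
    proof eventually_elim
      case (elim t)
      show ?case using elim(1) unfolding elim(2)[symmetric] .
    qed
  qed
  then have "AE t in lborel. \<forall>c\<in>C. ((\<lambda>\<epsilon>. ennreal (1 / \<epsilon>) * (\<integral>\<^sup>+r\<in>{t..t + \<epsilon>}. Q c r \<partial>lborel)) \<longlongrightarrow> Q c t) (at_right 0)"
    by (simp add: AE_ball_countable[OF C(1)])
  with EAE show ?thesis
  proof (eventually_elim, intro conjI)
    fix t assume Et: "E t \<noteq> \<infinity>"
      and lim: "\<forall>c\<in>C. ((\<lambda>\<epsilon>. ennreal (1 / \<epsilon>) * (\<integral>\<^sup>+r\<in>{t..t + \<epsilon>}. Q c r \<partial>lborel)) \<longlongrightarrow> Q c t) (at_right 0)"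
    show Et': "(\<integral>\<^sup>+\<omega>. ennreal ((\<Gamma> \<omega> t)\<^sup>2) \<partial>M) < \<infinity>" using Et by (simp add: E_def less_top)
    show "((\<lambda>\<epsilon>. ennreal (1 / \<epsilon>) * (\<integral>\<^sup>+r\<in>{t..t + \<epsilon>}. (\<integral>\<^sup>+\<omega>. ennreal ((\<Gamma> \<omega> r - \<Gamma> \<omega> t)\<^sup>2) \<partial>M) \<partial>lborel)) \<longlongrightarrow> 0) (at_right 0)"
    proof (rule tendsto_0_ennrealI)
      fix e :: real assume e: "0 < e"
      \<comment> \<open>The average of \<open>Q c\<close> near \<open>t\<close> is soon below
        \<open>e / 4\<close> as well. Inserting \<open>c\<close> between the sections at
        \<open>r\<close> and at \<open>t\<close> doubles both quantities, and they add up to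
        \<open>e\<close>.\<close>
      then obtain c where c: "c \<in> C" "Q c t < ennreal (e / 4)"
        using Ce[rule_format, OF Et', of "e / 4"] unfolding Q_def by auto
      have cm [measurable]: "c \<in> borel_measurable M" using C c sq_integrable_measurable by blast
      have Qm [measurable]: "Q c \<in> borel_measurable borel" using Em[OF cm] by (simp add: Q_def[abs_def])
      have "eventually (\<lambda>\<epsilon>. ennreal (1 / \<epsilon>) * (\<integral>\<^sup>+r\<in>{t..t + \<epsilon>}. Q c r \<partial>lborel) < ennreal (e / 4)) (at_right 0)"
        using lim c by (intro order_tendstoD(2)[OF _ c(2)]) auto
      then show "eventually (\<lambda>\<epsilon>. ennreal (1 / \<epsilon>) * (\<integral>\<^sup>+r\<in>{t..t + \<epsilon>}. (\<integral>\<^sup>+\<omega>. ennreal ((\<Gamma> \<omega> r - \<Gamma> \<omega> t)\<^sup>2) \<partial>M) \<partial>lborel) \<le> ennreal e) (at_right 0)"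
        using eventually_at_right_less[of 0]
      proof eventually_elim
        fix \<epsilon> :: real
        assume lt: "ennreal (1 / \<epsilon>) * (\<integral>\<^sup>+r\<in>{t..t + \<epsilon>}. Q c r \<partial>lborel) < ennreal (e / 4)" and \<epsilon>: "0 < \<epsilon>"
        have "(\<integral>\<^sup>+r\<in>{t..t + \<epsilon>}. (\<integral>\<^sup>+\<omega>. ennreal ((\<Gamma> \<omega> r - \<Gamma> \<omega> t)\<^sup>2) \<partial>M) \<partial>lborel)
            \<le> (\<integral>\<^sup>+r. 2 * (Q c r * indicator {t..t + \<epsilon>} r) + 2 * Q c t * indicator {t..t + \<epsilon>} r \<partial>lborel)"
        proof (rule nn_integral_mono)
          fix r
          have "(\<integral>\<^sup>+\<omega>. ennreal ((\<Gamma> \<omega> r - \<Gamma> \<omega> t)\<^sup>2) \<partial>M) \<le> 2 * Q c r + 2 * Q c t"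
            unfolding Q_def
            by (rule nn_integral_le_twice_sum)
              (use square_diff_le[of "\<Gamma> _ r" "\<Gamma> _ t" "c _"] in \<open>auto simp: power2_commute[of "c _" "\<Gamma> _ t"]\<close>)
          then show "(\<integral>\<^sup>+\<omega>. ennreal ((\<Gamma> \<omega> r - \<Gamma> \<omega> t)\<^sup>2) \<partial>M) * indicator {t..t + \<epsilon>} r
              \<le> 2 * (Q c r * indicator {t..t + \<epsilon>} r) + 2 * Q c t * indicator {t..t + \<epsilon>} r"
            by (simp add: indicator_def)
        qed
        also have "\<dots> = 2 * (\<integral>\<^sup>+r\<in>{t..t + \<epsilon>}. Q c r \<partial>lborel) + 2 * Q c t * ennreal \<epsilon>"
          using \<epsilon> by (subst nn_integral_add) (auto simp: nn_integral_cmult nn_integral_cmult_indicator)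
        finally have "ennreal (1 / \<epsilon>) * (\<integral>\<^sup>+r\<in>{t..t + \<epsilon>}. (\<integral>\<^sup>+\<omega>. ennreal ((\<Gamma> \<omega> r - \<Gamma> \<omega> t)\<^sup>2) \<partial>M) \<partial>lborel)
            \<le> ennreal (1 / \<epsilon>) * (2 * (\<integral>\<^sup>+r\<in>{t..t + \<epsilon>}. Q c r \<partial>lborel) + 2 * Q c t * ennreal \<epsilon>)"
          by (rule mult_left_mono) simp
        also have "\<dots> = 2 * (ennreal (1 / \<epsilon>) * (\<integral>\<^sup>+r\<in>{t..t + \<epsilon>}. Q c r \<partial>lborel)) + 2 * Q c t * (ennreal (1 / \<epsilon>) * ennreal \<epsilon>)"
          by (simp only: distrib_left mult_ac)
        also have "ennreal (1 / \<epsilon>) * ennreal \<epsilon> = 1"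
          using \<epsilon> by (simp add: ennreal_mult[symmetric])
        also have "2 * (ennreal (1 / \<epsilon>) * (\<integral>\<^sup>+r\<in>{t..t + \<epsilon>}. Q c r \<partial>lborel)) + 2 * Q c t * 1
            \<le> 2 * ennreal (e / 4) + 2 * ennreal (e / 4) * 1"
          using lt c by (intro add_mono mult_mono) auto
        also have "\<dots> = ennreal (2 * (e / 4)) + ennreal (2 * (e / 4))"
          using e by (subst (1 2) ennreal_mult) auto
        also have "\<dots> = ennreal e" using e by (subst ennreal_plus[symmetric]) auto
        finally show "ennreal (1 / \<epsilon>) * (\<integral>\<^sup>+r\<in>{t..t + \<epsilon>}. (\<integral>\<^sup>+\<omega>. ennreal ((\<Gamma> \<omega> r - \<Gamma> \<omega> t)\<^sup>2) \<partial>M) \<partial>lborel) \<le> ennreal e" .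
      qed
    qed
  qed
qed

end

section \<open>Lipschitz generators and time-integrated second moments\<close>

text \<open>A Lipschitz function is the infimum, over a countable dense set of base points
  \<open>d\<close>, of the cones \<open>h d\<close> of slope \<open>K\<close> standing on its graph,
  and each cone is measurable in \<open>x\<close>. So measurability for fixed \<open>(y, z)\<close>
  is enough to substitute random arguments.\<close>

lemma Lipschitz_compose_measurable:
  fixes f :: "'x \<Rightarrow> real \<Rightarrow> 'v::{real_normed_vector, second_countable_topology} \<Rightarrow> real"
  assumes fm: "\<And>y z. (\<lambda>x. f x y z) \<in> borel_measurable N" and K: "0 \<le> K"
    and lip: "\<And>x y y' z z'. x \<in> space N \<Longrightarrow> \<bar>f x y z - f x y' z'\<bar> \<le> K * (\<bar>y - y'\<bar> + norm (z - z'))"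
    and Y[measurable]: "Y \<in> borel_measurable N" and Z[measurable]: "Z \<in> borel_measurable N"
  shows "(\<lambda>x. f x (Y x) (Z x)) \<in> borel_measurable N"
proof -
  obtain D :: "(real \<times> 'v) set" where D: "countable D" "\<And>X. open X \<Longrightarrow> X \<noteq> {} \<Longrightarrow> \<exists>d\<in>D. d \<in> X"
    by (erule countable_dense_setE)
  have Dne: "D \<noteq> {}" using D(2)[of UNIV] by auto
  define h where "h d x = f x (fst d) (snd d) + K * (\<bar>Y x - fst d\<bar> + norm (Z x - snd d))" for d x
  have [measurable]: "h d \<in> borel_measurable N" for d
    unfolding h_def[abs_def] using fm[of "fst d" "snd d"] by measurable
  have eq: "(INF d\<in>D. h d x) = f x (Y x) (Z x)" if x: "x \<in> space N" for x
  proof (rule cInf_eq_non_empty)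
    show "(\<lambda>d. h d x) ` D \<noteq> {}" using Dne by simp
    fix v assume "v \<in> (\<lambda>d. h d x) ` D"
    then obtain d where "v = h d x" by auto
    then show "f x (Y x) (Z x) \<le> v"
      using lip[OF x, of "Y x" "Z x" "fst d" "snd d"] by (simp add: h_def abs_le_iff)
  next
    fix w assume w: "\<And>v. v \<in> (\<lambda>d. h d x) ` D \<Longrightarrow> w \<le> v"
    show "w \<le> f x (Y x) (Z x)"
    proof (rule field_le_epsilon)
      fix e :: real assume e: "0 < e"
      \<comment> \<open>The value \<open>h d x\<close> exceeds the target by at most
        \<open>4 * K * \<delta>\<close>, a cone and a Lipschitz error of
        \<open>2 * K * \<delta>\<close> each; the added 1 covers \<open>K = 0\<close>.\<close>
      define \<delta> where "\<delta> = e / (4 * K + 1)"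
      have \<delta>: "0 < \<delta>" using e K by (simp add: \<delta>_def)
      have "\<exists>d\<in>D. d \<in> ball (Y x, Z x) \<delta>"
        by (rule D(2)) (use \<delta> in simp_all)
      then obtain d where d: "d \<in> D" "dist (Y x, Z x) d < \<delta>" by auto
      have 1: "\<bar>Y x - fst d\<bar> \<le> \<delta>" using dist_fst_le[of "(Y x, Z x)" d] d by (simp add: dist_real_def)
      have 2: "norm (Z x - snd d) \<le> \<delta>" using dist_snd_le[of "(Y x, Z x)" d] d by (simp add: dist_norm)
      have "K * (\<bar>Y x - fst d\<bar> + norm (Z x - snd d)) \<le> K * (\<delta> + \<delta>)"
        using 1 2 K by (intro mult_left_mono add_mono) auto
      moreover have "f x (fst d) (snd d) - f x (Y x) (Z x) \<le> K * (\<bar>Y x - fst d\<bar> + norm (Z x - snd d))"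
        using lip[OF x, of "Y x" "Z x" "fst d" "snd d"] by (simp add: abs_le_iff)
      ultimately have "h d x \<le> f x (Y x) (Z x) + 4 * K * \<delta>" by (simp add: h_def)
      moreover have "4 * K * \<delta> \<le> e"
      proof -
        have "4 * K * \<delta> = (4 * K / (4 * K + 1)) * e" by (simp add: \<delta>_def)
        also have "\<dots> \<le> 1 * e" using e K by (intro mult_right_mono) auto
        finally show ?thesis by simp
      qed
      moreover have "w \<le> h d x" using w d by blast
      ultimately show "w \<le> f x (Y x) (Z x) + e" by linarith
    qed
  qed
  have "(\<lambda>x. INF d\<in>D. h d x) \<in> borel_measurable N"
    by (intro borel_measurable_cINF_real D) simp
  then show ?thesis by (rule measurable_cong[THEN iffD1, rotated]) (rule eq)
qed

lemma set_lebesgue_integral_square_le: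
  fixes f :: "real \<Rightarrow> real"
  assumes int: "set_integrable lborel {a..b} f" and [measurable]: "f \<in> borel_measurable borel" and "a \<le> b"
  shows "ennreal ((LINT r:{a..b}|lborel. f r)\<^sup>2) \<le> ennreal (b - a) * (\<integral>\<^sup>+r\<in>{a..b}. ennreal ((f r)\<^sup>2) \<partial>lborel)"
proof -
  have i: "integrable lborel (\<lambda>r. indicator {a..b} r *\<^sub>R f r)" using int by (simp add: set_integrable_def)
  have "ennreal ((LINT r:{a..b}|lborel. f r)\<^sup>2) = (ennreal (norm (LINT r:{a..b}|lborel. f r)))\<^sup>2"
    by (simp add: ennreal_power)
  also have "\<dots> \<le> (\<integral>\<^sup>+r. ennreal (norm (indicator {a..b} r *\<^sub>R f r)) \<partial>lborel)\<^sup>2"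
    unfolding set_lebesgue_integral_def by (intro power_mono integral_norm_bound_ennreal i) simp
  also have "(\<integral>\<^sup>+r. ennreal (norm (indicator {a..b} r *\<^sub>R f r)) \<partial>lborel)
      = (\<integral>\<^sup>+r. ennreal (\<bar>f r\<bar> * indicator {a..b} r) * indicator {a..b} r \<partial>lborel)"
    by (intro nn_integral_cong) (simp add: indicator_def)
  also have "\<dots>\<^sup>2 \<le> (\<integral>\<^sup>+r. (ennreal (\<bar>f r\<bar> * indicator {a..b} r))\<^sup>2 \<partial>lborel) * (\<integral>\<^sup>+r. (indicator {a..b} r)\<^sup>2 \<partial>lborel)"
    by (rule Cauchy_Schwarz_nn_integral) auto
  also have "(\<integral>\<^sup>+r. (ennreal (\<bar>f r\<bar> * indicator {a..b} r))\<^sup>2 \<partial>lborel) = (\<integral>\<^sup>+r\<in>{a..b}. ennreal ((f r)\<^sup>2) \<partial>lborel)"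
    by (intro nn_integral_cong) (simp add: indicator_def ennreal_power)
  also have "(\<integral>\<^sup>+r. (indicator {a..b} r)\<^sup>2 \<partial>lborel) = (\<integral>\<^sup>+r. indicator {a..b} r \<partial>lborel)"
    by (intro nn_integral_cong) (simp add: indicator_def)
  also have "\<dots> = ennreal (b - a)" using \<open>a \<le> b\<close> by simp
  finally show ?thesis by (simp add: mult.commute)
qed

context prob_space
begin

lemma orthogonal_square_le:
  assumes U: "sq_integrable M U" and V: "sq_integrable M V" and o: "expectation (\<lambda>\<omega>. U \<omega> * V \<omega>) = 0"
  shows "(\<integral>\<^sup>+\<omega>. ennreal ((U \<omega>)\<^sup>2) \<partial>M) \<le> (\<integral>\<^sup>+\<omega>. ennreal ((U \<omega> + V \<omega>)\<^sup>2) \<partial>M)"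
    and "(\<integral>\<^sup>+\<omega>. ennreal ((V \<omega>)\<^sup>2) \<partial>M) \<le> (\<integral>\<^sup>+\<omega>. ennreal ((U \<omega> + V \<omega>)\<^sup>2) \<partial>M)"
proof -
  have u: "integrable M (\<lambda>\<omega>. (U \<omega>)\<^sup>2)" and v: "integrable M (\<lambda>\<omega>. (V \<omega>)\<^sup>2)"
    and "integrable M (\<lambda>\<omega>. (U \<omega> + V \<omega>)\<^sup>2)"
    using U V sq_integrable_add[OF U V] by (auto simp: sq_integrable_def)
  have "expectation (\<lambda>\<omega>. (U \<omega> + V \<omega>)\<^sup>2)
      = expectation (\<lambda>\<omega>. (U \<omega>)\<^sup>2 + (V \<omega>)\<^sup>2 + 2 * (U \<omega> * V \<omega>))"
    by (simp add: power2_sum mult.assoc)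
  also have "\<dots> = expectation (\<lambda>\<omega>. (U \<omega>)\<^sup>2) + expectation (\<lambda>\<omega>. (V \<omega>)\<^sup>2)"
    using u v sq_integrable_mult[OF U V] o by simp
  finally have eq: "expectation (\<lambda>\<omega>. (U \<omega> + V \<omega>)\<^sup>2) = expectation (\<lambda>\<omega>. (U \<omega>)\<^sup>2) + expectation (\<lambda>\<omega>. (V \<omega>)\<^sup>2)" .
  have nn: "0 \<le> expectation (\<lambda>\<omega>. (U \<omega>)\<^sup>2)" "0 \<le> expectation (\<lambda>\<omega>. (V \<omega>)\<^sup>2)"
    by (simp_all add: Bochner_Integration.integral_nonneg)
  have c: "(\<integral>\<^sup>+\<omega>. ennreal ((U \<omega>)\<^sup>2) \<partial>M) = ennreal (expectation (\<lambda>\<omega>. (U \<omega>)\<^sup>2))"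
    "(\<integral>\<^sup>+\<omega>. ennreal ((V \<omega>)\<^sup>2) \<partial>M) = ennreal (expectation (\<lambda>\<omega>. (V \<omega>)\<^sup>2))"
    "(\<integral>\<^sup>+\<omega>. ennreal ((U \<omega> + V \<omega>)\<^sup>2) \<partial>M) = ennreal (expectation (\<lambda>\<omega>. (U \<omega> + V \<omega>)\<^sup>2))"
    by (rule nn_integral_eq_integral, fact, simp)+
  show "(\<integral>\<^sup>+\<omega>. ennreal ((U \<omega>)\<^sup>2) \<partial>M) \<le> (\<integral>\<^sup>+\<omega>. ennreal ((U \<omega> + V \<omega>)\<^sup>2) \<partial>M)"
    "(\<integral>\<^sup>+\<omega>. ennreal ((V \<omega>)\<^sup>2) \<partial>M) \<le> (\<integral>\<^sup>+\<omega>. ennreal ((U \<omega> + V \<omega>)\<^sup>2) \<partial>M)"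
    unfolding c eq using nn by (simp_all add: ennreal_leI)
qed

text \<open>The squared norm over the product of \<open>M\<close> with time in
  \<open>[t, u]\<close>. Defined on the product so that it can be read in either order: pathwise for
  Cauchy-Schwarz in time and the Ito estimate, at a fixed time for second moments.\<close>

definition energy :: "real \<Rightarrow> real \<Rightarrow> ('a \<Rightarrow> real \<Rightarrow> real) \<Rightarrow> ennreal" where
  "energy t u \<phi> = (\<integral>\<^sup>+x. ennreal ((\<phi> (fst x) (snd x))\<^sup>2 * indicator {t..u} (snd x)) \<partial>(M \<Otimes>\<^sub>M lborel))"

definition jointly_measurable :: "('a \<Rightarrow> real \<Rightarrow> 'b::topological_space) \<Rightarrow> bool" where
  "jointly_measurable \<phi> \<longleftrightarrow> (\<lambda>x. \<phi> (fst x) (snd x)) \<in> borel_measurable (M \<Otimes>\<^sub>M lborel)"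

lemma jointly_measurable_section:
  assumes "jointly_measurable \<phi>"
  shows "(\<lambda>\<omega>. \<phi> \<omega> r) \<in> borel_measurable M" "\<omega> \<in> space M \<Longrightarrow> \<phi> \<omega> \<in> borel_measurable borel"
  using measurable_compose[OF measurable_Pair2'[of r lborel M] assms[unfolded jointly_measurable_def]]
    measurable_compose[OF measurable_Pair1'[of \<omega> M lborel] assms[unfolded jointly_measurable_def]]
  by auto

lemma energy_fst:
  assumes "jointly_measurable \<phi>"
  shows "energy t u \<phi> = (\<integral>\<^sup>+\<omega>. (\<integral>\<^sup>+r\<in>{t..u}. ennreal ((\<phi> \<omega> r)\<^sup>2) \<partial>lborel) \<partial>M)"
proof -
  have [measurable]: "(\<lambda>x. \<phi> (fst x) (snd x)) \<in> borel_measurable (M \<Otimes>\<^sub>M lborel)"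
    using assms by (simp add: jointly_measurable_def)
  have "energy t u \<phi> = (\<integral>\<^sup>+\<omega>. (\<integral>\<^sup>+r. ennreal ((\<phi> \<omega> r)\<^sup>2 * indicator {t..u} r) \<partial>lborel) \<partial>M)"
    unfolding energy_def by (subst lborel.nn_integral_fst[symmetric]) simp_all
  also have "\<dots> = (\<integral>\<^sup>+\<omega>. (\<integral>\<^sup>+r\<in>{t..u}. ennreal ((\<phi> \<omega> r)\<^sup>2) \<partial>lborel) \<partial>M)"
    by (intro nn_integral_cong) (simp add: indicator_def)
  finally show ?thesis .
qed

lemma energy_snd:
  assumes "jointly_measurable \<phi>"
  shows "energy t u \<phi> = (\<integral>\<^sup>+r\<in>{t..u}. (\<integral>\<^sup>+\<omega>. ennreal ((\<phi> \<omega> r)\<^sup>2) \<partial>M) \<partial>lborel)"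
proof -
  interpret P: pair_sigma_finite M lborel ..
  have [measurable]: "(\<lambda>x. \<phi> (fst x) (snd x)) \<in> borel_measurable (M \<Otimes>\<^sub>M lborel)"
    using assms by (simp add: jointly_measurable_def)
  have "energy t u \<phi> = (\<integral>\<^sup>+r. (\<integral>\<^sup>+\<omega>. ennreal ((\<phi> \<omega> r)\<^sup>2 * indicator {t..u} r) \<partial>M) \<partial>lborel)"
    unfolding energy_def by (subst P.nn_integral_snd[symmetric]) simp_all
  also have "\<dots> = (\<integral>\<^sup>+r\<in>{t..u}. (\<integral>\<^sup>+\<omega>. ennreal ((\<phi> \<omega> r)\<^sup>2) \<partial>M) \<partial>lborel)"
    by (intro nn_integral_cong) (simp add: indicator_def)
  finally show ?thesis .
qed

lemma energy_le:
  assumes le: "\<And>\<omega> r. \<omega> \<in> space M \<Longrightarrow> r \<in> {t..u} \<Longrightarrow> (\<phi> \<omega> r)\<^sup>2 \<le> 2 * (a \<omega> r)\<^sup>2 + 2 * (b \<omega> r)\<^sup>2"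
    and a: "jointly_measurable a" and b: "jointly_measurable b"
  shows "energy t u \<phi> \<le> 2 * energy t u a + 2 * energy t u b"
proof -
  have [measurable]: "(\<lambda>x. a (fst x) (snd x)) \<in> borel_measurable (M \<Otimes>\<^sub>M lborel)"
    "(\<lambda>x. b (fst x) (snd x)) \<in> borel_measurable (M \<Otimes>\<^sub>M lborel)"
    using a b by (simp_all add: jointly_measurable_def)
  show ?thesis unfolding energy_def
    by (rule nn_integral_le_twice_sum) (use le in \<open>auto simp: indicator_def space_pair_measure\<close>)
qed

lemma energy_cmult:
  assumes "jointly_measurable \<phi>"
  shows "energy t u (\<lambda>\<omega> r. c * \<phi> \<omega> r) = ennreal (c\<^sup>2) * energy t u \<phi>"
proof -
  have [measurable]: "(\<lambda>x. \<phi> (fst x) (snd x)) \<in> borel_measurable (M \<Otimes>\<^sub>M lborel)"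
    using assms by (simp add: jointly_measurable_def)
  show ?thesis unfolding energy_def
    by (subst nn_integral_cmult[symmetric])
      (auto simp: power_mult_distrib ennreal_mult mult.assoc intro!: nn_integral_cong)
qed

end

section \<open>A priori estimates on short intervals\<close>

lemma (in prob_space) energy_section:
  assumes c: "c \<in> borel_measurable M" and "t \<le> u"
  shows "energy t u (\<lambda>\<omega> r. c \<omega>) = ennreal (u - t) * (\<integral>\<^sup>+\<omega>. ennreal ((c \<omega>)\<^sup>2) \<partial>M)"
proof -
  have [measurable]: "c \<in> borel_measurable M" by (rule c)
  have "energy t u (\<lambda>\<omega> r. c \<omega>) = (\<integral>\<^sup>+r\<in>{t..u}. (\<integral>\<^sup>+\<omega>. ennreal ((c \<omega>)\<^sup>2) \<partial>M) \<partial>lborel)"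
    by (rule energy_snd) (simp add: jointly_measurable_def)
  also have "\<dots> = (\<integral>\<^sup>+\<omega>. ennreal ((c \<omega>)\<^sup>2) \<partial>M) * emeasure lborel {t..u}"
    by (rule nn_integral_cmult_indicator) simp
  finally show ?thesis using \<open>t \<le> u\<close> by (simp add: mult.commute)
qed

text \<open>The Lipschitz condition is required at every point, which makes compositions with
  processes measurable. Only joint measurability is asked for, because altering a generator on a
  null set of the product may destroy its progressive measurability.\<close>

locale lipschitz_generator = brownian_motion M B
  for M :: "'a measure" and B :: "real \<Rightarrow> 'a \<Rightarrow> real ^ 'd" +
  fixes f :: "'a \<Rightarrow> real \<Rightarrow> real \<Rightarrow> real ^ 'd \<Rightarrow> real" and K :: real
  assumes K: "0 \<le> K"
    and f_measurable: "jointly_measurable (\<lambda>\<omega> r. f \<omega> r y z)"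
    and f_lipschitz: "\<omega> \<in> space M \<Longrightarrow> \<bar>f \<omega> r y z - f \<omega> r y' z'\<bar> \<le> K * (\<bar>y - y'\<bar> + norm (z - z'))"

context lipschitz_generator
begin

lemma jointly_measurable_compose:
  assumes Y: "progressive F u Y" and Z: "progressive F u Z" and "0 \<le> u"
  shows "jointly_measurable (\<lambda>\<omega> r. f \<omega> r (if r \<in> {0..u} then Y r \<omega> else 0) (if r \<in> {0..u} then Z r \<omega> else 0))"
proof -
  have [measurable_cong]: "sets (M \<Otimes>\<^sub>M lborel) = sets (M \<Otimes>\<^sub>M borel)" by simp
  have *: "(\<lambda>x. if snd x \<in> {0..u} then Y (snd x) (fst x) else 0) \<in> borel_measurable (M \<Otimes>\<^sub>M lborel)"
    "(\<lambda>x. if snd x \<in> {0..u} then Z (snd x) (fst x) else 0) \<in> borel_measurable (M \<Otimes>\<^sub>M lborel)"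
    using progressive_measurable[OF Y \<open>0 \<le> u\<close>] progressive_measurable[OF Z \<open>0 \<le> u\<close>]
    by (simp_all add: case_prod_beta')
  show ?thesis
    unfolding jointly_measurable_def
  proof (rule Lipschitz_compose_measurable[where f="\<lambda>x. f (fst x) (snd x)", OF _ K f_lipschitz * ])
    show "(\<lambda>x. f (fst x) (snd x) y z) \<in> borel_measurable (M \<Otimes>\<^sub>M lborel)" for y z
      using f_measurable by (simp add: jointly_measurable_def)
  qed (auto simp: space_pair_measure)
qed

end

text \<open>One BSDE with terminal time \<open>t + \<epsilon>\<close>, rewritten with
  \<open>f\<close> and Borel integrals. With \<open>n\<close> the energy of \<open>\<Phi>\<close>,
  the estimates will lead to \<open>n \<le> 24 * K\<^sup>2 * \<epsilon> * n\<close> plus known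
  terms; \<open>48 * K\<^sup>2 * \<epsilon> \<le> 1\<close> makes the first term at most half of
  \<open>n\<close>.\<close>

locale short_bsde = lipschitz_generator M B f K
  for M :: "'a measure" and B :: "real \<Rightarrow> 'a \<Rightarrow> real ^ 'd" and f K +
  fixes t \<epsilon> y :: real and z :: "real ^ 'd" and Y :: "real \<Rightarrow> 'a \<Rightarrow> real"
    and Z :: "real \<Rightarrow> 'a \<Rightarrow> real ^ 'd" and I :: "real \<Rightarrow> 'a \<Rightarrow> real"
  assumes t: "0 \<le> t" and \<epsilon>: "0 < \<epsilon>" "\<epsilon> \<le> 1" "48 * K\<^sup>2 * \<epsilon> \<le> 1"
    and Y_progressive: "progressive (augmented_filtration M B) (t + \<epsilon>) Y"
    and Z_progressive: "progressive (augmented_filtration M B) (t + \<epsilon>) Z"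
    and Y_sup: "(\<integral>\<^sup>+\<omega>. (SUP s\<in>{0..t + \<epsilon>}. ennreal (\<bar>Y s \<omega>\<bar>\<^sup>2)) \<partial>M) < \<infinity>"
    and Z_energy: "(\<integral>\<^sup>+\<omega>. (\<integral>\<^sup>+s\<in>{0..t + \<epsilon>}. ennreal ((norm (Z s \<omega>))\<^sup>2) \<partial>lborel) \<partial>M) < \<infinity>"
    and ito: "ito_integral M B (t + \<epsilon>) Z I"
    and G_energy: "energy t (t + \<epsilon>) (\<lambda>\<omega> r. f \<omega> r y z) < \<infinity>"
    and bsde: "AE \<omega> in M. \<forall>s\<in>{t..t + \<epsilon>}. set_integrable lborel {s..t + \<epsilon>} (\<lambda>r. f \<omega> r (Y r \<omega>) (Z r \<omega>)) \<and>
      Y s \<omega> = y + z \<bullet> (B (t + \<epsilon>) \<omega> - B t \<omega>)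
        + (LINT r:{s..t + \<epsilon>}|lborel. f \<omega> r (Y r \<omega>) (Z r \<omega>)) - (I (t + \<epsilon>) \<omega> - I s \<omega>)"
begin

abbreviation u :: real where "u \<equiv> t + \<epsilon>"
abbreviation E :: "('a \<Rightarrow> real \<Rightarrow> real) \<Rightarrow> ennreal" where "E \<equiv> energy t u"

text \<open>The continuation by 0 is harmless, because all energies below are taken over
  \<open>[t, u]\<close>, a part of \<open>[0, u]\<close>.\<close>

definition Yx :: "'a \<Rightarrow> real \<Rightarrow> real" where "Yx \<omega> r = (if r \<in> {0..u} then Y r \<omega> else 0)"
definition Zx :: "'a \<Rightarrow> real \<Rightarrow> real ^ 'd" where "Zx \<omega> r = (if r \<in> {0..u} then Z r \<omega> else 0)"
definition dY :: "'a \<Rightarrow> real \<Rightarrow> real" where "dY \<omega> r = Yx \<omega> r - y"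
definition dZ :: "'a \<Rightarrow> real \<Rightarrow> real" where "dZ \<omega> r = norm (Zx \<omega> r - z)"
definition \<Phi> :: "'a \<Rightarrow> real \<Rightarrow> real" where "\<Phi> \<omega> r = f \<omega> r (Yx \<omega> r) (Zx \<omega> r)"
definition G :: "'a \<Rightarrow> real \<Rightarrow> real" where "G \<omega> r = f \<omega> r y z"

lemma jointly_measurable_Yx: "jointly_measurable Yx"
  using progressive_measurable[OF Y_progressive] t \<epsilon>
  by (simp add: jointly_measurable_def Yx_def[abs_def] case_prod_beta')

lemma jointly_measurable_Zx: "jointly_measurable Zx"
  using progressive_measurable[OF Z_progressive] t \<epsilon>
  by (simp add: jointly_measurable_def Zx_def[abs_def] case_prod_beta')

lemma jointly_measurable_dY: "jointly_measurable dY"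
  using jointly_measurable_Yx unfolding jointly_measurable_def dY_def by measurable

lemma jointly_measurable_dZ: "jointly_measurable dZ"
  using jointly_measurable_Zx unfolding jointly_measurable_def dZ_def by measurable

lemma jointly_measurable_G: "jointly_measurable G"
  using f_measurable[of y z] by (simp add: G_def[abs_def])

lemma jointly_measurable_\<Phi>: "jointly_measurable \<Phi>"
  unfolding \<Phi>_def[abs_def] Yx_def Zx_def
  by (rule jointly_measurable_compose[OF Y_progressive Z_progressive]) (use t \<epsilon> in simp)

lemma jointly_measurable_diff:
  "jointly_measurable a \<Longrightarrow> jointly_measurable b \<Longrightarrow> jointly_measurable (\<lambda>\<omega> r. a \<omega> r - b \<omega> r :: real)"
  unfolding jointly_measurable_def by (rule borel_measurable_diff)

lemma jointly_measurable_cmult: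
  "jointly_measurable a \<Longrightarrow> jointly_measurable (\<lambda>\<omega> r. c * a \<omega> r :: real)"
  unfolding jointly_measurable_def by (rule borel_measurable_times[OF borel_measurable_const])

lemma energy_diff_le: "energy t (u) (\<lambda>\<omega> r. \<Phi> \<omega> r - G \<omega> r)
    \<le> 2 * (ennreal (K\<^sup>2) * energy t (u) dY) + 2 * (ennreal (K\<^sup>2) * energy t (u) dZ)"
proof -
  have "energy t (u) (\<lambda>\<omega> r. \<Phi> \<omega> r - G \<omega> r)
      \<le> 2 * energy t (u) (\<lambda>\<omega> r. K * dY \<omega> r) + 2 * energy t (u) (\<lambda>\<omega> r. K * dZ \<omega> r)"
  proof (rule energy_le)
    fix \<omega> r assume "\<omega> \<in> space M"
    then have "\<bar>\<Phi> \<omega> r - G \<omega> r\<bar> \<le> K * (\<bar>dY \<omega> r\<bar> + dZ \<omega> r)"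
      using f_lipschitz[of \<omega> r "Yx \<omega> r" "Zx \<omega> r" y z] by (simp add: \<Phi>_def G_def dY_def dZ_def)
    then have "(\<Phi> \<omega> r - G \<omega> r)\<^sup>2 \<le> (K * \<bar>dY \<omega> r\<bar> + K * dZ \<omega> r)\<^sup>2"
      using power_mono[of "\<bar>\<Phi> \<omega> r - G \<omega> r\<bar>" _ 2] by (simp add: distrib_left)
    also have "\<dots> \<le> 2 * (K * \<bar>dY \<omega> r\<bar>)\<^sup>2 + 2 * (K * dZ \<omega> r)\<^sup>2"
      using square_diff_le[of "K * \<bar>dY \<omega> r\<bar>" "- (K * dZ \<omega> r)" 0] by simp
    finally show "(\<Phi> \<omega> r - G \<omega> r)\<^sup>2 \<le> 2 * (K * dY \<omega> r)\<^sup>2 + 2 * (K * dZ \<omega> r)\<^sup>2"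
      by (simp add: power_mult_distrib)
  qed (intro jointly_measurable_cmult jointly_measurable_dY jointly_measurable_dZ)+
  then show ?thesis by (simp add: energy_cmult jointly_measurable_dY jointly_measurable_dZ)
qed

lemma energy_\<Phi>_le: "energy t (u) \<Phi>
    \<le> 2 * energy t (u) (\<lambda>\<omega> r. \<Phi> \<omega> r - G \<omega> r) + 2 * energy t (u) G"
  by (rule energy_le)
    (use square_diff_le[of "\<Phi> _ _" 0 "G _ _"] in \<open>auto intro: jointly_measurable_diff jointly_measurable_\<Phi> jointly_measurable_G\<close>)

text \<open>The expected supremum dominates the second moment at all times, and the interval has
  length at most 1.\<close>

lemma energy_dY_finite: "energy t (u) dY < \<infinity>"
proof -
  have "energy t (u) Yx \<le> (\<integral>\<^sup>+\<omega>. (SUP s\<in>{0..u}. ennreal (\<bar>Y s \<omega>\<bar>\<^sup>2)) \<partial>M)"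
    unfolding energy_fst[OF jointly_measurable_Yx]
  proof (rule nn_integral_mono)
    fix \<omega>
    let ?S = "SUP s\<in>{0..u}. ennreal (\<bar>Y s \<omega>\<bar>\<^sup>2)"
    have "(\<integral>\<^sup>+r\<in>{t..u}. ennreal ((Yx \<omega> r)\<^sup>2) \<partial>lborel) \<le> (\<integral>\<^sup>+r. ?S * indicator {t..u} r \<partial>lborel)"
    proof (rule nn_integral_mono)
      fix r
      show "ennreal ((Yx \<omega> r)\<^sup>2) * indicator {t..u} r \<le> ?S * indicator {t..u} r"
      proof (cases "r \<in> {t..u}")
        case True
        then have r: "r \<in> {0..u}" using t by auto
        then have "ennreal ((Yx \<omega> r)\<^sup>2) = ennreal (\<bar>Y r \<omega>\<bar>\<^sup>2)" by (simp add: Yx_def)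
        also have "\<dots> \<le> ?S" by (rule SUP_upper[OF r])
        finally show ?thesis by (rule mult_right_mono) simp
      qed simp
    qed
    also have "\<dots> = ?S * ennreal \<epsilon>" using \<epsilon> by (subst nn_integral_cmult_indicator) auto
    also have "\<dots> \<le> ?S * 1" using \<epsilon> by (intro mult_left_mono) (auto simp: ennreal_le_1)
    finally show "(\<integral>\<^sup>+r\<in>{t..u}. ennreal ((Yx \<omega> r)\<^sup>2) \<partial>lborel) \<le> ?S" by simp
  qed
  then have 1: "energy t (u) Yx < \<infinity>" using Y_sup by (rule le_less_trans)
  have 2: "energy t (u) (\<lambda>_ _. y) < \<infinity>"
    using \<epsilon> by (subst energy_section) (auto simp: emeasure_space_1 ennreal_mult[symmetric])
  have "energy t (u) dY \<le> 2 * energy t (u) Yx + 2 * energy t (u) (\<lambda>_ _. y)"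
    by (rule energy_le)
      (use square_diff_le[of "Yx _ _" y 0] jointly_measurable_Yx in \<open>auto simp: dY_def jointly_measurable_def\<close>)
  also have "\<dots> < \<infinity>" using 1 2 by (simp add: ennreal_mult_less_top)
  finally show ?thesis .
qed

lemma energy_dZ_finite: "energy t (u) dZ < \<infinity>"
proof -
  let ?n = "\<lambda>\<omega> r. norm (Zx \<omega> r)"
  have nm: "jointly_measurable ?n"
    using jointly_measurable_Zx unfolding jointly_measurable_def by measurable
  have "energy t (u) ?n \<le> (\<integral>\<^sup>+\<omega>. (\<integral>\<^sup>+s\<in>{0..u}. ennreal ((norm (Z s \<omega>))\<^sup>2) \<partial>lborel) \<partial>M)"
    unfolding energy_fst[OF nm] using t
    by (intro nn_integral_mono) (auto simp: indicator_def Zx_def)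
  then have 1: "energy t (u) ?n < \<infinity>" using Z_energy by (rule le_less_trans)
  have 2: "energy t (u) (\<lambda>_ _. norm z) < \<infinity>"
    using \<epsilon> by (subst energy_section) (auto simp: emeasure_space_1 ennreal_mult[symmetric])
  have "energy t (u) dZ \<le> 2 * energy t (u) ?n + 2 * energy t (u) (\<lambda>_ _. norm z)"
    by (rule energy_le)
      (use norm_diff_square_le[of "Zx _ _" z 0] nm in \<open>auto simp: dZ_def jointly_measurable_def\<close>)
  also have "\<dots> < \<infinity>" using 1 2 by (simp add: ennreal_mult_less_top)
  finally show ?thesis .
qed

text \<open>This must be known beforehand: the energy of \<open>\<Phi>\<close> is going to be moved
  from the right side of an inequality to the left, which is void for an infinite value.\<close>

lemma energy_\<Phi>_finite: "energy t (u) \<Phi> < \<infinity>"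
proof -
  have "2 * (ennreal (K\<^sup>2) * energy t (u) dY) + 2 * (ennreal (K\<^sup>2) * energy t (u) dZ) < \<infinity>"
    using energy_dY_finite energy_dZ_finite by (simp add: ennreal_mult_less_top)
  then have "energy t (u) (\<lambda>\<omega> r. \<Phi> \<omega> r - G \<omega> r) < \<infinity>"
    by (rule le_less_trans[OF energy_diff_le])
  then have "2 * energy t (u) (\<lambda>\<omega> r. \<Phi> \<omega> r - G \<omega> r) + 2 * energy t (u) G < \<infinity>"
    using G_energy by (simp add: ennreal_mult_less_top G_def[abs_def])
  then show ?thesis by (rule le_less_trans[OF energy_\<Phi>_le])
qed

definition Yh :: "real \<Rightarrow> 'a \<Rightarrow> real" where "Yh s \<omega> = Y s \<omega> - y - z \<bullet> (B s \<omega> - B t \<omega>)"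
definition J :: "real \<Rightarrow> 'a \<Rightarrow> real" where
  "J s \<omega> = I (u) \<omega> - I s \<omega> - z \<bullet> (B (u) \<omega> - B s \<omega>)"

lemma Y_sq_integrable:
  assumes s: "s \<in> {0..u}"
  shows "Y s \<in> borel_measurable (F s)" "sq_integrable M (Y s)"
proof -
  show 1: "Y s \<in> borel_measurable (F s)" by (rule progressive_adapted[OF Y_progressive]) (use s in auto)
  have "(\<integral>\<^sup>+\<omega>. ennreal ((Y s \<omega>)\<^sup>2) \<partial>M) \<le> (\<integral>\<^sup>+\<omega>. (SUP s\<in>{0..u}. ennreal (\<bar>Y s \<omega>\<bar>\<^sup>2)) \<partial>M)"
    by (intro nn_integral_mono SUP_upper2[OF s]) simp
  also note Y_sup
  finally show "sq_integrable M (Y s)"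
    using F_measurable[OF 1] by (simp add: sq_integrable_iff_nn_integral)
qed

lemma increment_const_sq_integrable:
  assumes "s \<in> {t..u}"
  shows "sq_integrable M (\<lambda>\<omega>. z \<bullet> (B s \<omega> - B t \<omega>))"
  using increment_sq_integrable[of t s "\<lambda>_. z"] assms t by (simp add: bounded_F_const increment_def[abs_def])

lemma Yh_sq_integrable:
  assumes s: "s \<in> {t..u}"
  shows "Yh s \<in> borel_measurable (F s)" "sq_integrable M (Yh s)"
proof -
  have [measurable]: "Y s \<in> borel_measurable (F s)" "B s \<in> borel_measurable (F s)" "B t \<in> borel_measurable (F s)"
    using s t by (auto intro: Y_sq_integrable B_F_measurable)
  show "Yh s \<in> borel_measurable (F s)" unfolding Yh_def[abs_def] by measurable
  show "sq_integrable M (Yh s)" unfolding Yh_def[abs_def] using s t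
    by (intro sq_integrable_diff Y_sq_integrable increment_const_sq_integrable sq_integrable_const) auto
qed

lemma J_sq_integrable: "s \<in> {t..u} \<Longrightarrow> sq_integrable M (J s)"
  unfolding J_def[abs_def] using t
  by (intro ito_increment_sq_integrable[OF ito Z_progressive]) auto

lemma J_orthogonal:
  assumes "s \<in> {t..u}" "U \<in> borel_measurable (F s)" "sq_integrable M U"
  shows "expectation (\<lambda>\<omega>. U \<omega> * J s \<omega>) = 0"
  unfolding J_def using t assms
  by (intro ito_increment_orthogonal[OF ito Z_progressive]) auto

text \<open>The martingale part of the terminal value splits at \<open>s\<close>: what is known at
  time \<open>s\<close> goes into \<open>Yh s\<close>, the later increment is combined with the
  stochastic integral in \<open>J s\<close>. Only the drift is left.\<close>

lemma drift_AE:
  "AE \<omega> in M. \<forall>s\<in>{t..u}. set_integrable lborel {s..u} (\<Phi> \<omega>) \<and>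
     Yh s \<omega> + J s \<omega> = (LINT r:{s..u}|lborel. \<Phi> \<omega> r)"
  using bsde
proof eventually_elim
  case (elim \<omega>)
  show ?case
  proof
    fix s assume s: "s \<in> {t..u}"
    have eq: "f \<omega> r (Y r \<omega>) (Z r \<omega>) = \<Phi> \<omega> r" if "r \<in> {s..u}" for r
      using that s t by (simp add: \<Phi>_def Yx_def Zx_def)
    have "set_integrable lborel {s..u} (\<lambda>r. f \<omega> r (Y r \<omega>) (Z r \<omega>)) \<longleftrightarrow> set_integrable lborel {s..u} (\<Phi> \<omega>)"
      by (rule set_integrable_cong) (auto simp: eq)
    moreover have "(LINT r:{s..u}|lborel. f \<omega> r (Y r \<omega>) (Z r \<omega>)) = (LINT r:{s..u}|lborel. \<Phi> \<omega> r)"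
      by (rule set_lebesgue_integral_cong) (auto simp: eq)
    moreover have "z \<bullet> (B (u) \<omega> - B t \<omega>) = z \<bullet> (B (u) \<omega> - B s \<omega>) + z \<bullet> (B s \<omega> - B t \<omega>)"
      by (simp add: inner_diff_right)
    ultimately show "set_integrable lborel {s..u} (\<Phi> \<omega>) \<and>
        Yh s \<omega> + J s \<omega> = (LINT r:{s..u}|lborel. \<Phi> \<omega> r)"
      using elim s by (auto simp: Yh_def J_def)
  qed
qed

lemma drift_square_le:
  assumes s: "s \<in> {t..u}"
  shows "(\<integral>\<^sup>+\<omega>. ennreal ((Yh s \<omega> + J s \<omega>)\<^sup>2) \<partial>M) \<le> ennreal \<epsilon> * energy t (u) \<Phi>"
proof -
  have [measurable]: "(\<lambda>x. \<Phi> (fst x) (snd x)) \<in> borel_measurable (M \<Otimes>\<^sub>M lborel)"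
    using jointly_measurable_\<Phi> by (simp add: jointly_measurable_def)
  have "(\<integral>\<^sup>+\<omega>. ennreal ((Yh s \<omega> + J s \<omega>)\<^sup>2) \<partial>M)
      \<le> (\<integral>\<^sup>+\<omega>. ennreal \<epsilon> * (\<integral>\<^sup>+r\<in>{t..u}. ennreal ((\<Phi> \<omega> r)\<^sup>2) \<partial>lborel) \<partial>M)"
  proof (rule nn_integral_mono_AE)
    show "AE \<omega> in M. ennreal ((Yh s \<omega> + J s \<omega>)\<^sup>2) \<le> ennreal \<epsilon> * (\<integral>\<^sup>+r\<in>{t..u}. ennreal ((\<Phi> \<omega> r)\<^sup>2) \<partial>lborel)"
      using drift_AE AE_space
    proof eventually_elim
      case (elim \<omega>)
      have \<Phi>m: "\<Phi> \<omega> \<in> borel_measurable borel"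
        by (rule jointly_measurable_section(2)[OF jointly_measurable_\<Phi> elim(2)])
      have "ennreal ((Yh s \<omega> + J s \<omega>)\<^sup>2) = ennreal ((LINT r:{s..u}|lborel. \<Phi> \<omega> r)\<^sup>2)"
        using elim s by simp
      also have "\<dots> \<le> ennreal (u - s) * (\<integral>\<^sup>+r\<in>{s..u}. ennreal ((\<Phi> \<omega> r)\<^sup>2) \<partial>lborel)"
        using elim s by (intro set_lebesgue_integral_square_le \<Phi>m) auto
      also have "\<dots> \<le> ennreal \<epsilon> * (\<integral>\<^sup>+r\<in>{t..u}. ennreal ((\<Phi> \<omega> r)\<^sup>2) \<partial>lborel)"
        using s by (intro mult_mono ennreal_leI nn_integral_mono) (auto simp: indicator_def)
      finally show ?case .
    qed
  qed
  also have "\<dots> = ennreal \<epsilon> * energy t (u) \<Phi>"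
    unfolding energy_fst[OF jointly_measurable_\<Phi>]
    by (rule nn_integral_cmult) measurable
  finally show ?thesis .
qed

lemma Yh_le:
  assumes s: "s \<in> {t..u}"
  shows "(\<integral>\<^sup>+\<omega>. ennreal ((Yh s \<omega>)\<^sup>2) \<partial>M) \<le> ennreal \<epsilon> * energy t (u) \<Phi>"
    and "(\<integral>\<^sup>+\<omega>. ennreal ((J s \<omega>)\<^sup>2) \<partial>M) \<le> ennreal \<epsilon> * energy t (u) \<Phi>"
  using orthogonal_square_le[OF Yh_sq_integrable(2)[OF s] J_sq_integrable[OF s] J_orthogonal[OF s Yh_sq_integrable[OF s]]]
    drift_square_le[OF s] by (auto intro: order_trans)

text \<open>At each time \<open>dY\<close> is \<open>Yh\<close> plus a Brownian increment of
  variance at most \<open>\<epsilon> * (norm z)\<^sup>2\<close>. Integration over time yields the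
  additional factor \<open>\<epsilon>\<close>.\<close>

lemma energy_dY_le:
  "energy t (u) dY \<le> ennreal \<epsilon> * (2 * (ennreal \<epsilon> * energy t (u) \<Phi>) + 2 * ennreal (\<epsilon> * (norm z)\<^sup>2))"
proof -
  let ?c = "2 * (ennreal \<epsilon> * energy t (u) \<Phi>) + 2 * ennreal (\<epsilon> * (norm z)\<^sup>2)"
  have "(\<integral>\<^sup>+\<omega>. ennreal ((dY \<omega> r)\<^sup>2) \<partial>M) \<le> ?c" if r: "r \<in> {t..u}" for r
  proof -
    have sq: "sq_integrable M (\<lambda>\<omega>. z \<bullet> (B r \<omega> - B t \<omega>))" by (rule increment_const_sq_integrable[OF r])
    have "(\<integral>\<^sup>+\<omega>. ennreal ((dY \<omega> r)\<^sup>2) \<partial>M)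
        \<le> 2 * (\<integral>\<^sup>+\<omega>. ennreal ((Yh r \<omega>)\<^sup>2) \<partial>M) + 2 * (\<integral>\<^sup>+\<omega>. ennreal ((z \<bullet> (B r \<omega> - B t \<omega>))\<^sup>2) \<partial>M)"
    proof (rule nn_integral_le_twice_sum)
      fix \<omega>
      have "dY \<omega> r = Yh r \<omega> + z \<bullet> (B r \<omega> - B t \<omega>)" using r t by (simp add: dY_def Yx_def Yh_def)
      then show "(dY \<omega> r)\<^sup>2 \<le> 2 * (Yh r \<omega>)\<^sup>2 + 2 * (z \<bullet> (B r \<omega> - B t \<omega>))\<^sup>2"
        using square_diff_le[of "Yh r \<omega>" "- (z \<bullet> (B r \<omega> - B t \<omega>))" 0] by simp
    qed (use sq_integrable_measurable[OF Yh_sq_integrable(2)[OF r]] sq_integrable_measurable[OF sq] in auto)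
    also have "(\<integral>\<^sup>+\<omega>. ennreal ((z \<bullet> (B r \<omega> - B t \<omega>))\<^sup>2) \<partial>M) = ennreal (expectation (\<lambda>\<omega>. (z \<bullet> (B r \<omega> - B t \<omega>))\<^sup>2))"
      using sq by (intro nn_integral_eq_integral) (auto simp: sq_integrable_def)
    also have "expectation (\<lambda>\<omega>. (z \<bullet> (B r \<omega> - B t \<omega>))\<^sup>2) = (r - t) * (norm z)\<^sup>2"
      using expectation_increment_same[OF t, of r "\<lambda>_. z" "\<lambda>_. z"] r prob_space
      by (simp add: bounded_F_const increment_def power2_eq_square power2_norm_eq_inner[unfolded power2_eq_square])
    also have "2 * (\<integral>\<^sup>+\<omega>. ennreal ((Yh r \<omega>)\<^sup>2) \<partial>M) + 2 * ennreal ((r - t) * (norm z)\<^sup>2) \<le> ?c"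
      using r by (intro add_mono mult_left_mono Yh_le(1) ennreal_leI mult_right_mono) auto
    finally show ?thesis .
  qed
  then have "energy t (u) dY \<le> (\<integral>\<^sup>+r. ?c * indicator {t..u} r \<partial>lborel)"
    unfolding energy_snd[OF jointly_measurable_dY] by (intro nn_integral_mono) (auto simp: indicator_def)
  also have "\<dots> = ?c * emeasure lborel {t..u}" by (rule nn_integral_cmult_indicator) simp
  finally show ?thesis using \<epsilon> by (simp add: mult.commute)
qed

text \<open>\<open>J t\<close> is the Ito integral of \<open>Z - z\<close> over the whole interval,
  so the single time \<open>s = t\<close> controls all of \<open>Z\<close>.\<close>

lemma energy_dZ_le: "energy t (u) dZ \<le> 4 * (ennreal \<epsilon> * energy t (u) \<Phi>)"
proof -
  have tt: "t \<in> {t..u}" using \<epsilon> by simp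
  have "energy t (u) dZ = (\<integral>\<^sup>+\<omega>. (\<integral>\<^sup>+r\<in>{t..u}. ennreal ((norm (Z r \<omega> - z))\<^sup>2) \<partial>lborel) \<partial>M)"
    unfolding energy_fst[OF jointly_measurable_dZ] using t
    by (intro nn_integral_cong) (auto simp: indicator_def dZ_def Zx_def)
  also have "\<dots> \<le> 4 * (\<integral>\<^sup>+\<omega>. ennreal ((J t \<omega>)\<^sup>2) \<partial>M)"
    unfolding J_def by (rule ito_increment_energy_le[OF ito Z_progressive t]) (use \<epsilon> in auto)
  also have "\<dots> \<le> 4 * (ennreal \<epsilon> * energy t (u) \<Phi>)"
    by (intro mult_left_mono Yh_le(2)[OF tt]) simp
  finally show ?thesis .
qed

text \<open>The bound is \<open>\<epsilon>\<close> times a bracket that vanishes with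
  \<open>\<epsilon>\<close> as soon as the energy of \<open>G\<close> does. This gain is what the
  division by \<open>\<epsilon>\<close> in the difference quotient consumes.\<close>

lemma energy_diff_bound:
  defines "\<gamma> \<equiv> enn2real (energy t (u) G)"
  shows "energy t (u) (\<lambda>\<omega> r. \<Phi> \<omega> r - G \<omega> r)
    \<le> ennreal (\<epsilon> * (48 * K\<^sup>2 * \<gamma> + (192 * K ^ 4 + 4 * K\<^sup>2) * (norm z)\<^sup>2 * \<epsilon>))"
proof -
  define n where "n = enn2real (energy t (u) \<Phi>)"
  have n: "energy t (u) \<Phi> = ennreal n" "0 \<le> n"
    using energy_\<Phi>_finite by (simp_all add: n_def)
  have \<gamma>: "energy t (u) G = ennreal \<gamma>" "0 \<le> \<gamma>"
    using G_energy by (simp_all add: \<gamma>_def G_def[abs_def])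
  define q where "q = (norm z)\<^sup>2"
  have q: "0 \<le> q" by (simp add: q_def)
  \<comment> \<open>The energies of \<open>dY\<close> and \<open>dZ\<close> enter with weight
    \<open>2 * K\<^sup>2\<close>. They contribute 4 and 8 times
    \<open>K\<^sup>2 * \<epsilon> * n\<close>, the former after
    \<open>\<epsilon> * \<epsilon> \<le> \<epsilon>\<close>; the last term stems from the Brownian
    part of \<open>dY\<close>.\<close>
  define A where "A = 12 * K\<^sup>2 * \<epsilon> * n + 4 * K\<^sup>2 * q * \<epsilon>\<^sup>2"
  have Y: "energy t (u) dY \<le> ennreal (\<epsilon> * (2 * (\<epsilon> * n) + 2 * (\<epsilon> * q)))"
    using energy_dY_le n q \<epsilon> by (simp add: ennreal_mult ennreal_plus q_def)
  have Z: "energy t (u) dZ \<le> ennreal (4 * (\<epsilon> * n))"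
    using energy_dZ_le n \<epsilon> by (simp add: ennreal_mult)
  have "energy t (u) (\<lambda>\<omega> r. \<Phi> \<omega> r - G \<omega> r)
      \<le> 2 * (ennreal (K\<^sup>2) * ennreal (\<epsilon> * (2 * (\<epsilon> * n) + 2 * (\<epsilon> * q)))) + 2 * (ennreal (K\<^sup>2) * ennreal (4 * (\<epsilon> * n)))"
    by (rule order_trans[OF energy_diff_le]) (intro add_mono mult_left_mono Y Z; simp)
  also have "\<dots> = ennreal (2 * (K\<^sup>2 * (\<epsilon> * (2 * (\<epsilon> * n) + 2 * (\<epsilon> * q)))) + 2 * (K\<^sup>2 * (4 * (\<epsilon> * n))))"
  proof -
    have "2 * (ennreal (K\<^sup>2) * ennreal v) + 2 * (ennreal (K\<^sup>2) * ennreal w) = ennreal (2 * (K\<^sup>2 * v) + 2 * (K\<^sup>2 * w))"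
      if "0 \<le> v" "0 \<le> w" for v w
      using that by (simp add: ennreal_mult ennreal_plus)
    then show ?thesis using n q \<epsilon> by simp
  qed
  also have "\<dots> \<le> ennreal A"
  proof (rule ennreal_leI)
    have "\<epsilon> * \<epsilon> * n \<le> 1 * \<epsilon> * n" using \<epsilon> n by (intro mult_right_mono) auto
    then have "K\<^sup>2 * (\<epsilon> * \<epsilon> * n) \<le> K\<^sup>2 * (\<epsilon> * n)" by (intro mult_left_mono) auto
    then show "2 * (K\<^sup>2 * (\<epsilon> * (2 * (\<epsilon> * n) + 2 * (\<epsilon> * q)))) + 2 * (K\<^sup>2 * (4 * (\<epsilon> * n))) \<le> A"
      by (simp add: A_def algebra_simps power2_eq_square)
  qed
  finally have A: "energy t (u) (\<lambda>\<omega> r. \<Phi> \<omega> r - G \<omega> r) \<le> ennreal A" .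
  have A0: "0 \<le> A" using n q \<epsilon> by (simp add: A_def)
  have "ennreal n \<le> 2 * ennreal A + 2 * ennreal \<gamma>"
    using energy_\<Phi>_le unfolding n \<gamma> by (rule order_trans) (intro add_mono mult_left_mono A; simp)
  also have "\<dots> = ennreal (2 * A + 2 * \<gamma>)" using A0 \<gamma> by (simp add: ennreal_mult ennreal_plus)
  finally have "ennreal n \<le> ennreal (2 * A + 2 * \<gamma>)" .
  moreover have "0 \<le> 2 * A + 2 * \<gamma>" using A0 \<gamma> by simp
  ultimately have n1: "n \<le> 2 * A + 2 * \<gamma>" by (simp only: ennreal_le_iff)
  \<comment> \<open>The absorption: \<open>2 * A\<close> contains
    \<open>24 * K\<^sup>2 * \<epsilon> * n\<close>, which is at most \<open>n / 2\<close> and moves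
    to the left side.\<close>
  have "48 * K\<^sup>2 * \<epsilon> * n \<le> 1 * n" using \<epsilon>(3) n by (intro mult_right_mono) auto
  then have n2: "n \<le> 16 * K\<^sup>2 * q * \<epsilon>\<^sup>2 + 4 * \<gamma>"
    using n1 by (simp add: A_def algebra_simps)
  have "A \<le> 12 * K\<^sup>2 * \<epsilon> * (16 * K\<^sup>2 * q * \<epsilon>\<^sup>2 + 4 * \<gamma>) + 4 * K\<^sup>2 * q * \<epsilon>\<^sup>2"
    unfolding A_def using \<epsilon> n2 by (intro add_right_mono mult_left_mono) auto
  also have "\<dots> = \<epsilon> * (48 * K\<^sup>2 * \<gamma> + 4 * K\<^sup>2 * q * \<epsilon>) + \<epsilon> * \<epsilon> * (192 * K ^ 4 * q * \<epsilon>)"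
    by (simp add: algebra_simps power2_eq_square power4_eq_xxxx)
  \<comment> \<open>A surplus factor \<open>\<epsilon>\<close> is given up so that both terms with
    \<open>q\<close> have the same order.\<close>
  also have "\<epsilon> * \<epsilon> * (192 * K ^ 4 * q * \<epsilon>) \<le> \<epsilon> * 1 * (192 * K ^ 4 * q * \<epsilon>)"
    using \<epsilon> q by (intro mult_right_mono mult_left_mono) auto
  finally have "A \<le> \<epsilon> * (48 * K\<^sup>2 * \<gamma> + (192 * K ^ 4 + 4 * K\<^sup>2) * q * \<epsilon>)"
    by (simp add: algebra_simps)
  with A show ?thesis unfolding q_def by (meson ennreal_leI order_trans)
qed

text \<open>\<open>L\<close> is a version of \<open>G\<close> at time \<open>t\<close> that is known
  at time \<open>t\<close>, a property \<open>G\<close> may lack. This makes the error of the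
  quotient orthogonal to \<open>J t\<close>; adding \<open>J t / \<epsilon>\<close> only enlarges
  the second moment and leaves the time average of \<open>\<Phi>\<close> minus \<open>G\<close> at
  \<open>t\<close>.\<close>

lemma difference_quotient_le:
  assumes L: "L \<in> borel_measurable (F t)" "sq_integrable M L" and LG: "AE \<omega> in M. L \<omega> = G \<omega> t"
  shows "(\<integral>\<^sup>+\<omega>. ennreal ((1 / \<epsilon> * (Y t \<omega> - y) - L \<omega>)\<^sup>2) \<partial>M)
    \<le> ennreal (1 / \<epsilon>) * (2 * energy t (u) (\<lambda>\<omega> r. \<Phi> \<omega> r - G \<omega> r)
        + 2 * energy t (u) (\<lambda>\<omega> r. G \<omega> r - G \<omega> t))"
proof -
  have tt: "t \<in> {t..u}" using \<epsilon> by simp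
  let ?U = "\<lambda>\<omega>. 1 / \<epsilon> * (Y t \<omega> - y) - L \<omega>"
  let ?V = "\<lambda>\<omega>. 1 / \<epsilon> * J t \<omega>"
  have Yt: "Y t \<in> borel_measurable (F t)" "sq_integrable M (Y t)"
    using Y_sq_integrable[of t] t \<epsilon> by auto
  have Um: "?U \<in> borel_measurable (F t)" using Yt(1) L(1) by measurable
  have Usq: "sq_integrable M ?U"
    by (intro sq_integrable_diff sq_integrable_cmult Yt L sq_integrable_const)
  have Vsq: "sq_integrable M ?V" by (intro sq_integrable_cmult J_sq_integrable tt)
  have "expectation (\<lambda>\<omega>. ?U \<omega> * ?V \<omega>) = expectation (\<lambda>\<omega>. 1 / \<epsilon> * (?U \<omega> * J t \<omega>))"
    by (simp only: mult_ac)
  also have "\<dots> = 0" using J_orthogonal[OF tt Um Usq] by (simp only: integral_mult_right_zero mult_zero_right)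
  finally have orth: "expectation (\<lambda>\<omega>. ?U \<omega> * ?V \<omega>) = 0" .
  let ?D = "\<lambda>\<omega> r. \<Phi> \<omega> r - G \<omega> t"
  have Gt: "(\<lambda>\<omega>. G \<omega> t) \<in> borel_measurable M"
    by (rule jointly_measurable_section(1)[OF jointly_measurable_G])
  have jGt: "jointly_measurable (\<lambda>\<omega> r. G \<omega> t)"
    using Gt unfolding jointly_measurable_def by measurable
  have jD: "jointly_measurable ?D" by (intro jointly_measurable_diff jointly_measurable_\<Phi> jGt)
  have [measurable]: "(\<lambda>x. \<Phi> (fst x) (snd x) - G (fst x) t) \<in> borel_measurable (M \<Otimes>\<^sub>M lborel)"
    using jD by (simp add: jointly_measurable_def)
  have "(\<integral>\<^sup>+\<omega>. ennreal ((?U \<omega>)\<^sup>2) \<partial>M) \<le> (\<integral>\<^sup>+\<omega>. ennreal ((?U \<omega> + ?V \<omega>)\<^sup>2) \<partial>M)"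
    by (rule orthogonal_square_le(1)[OF Usq Vsq orth])
  also have "\<dots> \<le> (\<integral>\<^sup>+\<omega>. ennreal (1 / \<epsilon>) * (\<integral>\<^sup>+r\<in>{t..u}. ennreal ((?D \<omega> r)\<^sup>2) \<partial>lborel) \<partial>M)"
  proof (rule nn_integral_mono_AE)
    show "AE \<omega> in M. ennreal ((?U \<omega> + ?V \<omega>)\<^sup>2) \<le> ennreal (1 / \<epsilon>) * (\<integral>\<^sup>+r\<in>{t..u}. ennreal ((?D \<omega> r)\<^sup>2) \<partial>lborel)"
      using drift_AE LG AE_space
    proof eventually_elim
      case (elim \<omega>)
      have Dm: "?D \<omega> \<in> borel_measurable borel"
        by (rule jointly_measurable_section(2)[OF jD elim(3)])
      have i1: "set_integrable lborel {t..u} (\<Phi> \<omega>)"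
        and e1: "Yh t \<omega> + J t \<omega> = (LINT r:{t..u}|lborel. \<Phi> \<omega> r)" using elim(1) tt by auto
      have i2: "set_integrable lborel {t..u} (\<lambda>r. G \<omega> t)"
        using \<epsilon> by (simp add: set_integrable_def)
      have "(LINT r:{t..u}|lborel. ?D \<omega> r) = Yh t \<omega> + J t \<omega> - \<epsilon> * G \<omega> t"
        using set_integral_diff(2)[OF i1 i2] \<epsilon> e1 by (simp add: set_lebesgue_integral_def)
      then have "(LINT r:{t..u}|lborel. ?D \<omega> r) = \<epsilon> * (?U \<omega> + ?V \<omega>)"
      proof -
        have "\<epsilon> * (?U \<omega> + ?V \<omega>) = (Y t \<omega> - y) + J t \<omega> - \<epsilon> * L \<omega>"
          using \<epsilon> by (simp add: distrib_left right_diff_distrib)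
        then show ?thesis using \<open>(LINT r:{t..u}|lborel. ?D \<omega> r) = _\<close> elim(2) by (simp add: Yh_def)
      qed
      then have "(?U \<omega> + ?V \<omega>)\<^sup>2 = (1 / \<epsilon>)\<^sup>2 * (LINT r:{t..u}|lborel. ?D \<omega> r)\<^sup>2"
        using \<epsilon> by (simp add: power_mult_distrib power_divide)
      then have "ennreal ((?U \<omega> + ?V \<omega>)\<^sup>2) = ennreal ((1 / \<epsilon>)\<^sup>2) * ennreal ((LINT r:{t..u}|lborel. ?D \<omega> r)\<^sup>2)"
        by (simp add: ennreal_mult)
      \<comment> \<open>Cauchy-Schwarz in time returns a factor \<open>\<epsilon>\<close>, so that
        \<open>1 / \<epsilon>\<close> remains, the weight of an average.\<close>
      also have "\<dots> \<le> ennreal ((1 / \<epsilon>)\<^sup>2) * (ennreal (u - t) * (\<integral>\<^sup>+r\<in>{t..u}. ennreal ((?D \<omega> r)\<^sup>2) \<partial>lborel))"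
        using \<epsilon> set_integral_diff(1)[OF i1 i2]
        by (intro mult_left_mono set_lebesgue_integral_square_le Dm) auto
      also have "\<dots> = ennreal ((1 / \<epsilon>)\<^sup>2 * \<epsilon>) * (\<integral>\<^sup>+r\<in>{t..u}. ennreal ((?D \<omega> r)\<^sup>2) \<partial>lborel)"
        using \<epsilon> by (simp add: ennreal_mult mult.assoc)
      also have "(1 / \<epsilon>)\<^sup>2 * \<epsilon> = 1 / \<epsilon>" using \<epsilon> by (simp add: power2_eq_square)
      finally show ?case .
    qed
  qed
  also have "\<dots> = ennreal (1 / \<epsilon>) * energy t (u) ?D"
    unfolding energy_fst[OF jD] by (rule nn_integral_cmult) measurable
  also have "energy t (u) ?D \<le> 2 * energy t (u) (\<lambda>\<omega> r. \<Phi> \<omega> r - G \<omega> r)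
        + 2 * energy t (u) (\<lambda>\<omega> r. G \<omega> r - G \<omega> t)"
    by (rule energy_le) (auto intro: square_diff_le jointly_measurable_diff jointly_measurable_\<Phi> jointly_measurable_G jGt)
  finally show ?thesis by (simp add: mult_left_mono)
qed

end

section \<open>The limit of the difference quotients\<close>

text \<open>Below the threshold \<open>d\<close> the first summand suffices; above it the exponent
  \<open>p - 2\<close> is negative, so \<open>\<bar>x\<bar> powr (p - 2)\<close> is at most its
  value at \<open>d\<close>.\<close>

lemma abs_powr_le:
  fixes d x p :: real
  assumes "1 \<le> p" "p < 2" "0 < d"
  shows "\<bar>x\<bar> powr p \<le> d powr p + d powr (p - 2) * x\<^sup>2"
proof (cases "\<bar>x\<bar> \<le> d")
  case True
  then have "\<bar>x\<bar> powr p \<le> d powr p" using assms by (intro powr_mono2) auto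
  then show ?thesis by (simp add: add_increasing2)
next
  case False
  then have x: "0 < \<bar>x\<bar>" "d \<le> \<bar>x\<bar>" using assms by auto
  have "\<bar>x\<bar> powr p = \<bar>x\<bar> powr (p - 2 + 2)" by simp
  also have "\<dots> = \<bar>x\<bar> powr (p - 2) * \<bar>x\<bar> powr 2" by (rule powr_add)
  also have "\<bar>x\<bar> powr 2 = x\<^sup>2" using x by simp
  also have "\<bar>x\<bar> powr (p - 2) * x\<^sup>2 \<le> d powr (p - 2) * x\<^sup>2"
    using assms x by (intro mult_right_mono powr_mono2') auto
  finally show ?thesis by (simp add: add_increasing)
qed

lemma tendsto_0_ennrealD:
  fixes f :: "'i \<Rightarrow> ennreal"
  assumes "(f \<longlongrightarrow> 0) F" "0 < (e::real)"
  shows "eventually (\<lambda>x. f x \<le> ennreal e) F"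
  using order_tendstoD(2)[OF assms(1), of "ennreal e"] assms(2) by (auto elim: eventually_mono)

context prob_space
begin

lemma sq_integrable_imp_in_Lp:
  assumes X: "sq_integrable M X" and p: "1 \<le> p" "p < 2"
  shows "in_Lp M p X"
proof -
  have [measurable]: "X \<in> borel_measurable M" by (rule sq_integrable_measurable[OF X])
  have "integrable M (\<lambda>\<omega>. \<bar>X \<omega>\<bar> powr p)"
  proof (rule Bochner_Integration.integrable_bound)
    show "integrable M (\<lambda>\<omega>. 1 + (X \<omega>)\<^sup>2)" using X by (simp add: sq_integrable_def)
    show "AE \<omega> in M. norm (\<bar>X \<omega>\<bar> powr p) \<le> norm (1 + (X \<omega>)\<^sup>2)"
      using abs_powr_le[OF p, of 1] by (intro AE_I2) simp
  qed measurable
  then show ?thesis by (simp add: in_Lp_def)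
qed

text \<open>With the threshold equal to the mean-square bound \<open>d\<close>, both summands of
  \<open>abs_powr_le\<close> integrate to at most \<open>d powr p\<close>. For
  \<open>p \<ge> 1\<close> the root \<open>2 powr (1 / p)\<close> is at most 2.\<close>

lemma Lp_norm_le:
  assumes X: "sq_integrable M X" and p: "1 \<le> p" "p < 2" and d: "0 < d"
    and le: "(\<integral>\<^sup>+\<omega>. ennreal ((X \<omega>)\<^sup>2) \<partial>M) \<le> ennreal (d\<^sup>2)"
  shows "Lp_norm M p X \<le> 2 * d"
proof -
  have i: "integrable M (\<lambda>\<omega>. (X \<omega>)\<^sup>2)" using X by (simp add: sq_integrable_def)
  have e: "expectation (\<lambda>\<omega>. (X \<omega>)\<^sup>2) \<le> d\<^sup>2"
    using le by (simp add: nn_integral_eq_integral[OF i])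
  have "expectation (\<lambda>\<omega>. \<bar>X \<omega>\<bar> powr p) \<le> expectation (\<lambda>\<omega>. d powr p + d powr (p - 2) * (X \<omega>)\<^sup>2)"
    using sq_integrable_imp_in_Lp[OF X p] i abs_powr_le[OF p d]
    by (intro integral_mono) (auto simp: in_Lp_def)
  also have "\<dots> = d powr p + d powr (p - 2) * expectation (\<lambda>\<omega>. (X \<omega>)\<^sup>2)"
    using i by (simp add: prob_space)
  also have "\<dots> \<le> d powr p + d powr (p - 2) * d\<^sup>2"
    using e by (intro add_left_mono mult_left_mono) auto
  also have "d powr (p - 2) * d\<^sup>2 = d powr p"
  proof -
    have "d\<^sup>2 = d powr 2" using d by simp
    then show ?thesis by (simp add: powr_add[symmetric])
  qed
  finally have "expectation (\<lambda>\<omega>. \<bar>X \<omega>\<bar> powr p) \<le> 2 * d powr p" by simp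
  then have "Lp_norm M p X \<le> (2 * d powr p) powr (1 / p)"
    unfolding Lp_norm_def using p by (intro powr_mono2) (auto intro: Bochner_Integration.integral_nonneg)
  also have "\<dots> = 2 powr (1 / p) * d" using d p by (simp add: powr_mult powr_powr)
  also have "\<dots> \<le> 2 powr 1 * d" using d p by (intro mult_right_mono powr_mono) auto
  finally show ?thesis by simp
qed

lemma Lp_tendsto_of_L2:
  assumes p: "1 \<le> p" "p < 2" and L: "sq_integrable M L" and X: "eventually (\<lambda>e. sq_integrable M (X e)) F"
    and lim: "((\<lambda>e. \<integral>\<^sup>+\<omega>. ennreal ((X e \<omega> - L \<omega>)\<^sup>2) \<partial>M) \<longlongrightarrow> 0) F"
  shows "Lp_tendsto M p X L F"
  unfolding Lp_tendsto_def
proof (intro conjI)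
  show "in_Lp M p L" by (rule sq_integrable_imp_in_Lp[OF L p])
  show "\<forall>\<^sub>F e in F. in_Lp M p (X e)"
    using X by eventually_elim (rule sq_integrable_imp_in_Lp[OF _ p])
  show "((\<lambda>e. Lp_norm M p (\<lambda>\<omega>. X e \<omega> - L \<omega>)) \<longlongrightarrow> 0) F"
    unfolding tendsto_iff
  proof (intro allI impI)
    fix r :: real assume r: "0 < r"
    have "eventually (\<lambda>e. (\<integral>\<^sup>+\<omega>. ennreal ((X e \<omega> - L \<omega>)\<^sup>2) \<partial>M) \<le> ennreal ((r / 4)\<^sup>2)) F"
      using r by (intro tendsto_0_ennrealD[OF lim]) simp
    with X show "\<forall>\<^sub>F e in F. dist (Lp_norm M p (\<lambda>\<omega>. X e \<omega> - L \<omega>)) 0 < r"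
    proof eventually_elim
      case (elim e)
      have "Lp_norm M p (\<lambda>\<omega>. X e \<omega> - L \<omega>) \<le> 2 * (r / 4)"
        using r by (intro Lp_norm_le sq_integrable_diff elim L p) auto
      moreover have "0 \<le> Lp_norm M p (\<lambda>\<omega>. X e \<omega> - L \<omega>)" by (simp add: Lp_norm_def)
      ultimately show ?case using r by (simp add: dist_real_def)
    qed
  qed
qed

end

text \<open>The given drift \<open>h\<close> is measurable only for the completed measure, but it
  agrees almost everywhere with the Borel function \<open>\<phi>\<close> obtained from the corrected
  generator. One null set serves all lower limits \<open>s\<close>.\<close>

lemma set_integral_lebesgue_eq_lborel:
  fixes h \<phi> :: "real \<Rightarrow> real"
  assumes h: "set_integrable lebesgue {a..b} h" and \<phi> [measurable]: "\<phi> \<in> borel_measurable borel"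
    and eq: "AE r in lborel. r \<in> {a..b} \<longrightarrow> h r = \<phi> r" and s: "a \<le> s"
  shows "set_integrable lborel {s..b} \<phi>" "(LINT r:{s..b}|lebesgue. h r) = (LINT r:{s..b}|lborel. \<phi> r)"
proof -
  have hs: "set_integrable lebesgue {s..b} h" using h by (rule set_integrable_subset) (use s in auto)
  have m: "(\<lambda>r. indicator {s..b} r *\<^sub>R \<phi> r) \<in> borel_measurable lborel" by measurable
  have AE: "AE r in lebesgue. indicator {s..b} r *\<^sub>R h r = indicator {s..b} r *\<^sub>R \<phi> r"
    using AE_completion[OF eq] by eventually_elim (use s in \<open>auto simp: indicator_def\<close>)
  have "integrable lebesgue (\<lambda>r. indicator {s..b} r *\<^sub>R \<phi> r)"
    using hs m AE unfolding set_integrable_def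
    by (rule integrable_cong_AE_imp[OF _ measurable_completion])
  then show "set_integrable lborel {s..b} \<phi>"
    unfolding set_integrable_def by (simp only: integrable_completion[OF m])
  have "(LINT r:{s..b}|lebesgue. h r) = (\<integral>r. indicator {s..b} r *\<^sub>R \<phi> r \<partial>lebesgue)"
    unfolding set_lebesgue_integral_def
    using hs by (intro integral_cong_AE[OF _ measurable_completion[OF m] AE])
      (auto simp only: set_integrable_def dest: borel_measurable_integrable)
  also have "\<dots> = (LINT r:{s..b}|lborel. \<phi> r)"
    unfolding set_lebesgue_integral_def by (rule integral_completion[OF m])
  finally show "(LINT r:{s..b}|lebesgue. h r) = (LINT r:{s..b}|lborel. \<phi> r)" .
qed

context lipschitz_generator
begin

text \<open>For almost every path \<open>f\<close> and \<open>g\<close> agree at almost every time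
  and for all arguments at once. Hence they agree along the solution, whatever values it
  takes.\<close>

lemma short_bsde_of_solution:
  assumes fg: "AE \<omega> in M. AE r in lborel. r \<in> {0..T} \<longrightarrow> (\<forall>y z. f \<omega> r y z = g \<omega> r y z)"
    and t: "0 \<le> t" and \<epsilon>: "0 < \<epsilon>" "\<epsilon> \<le> 1" "48 * K\<^sup>2 * \<epsilon> \<le> 1" "t + \<epsilon> \<le> T"
    and G: "energy t (t + \<epsilon>) (\<lambda>\<omega> r. f \<omega> r y z) < \<infinity>"
    and sol: "bsde_solution M B g (t + \<epsilon>) (\<lambda>\<omega>. y + z \<bullet> (B (t + \<epsilon>) \<omega> - B t \<omega>)) Y Z"
  obtains I where "short_bsde M B f K t \<epsilon> y z Y Z I"
proof -
  let ?u = "t + \<epsilon>"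
  have Yp: "progressive F ?u Y" and Zp: "progressive F ?u Z"
    and Ys: "(\<integral>\<^sup>+\<omega>. (SUP t\<in>{0..?u}. ennreal (\<bar>Y t \<omega>\<bar>\<^sup>2)) \<partial>M) < \<infinity>"
    and Ze: "(\<integral>\<^sup>+\<omega>. (\<integral>\<^sup>+t\<in>{0..?u}. ennreal ((norm (Z t \<omega>))\<^sup>2) \<partial>lborel) \<partial>M) < \<infinity>"
    and gi: "AE \<omega> in M. set_integrable lebesgue {0..?u} (\<lambda>s. g \<omega> s (Y s \<omega>) (Z s \<omega>))"
    using sol unfolding bsde_solution_def by blast+
  obtain I where I: "ito_integral M B ?u Z I"
    and eq: "AE \<omega> in M. \<forall>s\<in>{0..?u}. Y s \<omega> = y + z \<bullet> (B ?u \<omega> - B t \<omega>)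
        + (LINT r:{s..?u}|lebesgue. g \<omega> r (Y r \<omega>) (Z r \<omega>)) - (I ?u \<omega> - I s \<omega>)"
    using sol unfolding bsde_solution_def by blast
  have u0: "0 \<le> ?u" using t \<epsilon> by simp
  let ?\<Phi> = "\<lambda>\<omega> r. f \<omega> r (if r \<in> {0..?u} then Y r \<omega> else 0) (if r \<in> {0..?u} then Z r \<omega> else 0)"
  let ?P = "\<lambda>\<omega> s. set_integrable lborel {s..?u} (\<lambda>r. f \<omega> r (Y r \<omega>) (Z r \<omega>)) \<and>
      Y s \<omega> = y + z \<bullet> (B ?u \<omega> - B t \<omega>)
        + (LINT r:{s..?u}|lborel. f \<omega> r (Y r \<omega>) (Z r \<omega>)) - (I ?u \<omega> - I s \<omega>)"
  have "AE \<omega> in M. \<forall>s\<in>{t..?u}. ?P \<omega> s"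
    using gi eq fg AE_space
  proof eventually_elim
    case (elim \<omega>)
    have \<Phi>m: "?\<Phi> \<omega> \<in> borel_measurable borel"
      by (rule jointly_measurable_section(2)[OF jointly_measurable_compose[OF Yp Zp u0] elim(4)])
    have g\<Phi>: "AE r in lborel. r \<in> {0..?u} \<longrightarrow> g \<omega> r (Y r \<omega>) (Z r \<omega>) = ?\<Phi> \<omega> r"
      using elim(3) by eventually_elim (use \<epsilon> in auto)
    show ?case
    proof
      fix s assume s: "s \<in> {t..?u}"
      then have s0: "0 \<le> s" using t by simp
      note c = set_integral_lebesgue_eq_lborel[OF elim(1) \<Phi>m g\<Phi> s0]
      have 1: "set_integrable lborel {s..?u} (\<lambda>r. f \<omega> r (Y r \<omega>) (Z r \<omega>)) \<longleftrightarrow> set_integrable lborel {s..?u} (?\<Phi> \<omega>)"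
        by (rule set_integrable_cong) (use s0 in auto)
      have 2: "(LINT r:{s..?u}|lborel. f \<omega> r (Y r \<omega>) (Z r \<omega>)) = (LINT r:{s..?u}|lborel. ?\<Phi> \<omega> r)"
        by (rule set_lebesgue_integral_cong) (use s0 in auto)
      have "s \<in> {0..?u}" using s s0 by simp
      then have "Y s \<omega> = y + z \<bullet> (B ?u \<omega> - B t \<omega>)
            + (LINT r:{s..?u}|lebesgue. g \<omega> r (Y r \<omega>) (Z r \<omega>)) - (I ?u \<omega> - I s \<omega>)"
        by (rule bspec[OF elim(2)])
      then show "?P \<omega> s"
        unfolding 1 2 c(2)[symmetric] using c(1) by (rule conjI[rotated])
    qed
  qed
  with t \<epsilon> Yp Zp Ys Ze I G have "short_bsde M B f K t \<epsilon> y z Y Z I"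
    by (intro short_bsde.intro short_bsde_axioms.intro lipschitz_generator_axioms)
  then show thesis by (rule that)
qed

text \<open>Everything is controlled by the Lebesgue-point defect \<open>\<rho>\<close>: it bounds
  the energy of the generator on the short interval, and with it both parts of the quotient
  error.\<close>

lemma difference_quotient_L2_limit:
  assumes fg: "AE \<omega> in M. AE r in lborel. r \<in> {0..T} \<longrightarrow> (\<forall>y z. f \<omega> r y z = g \<omega> r y z)"
    and t: "0 \<le> t" "t < T"
    and sol: "\<forall>\<epsilon>\<in>{0<..T - t}.
        bsde_solution M B g (t + \<epsilon>) (\<lambda>\<omega>. y + z \<bullet> (B (t + \<epsilon>) \<omega> - B t \<omega>)) (Y \<epsilon>) (Z \<epsilon>)"
    and Lm: "L \<in> borel_measurable (F t)" and LG: "AE \<omega> in M. L \<omega> = f \<omega> t y z"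
    and fin: "(\<integral>\<^sup>+\<omega>. ennreal ((f \<omega> t y z)\<^sup>2) \<partial>M) < \<infinity>"
    and Lebesgue: "((\<lambda>\<epsilon>. ennreal (1 / \<epsilon>) * (\<integral>\<^sup>+r\<in>{t..t + \<epsilon>}. (\<integral>\<^sup>+\<omega>. ennreal ((f \<omega> r y z - f \<omega> t y z)\<^sup>2) \<partial>M) \<partial>lborel)) \<longlongrightarrow> 0) (at_right 0)"
  shows "sq_integrable M L"
    and "eventually (\<lambda>\<epsilon>. sq_integrable M (\<lambda>\<omega>. 1 / \<epsilon> * (Y \<epsilon> t \<omega> - y))) (at_right 0)"
    and "((\<lambda>\<epsilon>. \<integral>\<^sup>+\<omega>. ennreal ((1 / \<epsilon> * (Y \<epsilon> t \<omega> - y) - L \<omega>)\<^sup>2) \<partial>M) \<longlongrightarrow> 0) (at_right 0)"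
proof -
  define \<Gamma> where "\<Gamma> \<omega> r = f \<omega> r y z" for \<omega> r
  have \<Gamma>: "jointly_measurable \<Gamma>" using f_measurable[of y z] by (simp add: \<Gamma>_def[abs_def])
  have \<Gamma>t: "(\<lambda>\<omega>. \<Gamma> \<omega> t) \<in> borel_measurable M" by (rule jointly_measurable_section(1)[OF \<Gamma>])
  have j\<Gamma>t: "jointly_measurable (\<lambda>\<omega> r. \<Gamma> \<omega> t)"
    using \<Gamma>t unfolding jointly_measurable_def by measurable
  have j\<Gamma>d: "jointly_measurable (\<lambda>\<omega> r. \<Gamma> \<omega> r - \<Gamma> \<omega> t)"
    using \<Gamma> j\<Gamma>t unfolding jointly_measurable_def by (rule borel_measurable_diff)
  define e where "e = (\<integral>\<^sup>+\<omega>. ennreal ((\<Gamma> \<omega> t)\<^sup>2) \<partial>M)"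
  have e: "e < \<infinity>" using fin by (simp add: e_def \<Gamma>_def)
  have "(\<integral>\<^sup>+\<omega>. ennreal ((L \<omega>)\<^sup>2) \<partial>M) = e"
    unfolding e_def \<Gamma>_def using LG by (intro nn_integral_cong_AE) (auto elim!: eventually_mono)
  then show Lsq: "sq_integrable M L"
    using e F_measurable[OF Lm] by (simp add: sq_integrable_iff_nn_integral)
  define \<rho> where "\<rho> \<epsilon> = ennreal (1 / \<epsilon>) * energy t (t + \<epsilon>) (\<lambda>\<omega> r. \<Gamma> \<omega> r - \<Gamma> \<omega> t)" for \<epsilon>
  have \<rho>0: "(\<rho> \<longlongrightarrow> 0) (at_right 0)"
    using Lebesgue unfolding \<rho>_def energy_snd[OF j\<Gamma>d] by (simp add: \<Gamma>_def)
  have \<Gamma>_energy: "energy t (t + \<epsilon>) \<Gamma> \<le> 2 * \<rho> \<epsilon> + 2 * (ennreal \<epsilon> * e)" if \<epsilon>: "0 < \<epsilon>" "\<epsilon> \<le> 1" for \<epsilon>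
  proof -
    have "energy t (t + \<epsilon>) \<Gamma> \<le> 2 * energy t (t + \<epsilon>) (\<lambda>\<omega> r. \<Gamma> \<omega> r - \<Gamma> \<omega> t) + 2 * energy t (t + \<epsilon>) (\<lambda>\<omega> r. \<Gamma> \<omega> t)"
      by (rule energy_le[OF _ j\<Gamma>d j\<Gamma>t]) (use square_diff_le[of "\<Gamma> _ _" 0 "\<Gamma> _ t"] in simp)
    also have "energy t (t + \<epsilon>) (\<lambda>\<omega> r. \<Gamma> \<omega> t) = ennreal \<epsilon> * e"
      using energy_section[OF \<Gamma>t, of t "t + \<epsilon>"] \<epsilon> by (simp add: e_def)
    also have "energy t (t + \<epsilon>) (\<lambda>\<omega> r. \<Gamma> \<omega> r - \<Gamma> \<omega> t) \<le> \<rho> \<epsilon>"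
    proof -
      \<comment> \<open>Since \<open>\<epsilon> \<le> 1\<close>, the energy is at most its average
        \<open>\<rho> \<epsilon>\<close>.\<close>
      have "1 * energy t (t + \<epsilon>) (\<lambda>\<omega> r. \<Gamma> \<omega> r - \<Gamma> \<omega> t) \<le> \<rho> \<epsilon>"
        unfolding \<rho>_def using \<epsilon> by (intro mult_right_mono) (auto simp: ennreal_1[symmetric] simp del: ennreal_1 intro!: ennreal_leI)
      then show ?thesis by simp
    qed
    finally show ?thesis by (simp add: add_mono mult_left_mono)
  qed
  define c where "c = (192 * K ^ 4 + 4 * K\<^sup>2) * (norm z)\<^sup>2"
  have c: "0 \<le> c" by (simp add: c_def)
  \<comment> \<open>The bracket of \<open>energy_diff_bound\<close>, with the energy of the
    generator replaced by its bound \<open>\<Gamma>_energy\<close>, plus the Lebesgue-point defect;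
    both are doubled as in \<open>difference_quotient_le\<close>.\<close>
  define R where "R \<epsilon> = 2 * (ennreal (48 * K\<^sup>2) * (2 * \<rho> \<epsilon> + 2 * (ennreal \<epsilon> * e)) + ennreal (c * \<epsilon>)) + 2 * \<rho> \<epsilon>" for \<epsilon>
  have "(R \<longlongrightarrow> 2 * (ennreal (48 * K\<^sup>2) * (2 * 0 + 2 * (ennreal 0 * e)) + ennreal (c * 0)) + 2 * 0) (at_right 0)"
    unfolding R_def[abs_def] mult.commute[of "ennreal _" e] using e
    by (intro tendsto_add ennreal_tendsto_cmult \<rho>0 tendsto_ennrealI tendsto_mult tendsto_const tendsto_ident_at) auto
  then have R0: "(R \<longlongrightarrow> 0) (at_right 0)" by simp
  \<comment> \<open>This respects the horizon \<open>T\<close>, the bound 1 and the smallness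
    condition; the added 1 in the denominator covers \<open>K = 0\<close>.\<close>
  define \<epsilon>0 where "\<epsilon>0 = min (T - t) (min 1 (1 / (48 * K\<^sup>2 + 1)))"
  have \<epsilon>0: "0 < \<epsilon>0" using t by (simp add: \<epsilon>0_def add_nonneg_pos)
  have small: "eventually (\<lambda>\<epsilon>. 0 < \<epsilon> \<and> \<epsilon> < \<epsilon>0) (at_right 0)"
    using \<epsilon>0 eventually_at_right_field by blast
  have "eventually (\<lambda>\<epsilon>. \<rho> \<epsilon> < \<infinity>) (at_right 0)"
    using \<rho>0 by (rule order_tendstoD) simp
  with small have ev: "eventually (\<lambda>\<epsilon>. \<exists>I. short_bsde M B f K t \<epsilon> y z (Y \<epsilon>) (Z \<epsilon>) I) (at_right 0)"
  proof eventually_elim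
    case (elim \<epsilon>)
    then have \<epsilon>: "0 < \<epsilon>" "\<epsilon> \<le> 1" "t + \<epsilon> \<le> T" "\<epsilon> \<in> {0<..T - t}" "\<epsilon> \<le> 1 / (48 * K\<^sup>2 + 1)"
      by (auto simp: \<epsilon>0_def)
    have "48 * K\<^sup>2 * \<epsilon> \<le> (48 * K\<^sup>2 + 1) * \<epsilon>" using \<epsilon> by (intro mult_right_mono) auto
    also have "\<dots> \<le> (48 * K\<^sup>2 + 1) * (1 / (48 * K\<^sup>2 + 1))" using \<epsilon> by (intro mult_left_mono) auto
    also have "\<dots> = 1" by (simp add: add_nonneg_eq_0_iff)
    finally have \<epsilon>K: "48 * K\<^sup>2 * \<epsilon> \<le> 1" .
    have "2 * \<rho> \<epsilon> + 2 * (ennreal \<epsilon> * e) < \<infinity>" using elim e by (simp add: ennreal_mult_less_top)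
    then have "energy t (t + \<epsilon>) (\<lambda>\<omega> r. f \<omega> r y z) < \<infinity>"
      using le_less_trans[OF \<Gamma>_energy[OF \<epsilon>(1,2)]] by (simp add: \<Gamma>_def[abs_def])
    from short_bsde_of_solution[OF fg t(1) \<epsilon>(1,2) \<epsilon>K \<epsilon>(3) this bspec[OF sol \<epsilon>(4)]]
    show ?case by blast
  qed
  show "eventually (\<lambda>\<epsilon>. sq_integrable M (\<lambda>\<omega>. 1 / \<epsilon> * (Y \<epsilon> t \<omega> - y))) (at_right 0)"
    using ev small
  proof eventually_elim
    case (elim \<epsilon>)
    then obtain I where "short_bsde M B f K t \<epsilon> y z (Y \<epsilon>) (Z \<epsilon>) I" by blast
    then interpret S: short_bsde M B f K t \<epsilon> y z "Y \<epsilon>" "Z \<epsilon>" I .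
    show ?case using t elim by (intro sq_integrable_cmult sq_integrable_diff S.Y_sq_integrable sq_integrable_const) auto
  qed
  show "((\<lambda>\<epsilon>. \<integral>\<^sup>+\<omega>. ennreal ((1 / \<epsilon> * (Y \<epsilon> t \<omega> - y) - L \<omega>)\<^sup>2) \<partial>M) \<longlongrightarrow> 0) (at_right 0)"
  proof (rule tendsto_sandwich[OF _ _ tendsto_const R0])
    show "eventually (\<lambda>\<epsilon>. (\<integral>\<^sup>+\<omega>. ennreal ((1 / \<epsilon> * (Y \<epsilon> t \<omega> - y) - L \<omega>)\<^sup>2) \<partial>M) \<le> R \<epsilon>) (at_right 0)"
      using ev small
    proof eventually_elim
      case (elim \<epsilon>)
      then obtain I where "short_bsde M B f K t \<epsilon> y z (Y \<epsilon>) (Z \<epsilon>) I" by blast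
      then interpret S: short_bsde M B f K t \<epsilon> y z "Y \<epsilon>" "Z \<epsilon>" I .
      have \<epsilon>: "0 < \<epsilon>" "\<epsilon> \<le> 1" using S.\<epsilon> by auto
      have G: "S.G = \<Gamma>" by (intro ext) (simp add: S.G_def \<Gamma>_def)
      define \<gamma> where "\<gamma> = enn2real (energy t (t + \<epsilon>) \<Gamma>)"
      have \<gamma>: "energy t (t + \<epsilon>) \<Gamma> = ennreal \<gamma>" "0 \<le> \<gamma>"
        using S.G_energy by (simp_all add: \<gamma>_def \<Gamma>_def[abs_def])
      have "(\<integral>\<^sup>+\<omega>. ennreal ((1 / \<epsilon> * (Y \<epsilon> t \<omega> - y) - L \<omega>)\<^sup>2) \<partial>M)
          \<le> ennreal (1 / \<epsilon>) * (2 * energy t (t + \<epsilon>) (\<lambda>\<omega> r. S.\<Phi> \<omega> r - \<Gamma> \<omega> r)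
            + 2 * energy t (t + \<epsilon>) (\<lambda>\<omega> r. \<Gamma> \<omega> r - \<Gamma> \<omega> t))"
        using S.difference_quotient_le[OF Lm Lsq] LG by (simp add: G \<Gamma>_def)
      also have "\<dots> = 2 * (ennreal (1 / \<epsilon>) * energy t (t + \<epsilon>) (\<lambda>\<omega> r. S.\<Phi> \<omega> r - \<Gamma> \<omega> r)) + 2 * \<rho> \<epsilon>"
        by (simp only: \<rho>_def distrib_left mult_ac)
      also have "ennreal (1 / \<epsilon>) * energy t (t + \<epsilon>) (\<lambda>\<omega> r. S.\<Phi> \<omega> r - \<Gamma> \<omega> r)
          \<le> ennreal (1 / \<epsilon>) * ennreal (\<epsilon> * (48 * K\<^sup>2 * \<gamma> + c * \<epsilon>))"
        using S.energy_diff_bound unfolding G c_def \<gamma>_def by (intro mult_left_mono) auto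
      also have "\<dots> = ennreal (48 * K\<^sup>2 * \<gamma> + c * \<epsilon>)"
        using \<epsilon> c \<gamma>(2) by (subst ennreal_mult[symmetric]) auto
      also have "\<dots> = ennreal (48 * K\<^sup>2) * energy t (t + \<epsilon>) \<Gamma> + ennreal (c * \<epsilon>)"
        unfolding \<gamma>(1) using \<epsilon> c \<gamma>(2) by (subst ennreal_plus) (auto simp: ennreal_mult)
      also have "\<dots> \<le> ennreal (48 * K\<^sup>2) * (2 * \<rho> \<epsilon> + 2 * (ennreal \<epsilon> * e)) + ennreal (c * \<epsilon>)"
        by (intro add_mono mult_left_mono \<Gamma>_energy \<epsilon>) auto
      finally show ?case by (simp add: R_def add_mono mult_left_mono)
    qed
  qed simp
qed

end

section \<open>Passage from the given generator to an everywhere Lipschitz one\<close>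

theorem lemma2p1:
  fixes M :: "'a measure"
    and B :: "real \<Rightarrow> 'a \<Rightarrow> real ^ 'd"
    and g :: "'a \<Rightarrow> real \<Rightarrow> real \<Rightarrow> real ^ 'd \<Rightarrow> real"
    and T p y :: real
    and z :: "real ^ 'd"
  assumes "prob_space M"
    and "standard_brownian_motion M B"
    and "T > 0"
    and "\<And>y z. progressive (augmented_filtration M B) T (\<lambda>t \<omega>. g \<omega> t y z)"
    and A1: "\<exists>K\<ge>0. AE (\<omega>, t) in M \<Otimes>\<^sub>M lborel. t \<in> {0..T} \<longrightarrow>
           (\<forall>y\<^sub>1 y\<^sub>2 z\<^sub>1 z\<^sub>2. \<bar>g \<omega> t y\<^sub>1 z\<^sub>1 - g \<omega> t y\<^sub>2 z\<^sub>2\<bar> \<le> K * (\<bar>y\<^sub>1 - y\<^sub>2\<bar> + norm (z\<^sub>1 - z\<^sub>2)))"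
    and A2: "(\<integral>\<^sup>+\<omega>. (\<integral>\<^sup>+t\<in>{0..T}. ennreal (\<bar>g \<omega> t 0 0\<bar>\<^sup>2) \<partial>lborel) \<partial>M) < \<infinity>"
    and "1 \<le> p" "p < 2"
  shows "AE t in lborel. t \<in> {0..<T} \<longrightarrow>
           (\<forall>Y Z. (\<forall>\<epsilon>\<in>{0<..T - t}.
                bsde_solution M B g (t + \<epsilon>) (\<lambda>\<omega>. y + z \<bullet> (B (t + \<epsilon>) \<omega> - B t \<omega>)) (Y \<epsilon>) (Z \<epsilon>)) \<longrightarrow>
              Lp_tendsto M p (\<lambda>\<epsilon> \<omega>. (1 / \<epsilon>) * (Y \<epsilon> t \<omega> - y)) (\<lambda>\<omega>. g \<omega> t y z) (at_right 0))"
proof -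
  interpret prob_space M by fact
  interpret brownian_motion M B by unfold_locales fact
  interpret P: pair_sigma_finite M lborel ..
  note prog = assms(4)
  define lipschitz where "lipschitz K x \<longleftrightarrow> (snd x \<in> {0..T} \<longrightarrow>
      (\<forall>y\<^sub>1 y\<^sub>2 z\<^sub>1 z\<^sub>2. \<bar>g (fst x) (snd x) y\<^sub>1 z\<^sub>1 - g (fst x) (snd x) y\<^sub>2 z\<^sub>2\<bar> \<le> K * (\<bar>y\<^sub>1 - y\<^sub>2\<bar> + norm (z\<^sub>1 - z\<^sub>2))))" for K x
  obtain K where K: "0 \<le> K" and lip: "AE x in M \<Otimes>\<^sub>M lborel. lipschitz K x"
    using A1 by (auto simp: case_prod_beta' lipschitz_def)
  \<comment> \<open>The failure set involves all \<open>y\<close> and \<open>z\<close> at once and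
    need not be measurable; \<open>N\<close> is a measurable null set covering it.\<close>
  from AE_E[OF lip] obtain N where
    N: "{x \<in> space (M \<Otimes>\<^sub>M lborel). \<not> lipschitz K x} \<subseteq> N"
    and N0: "emeasure (M \<Otimes>\<^sub>M lborel) N = 0" and Ns: "N \<in> sets (M \<Otimes>\<^sub>M lborel)"
    by blast
  \<comment> \<open>Since \<open>N\<close> does not depend on \<open>(y, z)\<close>, setting the
    generator to 0 there preserves the Lipschitz bound. Vanishing outside \<open>[0, T]\<close>
    makes \<open>f\<close> a function on the whole time line.\<close>
  define f where "f \<omega> r y z = (if (\<omega>, r) \<in> N then 0 else if r \<in> {0..T} then g \<omega> r y z else 0)" for \<omega> r y z
  have fm: "jointly_measurable (\<lambda>\<omega> r. f \<omega> r y z)" for y z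
  proof -
    have "(\<lambda>x. if snd x \<in> {0..T} then g (fst x) (snd x) y z else 0) \<in> borel_measurable (M \<Otimes>\<^sub>M lborel)"
      using progressive_measurable[OF prog, of y z] \<open>T > 0\<close> by (simp add: case_prod_beta')
    then have "(\<lambda>x. if x \<in> N then 0 else if snd x \<in> {0..T} then g (fst x) (snd x) y z else 0) \<in> borel_measurable (M \<Otimes>\<^sub>M lborel)"
      using Ns by (intro measurable_If_set) auto
    then show ?thesis by (simp add: jointly_measurable_def f_def)
  qed
  have fl: "\<bar>f \<omega> r y z - f \<omega> r y' z'\<bar> \<le> K * (\<bar>y - y'\<bar> + norm (z - z'))" if "\<omega> \<in> space M" for \<omega> r y z y' z'
  proof (cases "(\<omega>, r) \<in> N \<or> r \<notin> {0..T}")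
    case True
    then have "f \<omega> r y z - f \<omega> r y' z' = 0" by (auto simp: f_def)
    then show ?thesis using K by simp
  next
    case False
    then have "lipschitz K (\<omega>, r)"
      using N that by (auto simp: space_pair_measure)
    then have "\<bar>g \<omega> r y z - g \<omega> r y' z'\<bar> \<le> K * (\<bar>y - y'\<bar> + norm (z - z'))"
      using False by (simp add: lipschitz_def)
    then show ?thesis using False by (simp add: f_def)
  qed
  interpret lipschitz_generator M B f K
    by unfold_locales (fact K fm fl)+
  have "AE x in M \<Otimes>\<^sub>M lborel. x \<notin> N"
    using N0 Ns by (intro AE_not_in) (auto simp: null_sets_def)
  then have NAE1: "AE \<omega> in M. AE r in lborel. (\<omega>, r) \<notin> N" by (rule P.AE_pair)
  \<comment> \<open>Both orders are used: almost every path at almost every time for the drift of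
    the equation, almost every time for almost every outcome to identify the limit at a fixed
    \<open>t\<close>.\<close>
  have "AE r in lborel. AE \<omega> in M. (\<omega>, r) \<notin> N"
  proof (rule P.AE_commute[THEN iffD1, OF _ NAE1])
    have "{x \<in> space (M \<Otimes>\<^sub>M lborel). (fst x, snd x) \<notin> N} = space (M \<Otimes>\<^sub>M lborel) - N" by auto
    then show "{x \<in> space (M \<Otimes>\<^sub>M lborel). (fst x, snd x) \<notin> N} \<in> sets (M \<Otimes>\<^sub>M lborel)" 
      using sets.compl_sets[OF Ns] by (simp only:)
  qed
  then have gf: "AE r in lborel. r \<in> {0..T} \<longrightarrow> (AE \<omega> in M. g \<omega> r y z = f \<omega> r y z)"
    by (rule eventually_mono) (auto simp: f_def elim!: eventually_mono)
  have fg: "AE \<omega> in M. AE r in lborel. r \<in> {0..T} \<longrightarrow> (\<forall>y z. f \<omega> r y z = g \<omega> r y z)"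
    using NAE1 by (rule eventually_mono) (auto simp: f_def elim!: eventually_mono)
  \<comment> \<open>The Lipschitz bound compares \<open>(y, z)\<close> with \<open>(0, 0)\<close>,
    where \<open>A2\<close> applies; the difference is bounded by a constant on a finite
    interval.\<close>
  have "(\<integral>\<^sup>+\<omega>. (\<integral>\<^sup>+r. ennreal ((f \<omega> r y z)\<^sup>2) \<partial>lborel) \<partial>M) < \<infinity>"
  proof -
    let ?c = "K * (\<bar>y\<bar> + norm z)"
    have "(\<integral>\<^sup>+\<omega>. (\<integral>\<^sup>+r. ennreal ((f \<omega> r y z)\<^sup>2) \<partial>lborel) \<partial>M) = energy 0 T (\<lambda>\<omega> r. f \<omega> r y z)"
      unfolding energy_fst[OF fm] by (intro nn_integral_cong) (auto simp: f_def indicator_def)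
    also have "\<dots> \<le> 2 * energy 0 T (\<lambda>\<omega> r. f \<omega> r 0 0) + 2 * energy 0 T (\<lambda>\<omega> r. ?c)"
    proof (rule energy_le)
      fix \<omega> r assume \<omega>: "\<omega> \<in> space M"
      have "\<bar>f \<omega> r y z - f \<omega> r 0 0\<bar> \<le> ?c" using fl[OF \<omega>, of r y z 0 0] by simp
      then have "(f \<omega> r y z - f \<omega> r 0 0)\<^sup>2 \<le> ?c\<^sup>2"
        using power_mono[of "\<bar>f \<omega> r y z - f \<omega> r 0 0\<bar>" ?c 2] by simp
      then show "(f \<omega> r y z)\<^sup>2 \<le> 2 * (f \<omega> r 0 0)\<^sup>2 + 2 * ?c\<^sup>2"
        using square_diff_le[of "f \<omega> r y z" 0 "f \<omega> r 0 0"] by simp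
    qed (simp_all add: fm, simp add: jointly_measurable_def)
    also have "\<dots> < \<infinity>"
    proof -
      have "energy 0 T (\<lambda>\<omega> r. f \<omega> r 0 0) \<le> (\<integral>\<^sup>+\<omega>. (\<integral>\<^sup>+t\<in>{0..T}. ennreal (\<bar>g \<omega> t 0 0\<bar>\<^sup>2) \<partial>lborel) \<partial>M)"
        unfolding energy_fst[OF fm] by (intro nn_integral_mono) (auto simp: f_def indicator_def)
      then have "energy 0 T (\<lambda>\<omega> r. f \<omega> r 0 0) < \<infinity>" using A2 by (rule le_less_trans)
      moreover have "energy 0 T (\<lambda>\<omega> r. ?c) < \<infinity>"
        using \<open>T > 0\<close> by (subst energy_section) (auto simp: emeasure_space_1 ennreal_mult[symmetric])
      ultimately show ?thesis by (simp add: ennreal_mult_less_top)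
    qed
    finally show ?thesis .
  qed
  moreover have "(\<lambda>(\<omega>, r). f \<omega> r y z) \<in> borel_measurable (M \<Otimes>\<^sub>M borel)"
    using fm[of y z] by (simp add: jointly_measurable_def case_prod_beta')
  ultimately have "AE t in lborel. (\<integral>\<^sup>+\<omega>. ennreal ((f \<omega> t y z)\<^sup>2) \<partial>M) < \<infinity> \<and>
    ((\<lambda>\<epsilon>. ennreal (1 / \<epsilon>) * (\<integral>\<^sup>+r\<in>{t..t + \<epsilon>}. (\<integral>\<^sup>+\<omega>. ennreal ((f \<omega> r y z - f \<omega> t y z)\<^sup>2) \<partial>M) \<partial>lborel)) \<longlongrightarrow> 0) (at_right 0)"
    by (intro L2_Lebesgue_points)
  \<comment> \<open>The exceptional times are settled here, before \<open>Y\<close> and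
    \<open>Z\<close> are introduced.\<close>
  with gf show ?thesis
  proof (eventually_elim, intro impI allI)
    fix t Y Z
    assume gf': "t \<in> {0..T} \<longrightarrow> (AE \<omega> in M. g \<omega> t y z = f \<omega> t y z)"
      and leb: "(\<integral>\<^sup>+\<omega>. ennreal ((f \<omega> t y z)\<^sup>2) \<partial>M) < \<infinity> \<and>
        ((\<lambda>\<epsilon>. ennreal (1 / \<epsilon>) * (\<integral>\<^sup>+r\<in>{t..t + \<epsilon>}. (\<integral>\<^sup>+\<omega>. ennreal ((f \<omega> r y z - f \<omega> t y z)\<^sup>2) \<partial>M) \<partial>lborel)) \<longlongrightarrow> 0) (at_right 0)"
      and t: "t \<in> {0..<T}"
      and sol: "\<forall>\<epsilon>\<in>{0<..T - t}.
        bsde_solution M B g (t + \<epsilon>) (\<lambda>\<omega>. y + z \<bullet> (B (t + \<epsilon>) \<omega> - B t \<omega>)) (Y \<epsilon>) (Z \<epsilon>)"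
    \<comment> \<open>The original \<open>g\<close> is progressive and supplies the
      \<open>F t\<close>-measurable version \<open>L\<close> of the corrected generator at time
      \<open>t\<close>.\<close>
    have Lm: "(\<lambda>\<omega>. g \<omega> t y z) \<in> borel_measurable (F t)"
      using t by (intro progressive_adapted[OF prog]) auto
    have LG: "AE \<omega> in M. g \<omega> t y z = f \<omega> t y z" using gf' t by simp
    have t': "0 \<le> t" "t < T" using t by auto
    note lim = difference_quotient_L2_limit[OF fg t' sol Lm LG conjunct1[OF leb] conjunct2[OF leb]]
    show "Lp_tendsto M p (\<lambda>\<epsilon> \<omega>. (1 / \<epsilon>) * (Y \<epsilon> t \<omega> - y)) (\<lambda>\<omega>. g \<omega> t y z) (at_right 0)"
      by (rule Lp_tendsto_of_L2[OF \<open>1 \<le> p\<close> \<open>p < 2\<close> lim])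
  qed
qed

end
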